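(* For every integer $k\ge 0$, as $n\to\infty$, $$u_{2k}(n) \sim (-1)^k\, 2^{2k-3}\, 3^{k-\frac34}\, B_{2k}\!\left(\tfrac12\right) n^{k-\frac54} e^{2\pi\sqrt{\frac n3}},$$ where $u_{2k}(n):=\sum_{m\in\mathbb Z} m^{2k}u(m,n)$.
   Context: A unimodal sequence (with designated peak) of size $n$ is a sequence of positive integers $a_1\le a_2\le\cdots\le a_r\le \overline{c}\ge b_s\ge\cdots\ge b_1$ with $a_1+\cdots+a_r+c+b_s+\cdots+b_1=n$, where $r,s\ge 0$ and the part $c$ is marked as the peak (so if the largest part is repeated, sequences differing in which copy is marked are counted as different). Its rank is $s-r$ (number of parts after the peak minus number of parts before the peak). $u(m,n)$ denotes the number of unimodal sequences of size $n$ with rank $m$. $B_\ell(x)$ denotes the $\ell$-th Bernoulli polynomial. *)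

theory Defs
  imports
    "HOL-Analysis.Analysis"
    "HOL-Library.Landau_Symbols"
    "HOL-Computational_Algebra.Formal_Power_Series"
begin

text \<open>
  A triple \<open>(as, c, bs)\<close> stands for the sequence \<open>as @ [c] @ bs\<close> whose peak is the displayed
  copy of \<open>c\<close>; \<open>bs\<close> lists the parts after the peak in the order in which they are written,
  hence weakly decreasing.
\<close>

definition unimodal_seqs :: "nat \<Rightarrow> (nat list \<times> nat \<times> nat list) set" where
  "unimodal_seqs n = {(as, c, bs).
     sorted_wrt (\<le>) (as @ [c]) \<and> sorted_wrt (\<ge>) (c # bs) \<and>
     (\<forall>x \<in> set (as @ [c] @ bs). 0 < x) \<and> sum_list (as @ [c] @ bs) = n}"

definition unimodal_rank :: "nat list \<times> nat \<times> nat list \<Rightarrow> int" where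
  "unimodal_rank = (\<lambda>(as, c, bs). int (length bs) - int (length as))"

definition u :: "int \<Rightarrow> nat \<Rightarrow> nat" where
  "u m n = card {t \<in> unimodal_seqs n. unimodal_rank t = m}"

definition u_moment :: "nat \<Rightarrow> nat \<Rightarrow> real" where
  "u_moment j n = (\<Sum>\<^sub>\<infinity>m::int. real_of_int m ^ j * real (u m n))"

text \<open>
  The generating function \<open>t e\<^bsup>x t\<^esup> / (e\<^bsup>t\<^esup> - 1) = (\<Sum>l. B\<^sub>l(x) t\<^bsup>l\<^esup> / l!)\<close>. Numerator and denominator both
  have order \<open>1\<close> at \<open>t = 0\<close>, so the quotient of formal power series is exact.
\<close>

definition bernoulli_poly :: "nat \<Rightarrow> real \<Rightarrow> real" where
  "bernoulli_poly l x = fact l * fps_nth (fps_X * fps_exp x / (fps_exp 1 - 1)) l"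

lemma bernoulli_poly_gf:
  "Abs_fps (\<lambda>l. bernoulli_poly l x / fact l) * (fps_exp 1 - 1) = fps_X * fps_exp x"
proof -
  let ?d = "fps_exp 1 - 1 :: real fps"
  have n0: "fps_nth ?d 0 = 0" and n1: "fps_nth ?d 1 \<noteq> 0"
    by simp_all
  have sd: "subdegree ?d = 1"
    by (rule subdegreeI) (use n0 n1 in auto)
  have "?d dvd fps_X * fps_exp x"
    using sd by (subst fps_dvd_iff) auto
  moreover have "Abs_fps (\<lambda>l. bernoulli_poly l x / fact l) = fps_X * fps_exp x / ?d"
    by (rule fps_ext) (simp add: bernoulli_poly_def)
  ultimately show ?thesis
    by simp
qed

lemma length_le_sum_list: "(\<forall>x\<in>set xs. 0 < x) \<Longrightarrow> length xs \<le> sum_list xs" for xs :: "nat list"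
  by (induction xs) auto

lemma finite_unimodal_seqs: "finite (unimodal_seqs n)"
proof -
  let ?L = "{xs. set xs \<subseteq> {..n} \<and> length xs \<le> n}"
  have "unimodal_seqs n \<subseteq> ?L \<times> {..n} \<times> ?L"
  proof (rule subsetI)
    fix t assume "t \<in> unimodal_seqs n"
    then obtain as c bs where t: "t = (as, c, bs)"
      and pos: "\<forall>x \<in> set (as @ [c] @ bs). 0 < x" and s: "sum_list (as @ [c] @ bs) = n"
      by (auto simp: unimodal_seqs_def)
    have "x \<le> n" if "x \<in> set (as @ [c] @ bs)" for x
      using member_le_sum_list[OF that] s by simp
    moreover have "length (as @ [c] @ bs) \<le> n"
      using length_le_sum_list[OF pos] s by simp
    ultimately show "t \<in> ?L \<times> {..n} \<times> ?L"
      using t by auto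
  qed
  moreover have "finite (?L \<times> {..n} \<times> ?L)"
    by (intro finite_cartesian_product finite_lists_length_le) auto
  ultimately show ?thesis
    by (rule finite_subset)
qed

lemma finite_u_support: "finite {m. u m n \<noteq> 0}"
proof (rule finite_subset)
  show "{m. u m n \<noteq> 0} \<subseteq> unimodal_rank ` unimodal_seqs n"
  proof
    fix m assume "m \<in> {m. u m n \<noteq> 0}"
    then have "{t \<in> unimodal_seqs n. unimodal_rank t = m} \<noteq> {}"
      unfolding u_def by force
    then show "m \<in> unimodal_rank ` unimodal_seqs n"
      by auto
  qed
qed (simp add: finite_unimodal_seqs)

lemma u_moment_finite_sum:
  "u_moment j n = (\<Sum>m\<in>{m. u m n \<noteq> 0}. real_of_int m ^ j * real (u m n))"
proof -
  have "u_moment j n = (\<Sum>\<^sub>\<infinity>m\<in>{m. u m n \<noteq> 0}. real_of_int m ^ j * real (u m n))"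
    unfolding u_moment_def by (rule infsum_cong_neutral) auto
  then show ?thesis
    by (simp only: infsum_finite[OF finite_u_support])
qed

end

theory Submission
  imports
    Defs
    "HOL-Library.Multiset"
    "HOL-Real_Asymp.Real_Asymp"
    "HOL-Complex_Analysis.Complex_Analysis"
    "HOL-Probability.Probability"
begin

text \<open>
  Moving the peak into the left half turns a unimodal sequence into a pair of partitions \<open>(L, M)\<close> with
  \<open>Max L \<ge> Max M\<close>, whose rank is \<open>1 - D\<close> for \<open>D = size L - size M\<close>. By the symmetry \<open>L \<leftrightarrow> M\<close>, and since
  pairs with equal largest parts are negligible, \<open>u\<^bsub>2k\<^esub>(n)\<close> is asymptotically half of the moment
  \<open>A\<^bsub>2k\<^esub>(n)\<close> of \<open>D\<close> over all pairs of total size \<open>n\<close>.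

  Removing \<open>m\<close> copies of a part \<open>d\<close> yields recurrences which show that the generating function of \<open>A\<^sub>0\<close> is
  \<open>exp (\<Sum>i. 2 \<sigma>(i) / i * q\<^bsup>i\<^esup>)\<close> and that \<open>A\<^sub>k\<close> is the convolution of \<open>A\<^sub>0\<close> with a nonnegative kernel
  \<open>E\<^sub>k\<close> built from divisor sums, with \<open>E\<^sub>k(e\<^bsup>-t\<^esup>) \<sim> a\<^sub>k t\<^bsup>-k\<^esup>\<close> as \<open>t \<rightarrow> 0\<close>. The saddle point method on the circle
  of radius \<open>e\<^bsup>-t\<^esup>\<close> with \<open>t = \<pi> / \<surd>(3 n)\<close> and angle \<open>t\<^bsup>3/2\<^esup> s\<close> needs only real asymptotics of Lambert series
  and dominated convergence in \<open>s\<close>. The constants satisfy \<open>\<Sum>k. a\<^sub>k w\<^bsup>k\<^esup> / k! = \<pi> w / sin (\<pi> w)\<close>, by the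
  partial fractions of the cotangent, which identifies \<open>a\<^bsub>2k\<^esub> = (-1)\<^bsup>k\<^esup> (2 \<pi>)\<^bsup>2k\<^esup> B\<^bsub>2k\<^esub>(1/2)\<close>.
\<close>

text \<open>In a unimodal sequence the peak couples the two halves. Over all pairs of partitions the
  coupling is gone and the generating function is an Euler product; the price is the tied pairs and
  the shift from \<open>D\<close> to \<open>1 - D\<close>, both of lower order.

  The symmetry of \<open>D\<close> acts a second time inside the recurrence for
  \<open>A\<^sub>k\<close>: only odd powers of the multiplicity survive, so every divisor sum has
  exponent at least 1. Its Lambert series then behaves like a pure power of \<open>t\<close> with a
  convergent zeta value, whereas the divisor-counting function would bring in a logarithm.

  The angle is scaled by \<open>t powr (3/2)\<close> because the second derivative of the logarithm
  of the generating function has order t^(-3). One estimate covers the whole circle: the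
  coefficients of that logarithm are at least 2, so its real part drops away from the positive axis
  at least as fast as that of 2/(1 - z). A nonnegative kernel is bounded on the circle by its value
  on the positive axis, so the same majorant serves every moment.\<close>

section \<open>Pairs of partitions\<close>

definition partition_pairs :: "nat \<Rightarrow> (nat multiset \<times> nat multiset) set" where
  "partition_pairs n = {(L, M). 0 \<notin># L \<and> 0 \<notin># M \<and> sum_mset L + sum_mset M = n}"

definition pair_rank :: "nat multiset \<times> nat multiset \<Rightarrow> int" where
  "pair_rank = (\<lambda>(L, M). int (size L) - int (size M))"

definition pair_moment :: "nat \<Rightarrow> nat \<Rightarrow> real" where
  "pair_moment k n = (\<Sum>p\<in>partition_pairs n. real_of_int (pair_rank p) ^ k)"

text \<open>The value at \<open>i = 0\<close> is \<open>0\<close>, being a sum over an infinite set.\<close>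

definition divisor_sum :: "nat \<Rightarrow> nat \<Rightarrow> real" where
  "divisor_sum l i = (\<Sum>m | m dvd i. real m ^ l)"

lemma size_le_sum_mset: "0 \<notin># L \<Longrightarrow> size L \<le> sum_mset L" for L :: "nat multiset"
  by (induction L) auto

lemma set_mset_le_sum_mset: "x \<in># L \<Longrightarrow> x \<le> sum_mset L" for L :: "nat multiset"
  by (induction L) auto

lemma finite_partition_pairs: "finite (partition_pairs n)"
proof -
  let ?X = "mset ` {xs. set xs \<subseteq> {..n} \<and> length xs \<le> n}"
  have "partition_pairs n \<subseteq> ?X \<times> ?X"
  proof (clarsimp simp: partition_pairs_def)
    have *: "L \<in> ?X" if "0 \<notin># L" "sum_mset L \<le> n" for L
    proof -
      obtain xs where xs: "mset xs = L" using ex_mset by blast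
      have "size L \<le> n" using size_le_sum_mset[OF that(1)] that(2) by simp
      then have "length xs \<le> n" using xs by auto
      moreover have "set xs \<subseteq> {..n}"
        using set_mset_le_sum_mset[of _ L] that(2) xs by fastforce
      ultimately show ?thesis using xs by blast
    qed
    fix L M :: "nat multiset"
    assume "0 \<notin># L" "0 \<notin># M" "n = sum_mset L + sum_mset M"
    then show "L \<in> mset ` {xs. set xs \<subseteq> {..sum_mset L + sum_mset M} \<and> length xs \<le> sum_mset L + sum_mset M} \<and>
         M \<in> mset ` {xs. set xs \<subseteq> {..sum_mset L + sum_mset M} \<and> length xs \<le> sum_mset L + sum_mset M}"
      using *[of L] *[of M] by simp
  qed
  moreover have "finite (?X \<times> ?X)"
    by (intro finite_cartesian_product finite_imageI finite_lists_length_le) auto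
  ultimately show ?thesis by (rule finite_subset)
qed

lemma partition_pairs_swap: "bij_betw prod.swap (partition_pairs n) (partition_pairs n)"
  by (rule bij_betwI[where g = prod.swap]) (auto simp: partition_pairs_def)

lemma pair_rank_swap: "pair_rank (prod.swap p) = - pair_rank p"
  by (auto simp: pair_rank_def split: prod.splits)

lemma sum_partition_pairs_swap:
  "(\<Sum>p\<in>partition_pairs n. f p) = (\<Sum>p\<in>partition_pairs n. f (prod.swap p))"
  by (rule sum.reindex_bij_betw[symmetric, OF partition_pairs_swap])

lemma sum_mset_eq_sum_count:
  fixes h :: "nat \<Rightarrow> real"
  assumes "set_mset L \<subseteq> {1..n}"
  shows "(\<Sum>x\<in>#L. h x) = (\<Sum>d=1..n. h d * real (count L d))"
  using assms
proof (induction L)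
  case (add x L)
  have "(\<Sum>d=1..n. h d * real (count (add_mset x L) d)) =
        (\<Sum>d=1..n. h d * real (count L d) + (if d = x then h d else 0))"
    by (rule sum.cong) (auto simp: algebra_simps)
  also have "\<dots> = (\<Sum>d=1..n. h d * real (count L d)) + h x"
    using add.prems by (simp add: sum.distrib)
  finally show ?case using add by simp
qed auto

text \<open>Adding \<open>m\<close> copies of \<open>d\<close> to the first component is a bijection
  onto the pairs in which \<open>d\<close> occurs there at least \<open>m\<close> times, and it
  raises the rank by \<open>m\<close>. The assumption \<open>1 \<le> d\<close> keeps the forbidden
  part 0 out.\<close>

lemma sum_partition_pairs_remove:
  assumes "1 \<le> d"
  shows "(\<Sum>p | p \<in> partition_pairs n \<and> m \<le> count (fst p) d. f (pair_rank p)) =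
    (if m * d \<le> n then \<Sum>p\<in>partition_pairs (n - m * d). f (pair_rank p + int m) else 0)"
proof (cases "m * d \<le> n")
  case False
  have "{p. p \<in> partition_pairs n \<and> m \<le> count (fst p) d} = {}"
  proof (rule equals0I)
    fix p assume "p \<in> {p. p \<in> partition_pairs n \<and> m \<le> count (fst p) d}"
    then obtain L M where p: "0 \<notin># L" "sum_mset L + sum_mset M = n" "m \<le> count L d"
      by (auto simp: partition_pairs_def)
    then have "replicate_mset m d \<subseteq># L"
      by (simp add: count_le_replicate_mset_subset_eq)
    then obtain L' where "L = replicate_mset m d + L'" by (auto simp: mset_subset_eq_exists_conv)
    then have "m * d \<le> sum_mset L" by (simp add: sum_mset_replicate_mset)
    with p False show False by simp
  qed
  with False show ?thesis by (simp only: sum.empty if_False)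
next
  case True
  let ?g = "\<lambda>(L, M). (L + replicate_mset m d, M :: nat multiset)"
  have "bij_betw ?g (partition_pairs (n - m * d)) {p. p \<in> partition_pairs n \<and> m \<le> count (fst p) d}"
  proof (rule bij_betwI[where g = "\<lambda>(L, M). (L - replicate_mset m d, M)"])
    show "?g \<in> partition_pairs (n - m * d) \<rightarrow> {p. p \<in> partition_pairs n \<and> m \<le> count (fst p) d}"
      using True assms by (auto simp: partition_pairs_def sum_mset_replicate_mset split: if_splits)
    show "(\<lambda>(L, M). (L - replicate_mset m d, M)) \<in>
      {p. p \<in> partition_pairs n \<and> m \<le> count (fst p) d} \<rightarrow> partition_pairs (n - m * d)"
    proof (clarsimp simp: partition_pairs_def)
      fix L M :: "nat multiset"
      assume a: "m \<le> count L d" "0 \<notin># L"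
      then have "replicate_mset m d \<subseteq># L"
        by (simp add: count_le_replicate_mset_subset_eq)
      then obtain L' where L': "L = replicate_mset m d + L'" by (auto simp: mset_subset_eq_exists_conv)
      show "0 \<notin># L - replicate_mset m d \<and>
        sum_mset (L - replicate_mset m d) + sum_mset M = sum_mset L + sum_mset M - m * d"
        using a unfolding L' by (auto simp: sum_mset_replicate_mset)
    qed
    show "\<And>x. (case ?g x of (L, M) \<Rightarrow> (L - replicate_mset m d, M)) = x" by auto
    fix y :: "nat multiset \<times> nat multiset"
    assume "y \<in> {p. p \<in> partition_pairs n \<and> m \<le> count (fst p) d}"
    then have "replicate_mset m d \<subseteq># fst y"
      by (simp add: count_le_replicate_mset_subset_eq)
    then show "?g ((\<lambda>(L, M). (L - replicate_mset m d, M)) y) = y"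
      by (auto split: prod.splits)
  qed
  from sum.reindex_bij_betw[OF this, of "\<lambda>p. f (pair_rank p)"] True
  show ?thesis by (simp add: pair_rank_def case_prod_unfold add_diff_eq diff_add_eq algebra_simps)
qed

text \<open>Writing the multiplicity of \<open>d\<close> as \<open>\<Sum>m\<ge>1. of_bool (m \<le> count L d)\<close> and deleting \<open>m\<close> copies
  of \<open>d\<close> turns a sum weighted by parts into a convolution with a divisor sum.\<close>

lemma sum_partition_pairs_weighted:
  fixes h :: "nat \<Rightarrow> real" and f :: "int \<Rightarrow> real"
  shows "(\<Sum>p\<in>partition_pairs n. (\<Sum>x\<in>#fst p. h x) * f (pair_rank p)) =
    (\<Sum>i=1..n. \<Sum>m | m dvd i. h (i div m) * (\<Sum>p\<in>partition_pairs (n - i). f (pair_rank p + int m)))"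
proof -
  let ?P = "partition_pairs n"
  let ?F = "\<lambda>m i. (\<Sum>p\<in>partition_pairs (n - i). f (pair_rank p + int m))"
  have set_le: "set_mset L \<subseteq> {1..n}" "count L d \<le> n" if "(L, M) \<in> ?P" for L M d
  proof -
    have *: "0 \<notin># L" "sum_mset L \<le> n" using that by (auto simp: partition_pairs_def)
    show "set_mset L \<subseteq> {1..n}"
      using * set_mset_le_sum_mset[of _ L] by (force simp: Suc_le_eq intro: Nat.gr0I)
    show "count L d \<le> n"
      using * size_le_sum_mset[of L] count_le_size[of L d] by linarith
  qed
  have cnt: "real (count L d) = (\<Sum>m=1..n. of_bool (m \<le> count L d))" if "(L, M) \<in> ?P" for L M d
  proof -
    have "(\<Sum>m=1..n. of_bool (m \<le> count L d)) = real (card ({1..n} \<inter> {m. m \<le> count L d}))"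
      by simp
    also have "{1..n} \<inter> {m. m \<le> count L d} = {1..count L d}"
      using set_le(2)[OF that, of d] by auto
    finally show ?thesis by simp
  qed
  have "(\<Sum>p\<in>?P. (\<Sum>x\<in>#fst p. h x) * f (pair_rank p)) =
     (\<Sum>p\<in>?P. \<Sum>d=1..n. \<Sum>m=1..n. h d * (of_bool (m \<le> count (fst p) d) * f (pair_rank p)))"
  proof (rule sum.cong[OF refl])
    fix p assume p: "p \<in> ?P"
    obtain L M where [simp]: "p = (L, M)" by force
    show "(\<Sum>x\<in>#fst p. h x) * f (pair_rank p) =
       (\<Sum>d=1..n. \<Sum>m=1..n. h d * (of_bool (m \<le> count (fst p) d) * f (pair_rank p)))"
      using p by (simp only: \<open>p = (L, M)\<close> fst_conv sum_mset_eq_sum_count[OF set_le(1)] cnt sum_distrib_left sum_distrib_right mult.assoc)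
  qed
  also have "\<dots> = (\<Sum>d=1..n. \<Sum>m=1..n. h d * (\<Sum>p\<in>?P. of_bool (m \<le> count (fst p) d) * f (pair_rank p)))"
    by (subst sum.swap, rule sum.cong[OF refl], subst sum.swap) (simp add: sum_distrib_left)
  also have "\<dots> = (\<Sum>d=1..n. \<Sum>m=1..n. if m * d \<le> n then h d * ?F m (m * d) else 0)"
  proof (intro sum.cong refl)
    fix d m assume "d \<in> {1..n}"
    have "(\<Sum>p\<in>?P. of_bool (m \<le> count (fst p) d) * f (pair_rank p)) =
       (\<Sum>p | p \<in> partition_pairs n \<and> m \<le> count (fst p) d. f (pair_rank p))"
      by (rule sum.mono_neutral_cong_right) (auto simp: finite_partition_pairs)
    then show "h d * (\<Sum>p\<in>?P. of_bool (m \<le> count (fst p) d) * f (pair_rank p)) =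
       (if m * d \<le> n then h d * ?F m (m * d) else 0)"
      using sum_partition_pairs_remove[where d = d and m = m and n = n and f = f] \<open>d \<in> {1..n}\<close> by simp
  qed
  also have "\<dots> = (\<Sum>(d,m)\<in>{1..n}\<times>{1..n}. if m * d \<le> n then h d * ?F m (m * d) else 0)"
    by (simp add: sum.cartesian_product)
  also have "\<dots> = (\<Sum>x\<in>{x\<in>{1..n}\<times>{1..n}. snd x * fst x \<le> n}. h (fst x) * ?F (snd x) (snd x * fst x))"
    by (subst sum.inter_filter) (auto intro!: sum.cong)
  also have "\<dots> = (\<Sum>(i,m)\<in>(SIGMA i:{1..n}. {m. m dvd i}). h (i div m) * ?F m i)"
  proof (rule sum.reindex_bij_witness[where j = "\<lambda>(d,m). (m * d, m)" and i = "\<lambda>(i,m). (i div m, m)"])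
    fix b assume "b \<in> (SIGMA i:{1..n}. {m. m dvd i})"
    then obtain i m where b: "b = (i, m)" "1 \<le> i" "i \<le> n" "m dvd i" by auto
    then obtain d where d: "i = m * d" by auto
    have md: "m > 0" "d > 0" using b d by (auto intro: Nat.gr0I)
    then have "m \<le> n" "d \<le> n"
      using b(3) d order_trans[of m "m * d" n] order_trans[of d "m * d" n] by simp_all
    with md show "(case b of (i, m) \<Rightarrow> (i div m, m)) \<in> {x \<in> {1..n} \<times> {1..n}. snd x * fst x \<le> n}"
      using b d by auto
  qed auto
  also have "\<dots> = (\<Sum>i=1..n. \<Sum>m | m dvd i. h (i div m) * ?F m i)"
    by (subst sum.Sigma) (auto intro: finite_divisors_nat)
  finally show ?thesis .
qed

text \<open>The size \<open>n\<close> is the sum of all parts, and by the swap both components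
  contribute equally. For generating functions this is the logarithmic derivative of the squared
  partition product.\<close>

lemma pair_moment_0_recurrence:
  "real n * pair_moment 0 n = (\<Sum>i=1..n. 2 * divisor_sum 1 i * pair_moment 0 (n - i))"
proof -
  have "real n * pair_moment 0 n = (\<Sum>p\<in>partition_pairs n. real (sum_mset (fst p)) + real (sum_mset (snd p)))"
    unfolding pair_moment_def sum_distrib_left
    by (rule sum.cong) (auto simp: partition_pairs_def)
  also have "\<dots> = 2 * (\<Sum>p\<in>partition_pairs n. real (sum_mset (fst p)))"
    using sum_partition_pairs_swap[of "\<lambda>p. real (sum_mset (snd p))" n] by (simp add: sum.distrib)
  also have "(\<Sum>p\<in>partition_pairs n. real (sum_mset (fst p))) =
     (\<Sum>i=1..n. \<Sum>m | m dvd i. real (i div m) * pair_moment 0 (n - i))"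
    using sum_partition_pairs_weighted[of real "\<lambda>_. 1" n]
    by (simp add: pair_moment_def of_nat_sum_mset image_mset.compositionality comp_def)
  also have "\<dots> = (\<Sum>i=1..n. divisor_sum 1 i * pair_moment 0 (n - i))"
  proof (rule sum.cong[OF refl])
    fix i assume i: "i \<in> {1..n}"
    have "(\<Sum>m | m dvd i. real (i div m)) = divisor_sum 1 i"
      unfolding divisor_sum_def
      by (rule sum.reindex_bij_witness[where i = "\<lambda>m. i div m" and j = "\<lambda>m. i div m"])
         (use i in \<open>auto elim!: dvdE\<close>)
    then show "(\<Sum>m | m dvd i. real (i div m) * pair_moment 0 (n - i)) = divisor_sum 1 i * pair_moment 0 (n - i)"
      by (simp add: sum_distrib_right[symmetric])
  qed
  finally show ?thesis by (simp add: sum_distrib_left mult.assoc)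
qed

text \<open>Coefficients of \<open>m ^ l * r ^ (k - l)\<close> in
  \<open>(r + m) ^ k - (r - m) ^ k\<close>: the even powers of \<open>m\<close> cancel.\<close>

definition moment_coeff :: "nat \<Rightarrow> nat \<Rightarrow> real" where
  "moment_coeff k l = (if odd l then 2 * real (k choose l) else 0)"

text \<open>One factor of the rank is split as \<open>size L - size M\<close>, and a size is a sum
  over parts with weight 1, to which the deletion of equal parts applies.\<close>

lemma pair_moment_Suc_recurrence:
  "pair_moment (Suc k) n =
    (\<Sum>l\<le>k. moment_coeff k l * (\<Sum>i=1..n. divisor_sum l i * pair_moment (k - l) (n - i)))"
proof -
  let ?r = "\<lambda>p. real_of_int (pair_rank p)"
  define S where "S = (\<lambda>f. \<Sum>p\<in>partition_pairs n. real (size (fst p)) * f (pair_rank p))"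
  have S: "S f = (\<Sum>i=1..n. \<Sum>m | m dvd i. \<Sum>p\<in>partition_pairs (n - i). f (pair_rank p + int m))" for f
    using sum_partition_pairs_weighted[of "\<lambda>_. 1" f n] by (simp add: S_def)
  have "pair_moment (Suc k) n =
     (\<Sum>p\<in>partition_pairs n. real (size (fst p)) * ?r p ^ k - real (size (snd p)) * ?r p ^ k)"
    unfolding pair_moment_def by (rule sum.cong) (auto simp: pair_rank_def algebra_simps)
  also have "\<dots> = S (\<lambda>x. real_of_int x ^ k) - S (\<lambda>x. (- real_of_int x) ^ k)"
    using sum_partition_pairs_swap[of "\<lambda>p. real (size (snd p)) * ?r p ^ k" n]
    by (simp add: sum_subtractf S_def pair_rank_swap)
  also have "\<dots> = (\<Sum>i=1..n. \<Sum>m | m dvd i. \<Sum>p\<in>partition_pairs (n - i).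
      (?r p + real m) ^ k - (- ?r p - real m) ^ k)"
    by (simp add: S sum_subtractf)
  also have "\<dots> = (\<Sum>i=1..n. \<Sum>m | m dvd i. \<Sum>p\<in>partition_pairs (n - i).
      (real m + ?r p) ^ k - (- real m + ?r p) ^ k)"
  \<comment> \<open>A second swap, now on the smaller pairs, turns \<open>- D - m\<close> into
    \<open>D - m\<close>, so that the difference becomes odd in \<open>m\<close>.\<close>
  proof (rule sum.cong[OF refl], rule sum.cong[OF refl])
    fix i m
    have "(\<Sum>p\<in>partition_pairs (n - i). (- ?r p - real m) ^ k) = (\<Sum>p\<in>partition_pairs (n - i). (- real m + ?r p) ^ k)"
      by (subst sum_partition_pairs_swap) (simp add: pair_rank_swap algebra_simps)
    then show "(\<Sum>p\<in>partition_pairs (n - i). (?r p + real m) ^ k - (- ?r p - real m) ^ k) =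
       (\<Sum>p\<in>partition_pairs (n - i). (real m + ?r p) ^ k - (- real m + ?r p) ^ k)"
      by (simp add: sum_subtractf algebra_simps)
  qed
  also have "\<dots> = (\<Sum>i=1..n. \<Sum>m | m dvd i. \<Sum>p\<in>partition_pairs (n - i).
      \<Sum>l\<le>k. moment_coeff k l * (real m ^ l * ?r p ^ (k - l)))"
  proof (intro sum.cong refl)
    fix i m p
    show "(real m + ?r p) ^ k - (- real m + ?r p) ^ k = (\<Sum>l\<le>k. moment_coeff k l * (real m ^ l * ?r p ^ (k - l)))"
      unfolding binomial_ring sum_subtractf[symmetric]
      by (rule sum.cong) (auto simp: moment_coeff_def)
  qed
  also have "\<dots> = (\<Sum>i=1..n. \<Sum>m | m dvd i. \<Sum>l\<le>k. moment_coeff k l * (real m ^ l * pair_moment (k - l) (n - i)))"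
    unfolding pair_moment_def sum_distrib_left by (intro sum.cong refl, rule sum.swap)
  also have "\<dots> = (\<Sum>i=1..n. \<Sum>l\<le>k. \<Sum>m | m dvd i. moment_coeff k l * (real m ^ l * pair_moment (k - l) (n - i)))"
    by (rule sum.cong[OF refl], rule sum.swap)
  also have "\<dots> = (\<Sum>l\<le>k. \<Sum>i=1..n. \<Sum>m | m dvd i. moment_coeff k l * (real m ^ l * pair_moment (k - l) (n - i)))"
    by (rule sum.swap)
  finally show ?thesis
    by (simp add: divisor_sum_def sum_distrib_left sum_distrib_right)
qed

section \<open>Unimodal sequences as pairs of partitions\<close>

text \<open>The peak belongs to the first component. Parts of the second one may equal it: the
  number of copies in the first component records which copy is marked.\<close>

definition peak_pairs :: "nat \<Rightarrow> (nat multiset \<times> nat multiset) set" where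
  "peak_pairs n = {(L, M) \<in> partition_pairs n. L \<noteq> {#} \<and> (\<forall>y\<in>#M. y \<le> Max_mset L)}"

definition tied_pairs :: "nat \<Rightarrow> (nat multiset \<times> nat multiset) set" where
  "tied_pairs n = {(L, M) \<in> partition_pairs n. L \<noteq> {#} \<and> M \<noteq> {#} \<and> Max_mset L = Max_mset M}"

lemma Max_mset_mset_snoc_sorted:
  fixes c :: nat
  assumes "sorted (as @ [c])"
  shows "Max_mset (mset (as @ [c])) = c"
  using assms by (intro Max_eqI) (auto simp: sorted_append)

lemma bij_betw_unimodal_peak:
  "bij_betw (\<lambda>(as, c, bs). (mset (as @ [c]), mset bs)) (unimodal_seqs n) (peak_pairs n)"
proof (rule bij_betwI[where g = "\<lambda>(L, M). (butlast (sorted_list_of_multiset L),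
      last (sorted_list_of_multiset L), rev (sorted_list_of_multiset M))"])
  show "(\<lambda>(as, c, bs). (mset (as @ [c]), mset bs)) \<in> unimodal_seqs n \<rightarrow> peak_pairs n"
  proof
    fix t assume "t \<in> unimodal_seqs n"
    then obtain as c bs where t: "t = (as, c, bs)" "sorted (as @ [c])"
      "sorted_wrt (\<ge>) (c # bs)" "\<forall>x \<in> set (as @ [c] @ bs). 0 < x" "sum_list (as @ [c] @ bs) = n"
      by (auto simp: unimodal_seqs_def)
    moreover have "\<forall>y\<in>#mset bs. y \<le> Max_mset (mset (as @ [c]))"
      unfolding Max_mset_mset_snoc_sorted[OF t(2)] using t(3) by auto
    ultimately show "(case t of (as, c, bs) \<Rightarrow> (mset (as @ [c]), mset bs)) \<in> peak_pairs n"
      by (auto simp: peak_pairs_def partition_pairs_def sum_mset_sum_list)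
  qed
next
  show "(\<lambda>(L, M). (butlast (sorted_list_of_multiset L), last (sorted_list_of_multiset L),
      rev (sorted_list_of_multiset M))) \<in> peak_pairs n \<rightarrow> unimodal_seqs n"
  proof
    fix p assume p: "p \<in> peak_pairs n"
    obtain L M where LM: "p = (L, M)" by force
    define xs where "xs = sorted_list_of_multiset L"
    define ys where "ys = sorted_list_of_multiset M"
    have L: "L = mset xs" and M: "M = mset ys" by (simp_all add: xs_def ys_def)
    have so: "sorted xs" "sorted ys" by (simp_all add: xs_def ys_def)
    have pp: "L \<noteq> {#}" "\<forall>y\<in>#M. y \<le> Max_mset L" "0 \<notin># L" "0 \<notin># M" "sum_mset L + sum_mset M = n"
      using p LM by (auto simp: peak_pairs_def partition_pairs_def)
    then have ne: "xs \<noteq> []" by (auto simp: L)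
    define as where "as = butlast xs"
    define c where "c = last xs"
    have xs: "xs = as @ [c]" using ne by (simp add: as_def c_def)
    have "Max_mset L = c"
      unfolding L xs by (rule Max_mset_mset_snoc_sorted) (use so xs in simp)
    then have "\<forall>y\<in>set ys. y \<le> c" using pp(2) M by simp
    moreover have "sorted_wrt (\<ge>) (rev ys)"
      using so by (simp add: sorted_wrt_rev)
    moreover have "\<forall>x\<in>set (xs @ ys). 0 < x"
      using pp L M by (auto intro: Nat.gr0I)
    moreover have "sum_list xs + sum_list ys = n"
      using pp(5) L M by (simp add: sum_mset_sum_list)
    ultimately have "(as, c, rev ys) \<in> unimodal_seqs n"
      using so xs by (auto simp: unimodal_seqs_def)
    then show "(case p of (L, M) \<Rightarrow> (butlast (sorted_list_of_multiset L),
       last (sorted_list_of_multiset L), rev (sorted_list_of_multiset M))) \<in> unimodal_seqs n"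
      by (simp add: LM as_def c_def xs_def ys_def)
  qed
next
  fix t assume "t \<in> unimodal_seqs n"
  then obtain as c bs where t: "t = (as, c, bs)" "sorted (as @ [c])" "sorted_wrt (\<ge>) (c # bs)"
    by (auto simp: unimodal_seqs_def)
  have 1: "sorted_list_of_multiset (mset (as @ [c])) = as @ [c]"
    using t by (intro sorted_list_of_multiset_mset[THEN trans] sorted_sort_id) auto
  have "sorted (rev bs)" using t(3) by (simp add: sorted_wrt_rev)
  then have "sorted_list_of_multiset (mset (rev bs)) = rev bs"
    by (simp only: sorted_list_of_multiset_mset sorted_sort_id)
  then have 2: "sorted_list_of_multiset (mset bs) = rev bs" by (simp only: mset_rev)
  show "(case case t of (as, c, bs) \<Rightarrow> (mset (as @ [c]), mset bs) of
          (L, M) \<Rightarrow> (butlast (sorted_list_of_multiset L), last (sorted_list_of_multiset L),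
                     rev (sorted_list_of_multiset M))) = t"
    unfolding t(1) prod.case 1 2 by simp
next
  fix p assume "p \<in> peak_pairs n"
  then obtain L M where p: "p = (L, M)" "L \<noteq> {#}" by (auto simp: peak_pairs_def)
  then have "sorted_list_of_multiset L \<noteq> []"
    by (metis mset.simps(1) mset_sorted_list_of_multiset)
  then have "mset (butlast (sorted_list_of_multiset L) @ [last (sorted_list_of_multiset L)]) = L"
    by (simp only: append_butlast_last_id mset_sorted_list_of_multiset not_False_eq_True)
  then show "(case case p of (L, M) \<Rightarrow> (butlast (sorted_list_of_multiset L),
      last (sorted_list_of_multiset L), rev (sorted_list_of_multiset M)) of
      (as, c, bs) \<Rightarrow> (mset (as @ [c]), mset bs)) = p"
    using p by simp
qed

lemma u_moment_eq_sum_unimodal: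
  "u_moment j n = (\<Sum>t\<in>unimodal_seqs n. real_of_int (unimodal_rank t) ^ j)"
proof -
  have supp: "{m. u m n \<noteq> 0} = unimodal_rank ` unimodal_seqs n"
    using finite_unimodal_seqs[of n] by (auto simp: u_def)
  have "(\<Sum>t\<in>unimodal_seqs n. real_of_int (unimodal_rank t) ^ j) =
     (\<Sum>m\<in>unimodal_rank ` unimodal_seqs n. \<Sum>t | t \<in> unimodal_seqs n \<and> unimodal_rank t = m.
        real_of_int (unimodal_rank t) ^ j)"
    by (rule sum.image_gen[OF finite_unimodal_seqs])
  also have "\<dots> = (\<Sum>m\<in>unimodal_rank ` unimodal_seqs n. real_of_int m ^ j * real (u m n))"
    by (rule sum.cong) (auto simp: u_def)
  finally show ?thesis by (simp only: u_moment_finite_sum supp)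
qed

lemma u_moment_eq_sum_peak:
  "u_moment j n = (\<Sum>p\<in>peak_pairs n. (1 - real_of_int (pair_rank p)) ^ j)"
proof -
  have "u_moment j n = (\<Sum>t\<in>unimodal_seqs n.
     (1 - real_of_int (pair_rank ((\<lambda>(as, c, bs). (mset (as @ [c]), mset bs)) t))) ^ j)"
    unfolding u_moment_eq_sum_unimodal
    by (rule sum.cong) (auto simp: unimodal_rank_def pair_rank_def algebra_simps split: prod.splits)
  then show ?thesis
    by (subst (asm) sum.reindex_bij_betw[OF bij_betw_unimodal_peak])
qed

lemma finite_peak_pairs: "finite (peak_pairs n)"
  by (rule finite_subset[OF _ finite_partition_pairs]) (auto simp: peak_pairs_def)

text \<open>Of a pair and its swap at least one has the larger maximum in front, and both do exactly
  when the pair is tied. For \<open>n = 0\<close> the only pair is empty and is neither kind, hence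
  \<open>n > 0\<close>.\<close>

lemma sum_peak_pairs:
  assumes "n > 0" and f: "\<And>p. f (prod.swap p) = f p"
  shows "2 * (\<Sum>p\<in>peak_pairs n. f p) = (\<Sum>p\<in>partition_pairs n. f p) + (\<Sum>p\<in>tied_pairs n. f p :: real)"
proof -
  let ?S = "prod.swap ` peak_pairs n"
  have un: "peak_pairs n \<union> ?S = partition_pairs n"
  proof
    show "peak_pairs n \<union> ?S \<subseteq> partition_pairs n"
      by (auto simp: peak_pairs_def partition_pairs_def)
    show "partition_pairs n \<subseteq> peak_pairs n \<union> ?S"
    proof
      fix p assume p: "p \<in> partition_pairs n"
      obtain L M where LM: "p = (L, M)" by force
      have "L \<noteq> {#} \<or> M \<noteq> {#}" using p LM assms(1) by (auto simp: partition_pairs_def)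
      then consider "L \<noteq> {#}" "\<forall>y\<in>#M. y \<le> Max_mset L" | "M \<noteq> {#}" "\<forall>y\<in>#L. y \<le> Max_mset M"
        by (metis Max_ge finite_set_mset linorder_le_cases order_trans set_mset_empty empty_iff)
      then show "p \<in> peak_pairs n \<union> ?S"
      proof cases
        case 1
        then show ?thesis using p LM by (auto simp: peak_pairs_def)
      next
        case 2
        then have "(M, L) \<in> peak_pairs n" using p LM by (auto simp: peak_pairs_def partition_pairs_def)
        then show ?thesis using LM by force
      qed
    qed
  qed
  have int: "peak_pairs n \<inter> ?S = tied_pairs n"
  proof (rule set_eqI)
    fix p :: "nat multiset \<times> nat multiset"
    obtain L M where p: "p = (L, M)" by force
    have "p \<in> ?S \<longleftrightarrow> (M, L) \<in> peak_pairs n" using p by (force simp: image_iff)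
    moreover have "(L \<noteq> {#} \<and> (\<forall>y\<in>#M. y \<le> Max_mset L)) \<and> (M \<noteq> {#} \<and> (\<forall>y\<in>#L. y \<le> Max_mset M)) \<longleftrightarrow>
      L \<noteq> {#} \<and> M \<noteq> {#} \<and> Max_mset L = Max_mset M"
      by (metis Max_ge Max_in antisym finite_set_mset set_mset_eq_empty_iff)
    ultimately show "p \<in> peak_pairs n \<inter> ?S \<longleftrightarrow> p \<in> tied_pairs n"
      using p by (auto simp: peak_pairs_def tied_pairs_def partition_pairs_def add.commute)
  qed
  have "(\<Sum>p\<in>?S. f p) = (\<Sum>p\<in>peak_pairs n. f p)"
    by (subst sum.reindex) (auto simp: f)
  with sum.union_inter[of "peak_pairs n" ?S f] show ?thesis
    by (simp add: un int finite_peak_pairs)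
qed

text \<open>A tied pair has \<open>J + 1\<close> modifications of size \<open>n + 2 * J\<close> and the same rank: raise one copy of the
  largest part of the first component by \<open>2 * j\<close>, and append \<open>J - j\<close> parts \<open>1\<close> to both components.
  The gap between the largest parts recovers \<open>j\<close>.\<close>

lemma sum_tied_pairs_le:
  assumes f: "\<And>x. 0 \<le> f x"
  shows "real (Suc J) * (\<Sum>p\<in>tied_pairs n. f (pair_rank p)) \<le>
    (\<Sum>p\<in>partition_pairs (n + 2 * J). f (pair_rank p))"
proof -
  define \<Phi> where "\<Phi> = (\<lambda>(j, L, M). (add_mset (Max_mset L + 2 * j) (L - {#Max_mset L#}) +
     replicate_mset (J - j) (1::nat), M + replicate_mset (J - j) (1::nat)))"
  let ?D = "{..J} \<times> tied_pairs n"
  have tp: "\<exists>c L'. L = add_mset c L' \<and> c = Max_mset L \<and> c = Max_mset M \<and> M \<noteq> {#} \<and> c \<ge> 1 \<and> (\<forall>x\<in>#L'. 1 \<le> x \<and> x \<le> c)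
     \<and> c \<in># M \<and> (\<forall>x\<in>#M. 1 \<le> x \<and> x \<le> c) \<and> sum_mset L + sum_mset M = n"
    if "(L, M) \<in> tied_pairs n" for L M
  proof -
    have a: "L \<noteq> {#}" "M \<noteq> {#}" "Max_mset L = Max_mset M" "0 \<notin># L" "0 \<notin># M" "sum_mset L + sum_mset M = n"
      using that by (auto simp: tied_pairs_def partition_pairs_def)
    have "Max_mset L \<in># L" by (rule Max_in) (use a in auto)
    then obtain L' where L': "L = add_mset (Max_mset L) L'" by (metis multi_member_split)
    have pos: "x \<ge> 1" if "x \<in># L \<or> x \<in># M" for x
      using that a by (cases x) auto
    have b: "\<forall>x\<in>#L'. 1 \<le> x \<and> x \<le> Max_mset L"
    proof
      fix x assume "x \<in># L'"
      then have "x \<in># L" by (subst L') simp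
      then show "1 \<le> x \<and> x \<le> Max_mset L" using pos by simp
    qed
    have c: "\<forall>x\<in>#M. 1 \<le> x \<and> x \<le> Max_mset L"
      using pos a(3) by auto
    have d: "Max_mset L \<in># M" unfolding a(3) using a(2) by simp
    have e: "1 \<le> Max_mset L" using pos d by blast
    show ?thesis
      by (rule exI[of _ "Max_mset L"], rule exI[of _ L']) (use L' a b c d e in blast)
  qed
  have max1: "Max_mset (fst (\<Phi> (j, L, M))) = Max_mset L + 2 * j"
    and max2: "Max_mset (snd (\<Phi> (j, L, M))) = Max_mset L" if "(L, M) \<in> tied_pairs n" for j L M
  proof -
    from tp[OF that] obtain c L' where L: "L = add_mset c L'" and c: "c = Max_mset L" "M \<noteq> {#}" "c \<ge> 1"
      "\<forall>x\<in>#L'. 1 \<le> x \<and> x \<le> c" "c \<in># M" "\<forall>x\<in>#M. 1 \<le> x \<and> x \<le> c"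
      by blast
    have "Max_mset (fst (\<Phi> (j, L, M))) = c + 2 * j"
      unfolding \<Phi>_def prod.case fst_conv c(1)[symmetric] unfolding L using c(3,4)
      by (intro Max_eqI) (auto split: if_splits intro: trans_le_add1)
    then show "Max_mset (fst (\<Phi> (j, L, M))) = Max_mset L + 2 * j" using c(1) by simp
    have "Max_mset (snd (\<Phi> (j, L, M))) = c"
      unfolding \<Phi>_def prod.case snd_conv using c(3,5,6)
      by (intro Max_eqI) (auto split: if_splits)
    then show "Max_mset (snd (\<Phi> (j, L, M))) = Max_mset L" using c(1) by simp
  qed
  have inj: "inj_on \<Phi> ?D"
  proof (rule inj_onI, clarsimp)
    fix j L M j' L' M'
    assume 1: "(L, M) \<in> tied_pairs n" and 2: "(L', M') \<in> tied_pairs n"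
      and eq: "\<Phi> (j, L, M) = \<Phi> (j', L', M')"
    have mx: "Max_mset L = Max_mset L'" using max2[OF 1, of j] max2[OF 2, of j'] eq by simp
    have j: "j = j'" using max1[OF 1, of j] max1[OF 2, of j'] eq mx by simp
    have "L - {#Max_mset L#} = L' - {#Max_mset L'#}" and M: "M = M'"
      using eq unfolding \<Phi>_def prod.case mx j by auto
    moreover have "L = add_mset (Max_mset L) (L - {#Max_mset L#})"
      "L' = add_mset (Max_mset L') (L' - {#Max_mset L'#})"
      using tp[OF 1] tp[OF 2] by (metis add_mset_remove_trivial)+
    ultimately show "j = j' \<and> L = L' \<and> M = M'" using j mx by metis
  qed
  have into: "\<Phi> ` ?D \<subseteq> partition_pairs (n + 2 * J)"
  proof (rule image_subsetI)
    fix x assume "x \<in> ?D"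
    then obtain j L M where x: "x = (j, L, M)" and j: "j \<le> J" and t: "(L, M) \<in> tied_pairs n" by auto
    from tp[OF t] obtain c L' where L: "L = add_mset c L'" and c: "c = Max_mset L" "c \<ge> 1"
      "\<forall>x\<in>#L'. 1 \<le> x \<and> x \<le> c" "\<forall>x\<in>#M. 1 \<le> x \<and> x \<le> c" "sum_mset L + sum_mset M = n"
      by blast
    have P: "\<Phi> (j, L, M) = (add_mset (c + 2 * j) L' + replicate_mset (J - j) 1, M + replicate_mset (J - j) 1)"
      unfolding \<Phi>_def prod.case c(1)[symmetric] unfolding L by simp
    have "c + sum_mset L' + sum_mset M = n" using c(5) L by simp
    then show "\<Phi> x \<in> partition_pairs (n + 2 * J)"
      unfolding x P partition_pairs_def using c j by (auto simp: sum_mset_replicate_mset split: if_splits)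
  qed
  have rank: "pair_rank (\<Phi> x) = pair_rank (snd x)" if "x \<in> ?D" for x
  proof -
    obtain j L M where x: "x = (j, L, M)" by (metis prod_cases3)
    from tp[of L M] that x obtain c L' where "L = add_mset c L'" "c = Max_mset L" by auto
    then have "size L = Suc (size (L - {#Max_mset L#}))" by (metis add_mset_remove_trivial size_add_mset)
    then show ?thesis by (simp add: x \<Phi>_def pair_rank_def)
  qed
  have "real (Suc J) * (\<Sum>p\<in>tied_pairs n. f (pair_rank p)) = (\<Sum>x\<in>?D. f (pair_rank (snd x)))"
    by (simp add: sum.cartesian_product')
  also have "\<dots> = (\<Sum>x\<in>?D. f (pair_rank (\<Phi> x)))"
    using rank by (intro sum.cong) auto
  also have "\<dots> = (\<Sum>p\<in>\<Phi> ` ?D. f (pair_rank p))"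
    by (simp add: sum.reindex[OF inj])
  also have "\<dots> \<le> (\<Sum>p\<in>partition_pairs (n + 2 * J). f (pair_rank p))"
    by (rule sum_mono2[OF finite_partition_pairs into]) (simp add: f)
  finally show ?thesis .
qed

section \<open>Lambert series of divisor sums\<close>

text \<open>The double series over all positive \<open>m\<close> and \<open>d\<close> is regrouped
  by the product of the indices. Nonnegativity makes the iterated sum unconditional, which allows
  this.\<close>

lemma lambert_rearrangement:
  fixes G :: "nat \<Rightarrow> nat \<Rightarrow> real"
  assumes nonneg: "\<And>m d. 0 \<le> G m d"
    and inner: "\<And>d. (\<lambda>m. G (Suc m) (Suc d)) sums S d" and outer: "S sums T"
  shows "(\<lambda>i. \<Sum>m | m dvd Suc i. G m (Suc i div m)) sums T"
proof -
  let ?f = "\<lambda>(d, m). G (Suc m) (Suc d)"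
  have S_nonneg: "0 \<le> S d" for d
    by (rule sums_le[OF nonneg sums_zero inner])
  have in': "((\<lambda>m. ?f (d, m)) has_sum S d) UNIV" for d
    using sums_nonneg_imp_has_sum[OF inner nonneg] by simp
  have out': "(S has_sum T) UNIV"
    by (rule sums_nonneg_imp_has_sum[OF outer S_nonneg])
  have "?f summable_on (UNIV \<times> UNIV)"
    by (rule summable_on_SigmaI[OF in']) (use out' nonneg in \<open>auto simp: has_sum_imp_summable\<close>)
  then have *: "(?f has_sum T) (UNIV \<times> UNIV)"
    by (intro has_sum_SigmaI[where g = S] in' out') auto
  have "((\<lambda>(i, m). G m (Suc i div m)) has_sum T) (SIGMA i:UNIV. {m. m dvd Suc i})"
  proof (rule iffD1[OF has_sum_reindex_bij_witness[
        where i = "\<lambda>(i, m). (Suc i div m - 1, m - 1)" and j = "\<lambda>(d, m). (Suc d * Suc m - 1, Suc m)"] *])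
    fix b assume "b \<in> (SIGMA i:UNIV. {m. m dvd Suc i})"
    then obtain i m where b: "b = (i, m)" "m dvd Suc i" by auto
    then obtain d where d: "Suc i = m * d" by (auto elim!: dvdE)
    then have pos: "0 < d" "0 < m" by (auto intro: Nat.gr0I)
    then have "Suc i div m = d" by (simp add: d)
    moreover have "Suc (d - 1) * Suc (m - 1) - 1 = i" using pos d by (simp add: mult.commute[of m d, symmetric])
    ultimately show "(case case b of (i, m) \<Rightarrow> (Suc i div m - 1, m - 1) of (d, m) \<Rightarrow> (Suc d * Suc m - 1, Suc m)) = b"
      unfolding b(1) prod.case using pos by (simp del: mult_Suc mult_Suc_right)
  qed (auto simp del: mult_Suc mult_Suc_right)
  then have "((\<lambda>i. \<Sum>m | m dvd Suc i. G m (Suc i div m)) has_sum T) UNIV"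
    by (rule has_sum_SigmaD) (auto intro!: has_sum_finiteI finite_divisors_nat)
  then show ?thesis by (rule has_sum_imp_sums)
qed

section \<open>Polylogarithms of order -r at exp(-x), bounded uniformly and near 0\<close>

definition pow_exp_sum :: "nat \<Rightarrow> real \<Rightarrow> real" where
  "pow_exp_sum r x = (\<Sum>m. real (Suc m) ^ r * exp (- (real (Suc m) * x)))"

text \<open>The negative binomial series: the induction multiplies by one more geometric series, and
  the hockey-stick identity sums the coefficients.\<close>

lemma choose_sums:
  fixes y :: real
  assumes "0 \<le> y" "y < 1"
  shows "(\<lambda>m. real ((r + m) choose m) * y ^ m) sums (1 / (1 - y) ^ Suc r)"
proof (induction r)
  case 0
  then show ?case using geometric_sums[of y] assms by simp
next
  case (Suc r)
  have "summable (\<lambda>m. norm (real ((r + m) choose m) * y ^ m))"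
    using Suc assms by (simp add: sums_iff abs_mult)
  moreover have "summable (\<lambda>m. norm (y ^ m))"
    using assms by (simp add: summable_geometric norm_power)
  ultimately have "(\<lambda>k. \<Sum>i\<le>k. (real ((r + i) choose i) * y ^ i) * y ^ (k - i)) sums
      ((\<Sum>m. real ((r + m) choose m) * y ^ m) * (\<Sum>m. y ^ m))"
    by (rule Cauchy_product_sums)
  moreover have "(\<Sum>i\<le>k. (real ((r + i) choose i) * y ^ i) * y ^ (k - i)) = real ((Suc r + k) choose k) * y ^ k" for k
  proof -
    have "(\<Sum>i\<le>k. (real ((r + i) choose i) * y ^ i) * y ^ (k - i)) = (\<Sum>i\<le>k. real ((r + i) choose i) * y ^ k)"
      by (intro sum.cong) (auto simp: mult.assoc power_add[symmetric])
    also have "\<dots> = real (\<Sum>i\<le>k. (r + i) choose i) * y ^ k"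
      by (simp add: sum_distrib_right)
    finally show ?thesis by (simp only: sum_choose_lower add_Suc)
  qed
  ultimately show ?case
    using Suc assms by (simp add: sums_iff suminf_geometric)
qed

text \<open>The right side is the rising product (j+1)(j+2)...(j+r), each of whose factors is at
  least j+1.\<close>

lemma power_le_fact_choose: "Suc j ^ r \<le> fact r * ((r + j) choose j)"
proof (induction r)
  case (Suc r)
  have 1: "(Suc r + j) choose j = (Suc (r + j) choose Suc r)"
    by (subst binomial_symmetric) auto
  have 2: "(r + j) choose j = (r + j choose r)"
    by (subst binomial_symmetric) auto
  have "fact (Suc r) * ((Suc r + j) choose j) = fact r * (Suc r * (Suc (r + j) choose Suc r))"
    unfolding 1 fact_Suc of_nat_id by (simp only: mult_ac)
  also have "\<dots> = Suc (r + j) * (fact r * ((r + j) choose j))"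
    unfolding Suc_times_binomial 2 by (simp only: mult_ac)
  also have "\<dots> \<ge> Suc j * Suc j ^ r"
    using Suc by (intro mult_mono) auto
  finally show ?case by simp
qed auto

lemma pow_exp_sum_props:
  assumes "x > 0"
  shows summable_pow_exp: "summable (\<lambda>m. real (Suc m) ^ r * exp (- (real (Suc m) * x)))"
    and pow_exp_sum_le: "pow_exp_sum r x \<le> fact r * exp (-x) / (1 - exp (-x)) ^ Suc r"
proof -
  let ?y = "exp (-x)"
  have ch: "(\<lambda>m. fact r * ?y * (real ((r + m) choose m) * ?y ^ m)) sums (fact r * ?y * (1 / (1 - ?y) ^ Suc r))"
    by (rule sums_mult, rule choose_sums) (use assms in auto)
  have le: "real (Suc m) ^ r * exp (- (real (Suc m) * x)) \<le> fact r * ?y * (real ((r + m) choose m) * ?y ^ m)" for m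
  proof -
    have "real (Suc m) ^ r \<le> fact r * real ((r + m) choose m)"
      using power_le_fact_choose[of m r] by (metis of_nat_fact of_nat_le_iff of_nat_mult of_nat_power)
    then have "real (Suc m) ^ r * (?y * ?y ^ m) \<le> fact r * real ((r + m) choose m) * (?y * ?y ^ m)"
      by (rule mult_right_mono) auto
    moreover have "exp (- (real (Suc m) * x)) = ?y * ?y ^ m"
      by (simp add: exp_of_nat_mult[symmetric] exp_add[symmetric] algebra_simps)
    ultimately show ?thesis by (simp only: mult_ac)
  qed
  show s: "summable (\<lambda>m. real (Suc m) ^ r * exp (- (real (Suc m) * x)))"
    by (rule summable_comparison_test'[OF sums_summable[OF ch], of 0]) (use le in \<open>auto simp: abs_mult\<close>)
  show "pow_exp_sum r x \<le> fact r * ?y / (1 - ?y) ^ Suc r"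
    using sums_le[OF le summable_sums[OF s] ch] by (simp add: pow_exp_sum_def)
qed

lemma pow_exp_sum_nonneg: "x > 0 \<Longrightarrow> 0 \<le> pow_exp_sum r x"
  unfolding pow_exp_sum_def by (intro suminf_nonneg summable_pow_exp) auto

text \<open>Now the product (m+1)...(m+r) is compared with the power of its largest factor. Aligning
  the indices discards the first \<open>r - 1\<close> terms, which explains the exponent
  \<open>r\<close> of \<open>exp (-x)\<close> where the upper bound has exponent 1.\<close>

lemma pow_exp_sum_ge:
  assumes "x > 0" "r \<ge> 1"
  shows "pow_exp_sum r x \<ge> fact r * exp (-x) ^ r / (1 - exp (-x)) ^ Suc r"
proof -
  let ?y = "exp (-x)"
  let ?g = "\<lambda>m. real (Suc m) ^ r * exp (- (real (Suc m) * x))"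
  have ch: "(\<lambda>m. fact r * ?y ^ r * (real ((r + m) choose m) * ?y ^ m)) sums (fact r * ?y ^ r * (1 / (1 - ?y) ^ Suc r))"
    by (rule sums_mult, rule choose_sums) (use assms in auto)
  have s: "summable ?g" by (rule summable_pow_exp[OF assms(1)])
  then have s': "summable (\<lambda>m. ?g (m + (r - 1)))" by (rule summable_ignore_initial_segment)
  have le: "fact r * ?y ^ r * (real ((r + m) choose m) * ?y ^ m) \<le> ?g (m + (r - 1))" for m
  proof -
    have "((r + m) choose m) * fact r \<le> (r + m) ^ r"
      using binomial_fact_pow[of "r + m" r] by (subst binomial_symmetric) auto
    then have "fact r * real ((r + m) choose m) \<le> real (r + m) ^ r"
      by (metis mult.commute of_nat_fact of_nat_le_iff of_nat_mult of_nat_power)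
    then have "fact r * real ((r + m) choose m) * (?y ^ r * ?y ^ m) \<le> real (r + m) ^ r * (?y ^ r * ?y ^ m)"
      by (rule mult_right_mono) auto
    moreover have "Suc (m + (r - 1)) = r + m" using assms by simp
    moreover have "exp (- (real (r + m) * x)) = ?y ^ r * ?y ^ m"
      by (simp add: exp_of_nat_mult[symmetric] exp_add[symmetric] algebra_simps)
    ultimately show ?thesis by (simp only: mult_ac)
  qed
  have "(\<Sum>m. ?g (m + (r - 1))) \<le> suminf ?g"
    by (subst suminf_split_initial_segment[OF s, of "r - 1"]) (auto intro!: sum_nonneg)
  then show ?thesis
    using sums_le[OF le ch summable_sums[OF s']] by (simp add: pow_exp_sum_def)
qed

lemma div_one_minus_exp_le: "x > 0 \<Longrightarrow> x / (1 - exp (-x)) \<le> 1 + (x::real)"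
proof -
  assume x: "x > 0"
  have "(1 + x) * exp (-x) \<le> exp x * exp (-x)"
    by (intro mult_right_mono exp_ge_add_one_self) auto
  then have "(1 + x) * exp (-x) \<le> 1" by (simp add: exp_add[symmetric])
  then show ?thesis using x by (simp add: field_simps)
qed

text \<open>The bound is uniform in \<open>x\<close>, which is what dominated convergence over the
  multiples \<open>d * t\<close> requires.\<close>

lemma pow_exp_sum_bound:
  assumes "x > 0" "r \<ge> 1"
  shows "x ^ Suc r * pow_exp_sum r x \<le> fact r * real (Suc r) ^ Suc r"
proof -
  \<comment> \<open>This splits \<open>exp (-x)\<close> into \<open>Suc r\<close> equal factors, one
    for each of the linearly growing factors \<open>x / (1 - exp (-x))\<close>.\<close>
  define z where "z = x / real (Suc r)"
  have z: "z > 0" "real (Suc r) * z = x" using assms by (auto simp: z_def)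
  have e: "exp (-x) = exp (-z) ^ Suc r"
    by (subst exp_of_nat_mult[symmetric]) (simp add: z(2)[symmetric] del: of_nat_Suc)
  have "x / (1 - exp (-x)) * exp (-z) \<le> (1 + real (Suc r) * z) * exp (-z)"
    using div_one_minus_exp_le[OF assms(1)] z(2) by (intro mult_right_mono) auto
  also have "\<dots> \<le> (real (Suc r) * (1 + z)) * exp (-z)"
    by (intro mult_right_mono) (auto simp: algebra_simps)
  also have "\<dots> \<le> (real (Suc r) * exp z) * exp (-z)"
    by (intro mult_right_mono mult_left_mono exp_ge_add_one_self) auto
  also have "\<dots> = real (Suc r)" by (simp add: exp_minus)
  finally have *: "x / (1 - exp (-x)) * exp (-z) \<le> real (Suc r)" .
  have "x ^ Suc r * pow_exp_sum r x \<le> x ^ Suc r * (fact r * exp (-x) / (1 - exp (-x)) ^ Suc r)"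
    using assms by (intro mult_left_mono pow_exp_sum_le) auto
  also have "\<dots> = fact r * (x / (1 - exp (-x)) * exp (-z)) ^ Suc r"
    unfolding power_mult_distrib power_divide e[symmetric] by simp
  also have "\<dots> \<le> fact r * real (Suc r) ^ Suc r"
    using assms * by (intro mult_left_mono power_mono) auto
  finally show ?thesis .
qed

lemma pow_exp_sum_tendsto:
  assumes "r \<ge> 1"
  shows "((\<lambda>x. x ^ Suc r * pow_exp_sum r x) \<longlongrightarrow> fact r) (at_right 0)"
proof (rule tendsto_sandwich)
  have lim: "((\<lambda>x::real. x / (1 - exp (-x))) \<longlongrightarrow> 1) (at_right 0)" by real_asymp
  have lim2: "((\<lambda>x::real. exp (-x)) \<longlongrightarrow> 1) (at_right 0)" by real_asymp
  show "((\<lambda>x::real. fact r * exp (-x) ^ r * (x / (1 - exp (-x))) ^ Suc r) \<longlongrightarrow> fact r) (at_right 0)"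
    using tendsto_mult[OF tendsto_mult[OF tendsto_const tendsto_power[OF lim2]] tendsto_power[OF lim],
      of "fact r" r "Suc r"] by simp
  show "((\<lambda>x::real. fact r * exp (-x) * (x / (1 - exp (-x))) ^ Suc r) \<longlongrightarrow> fact r) (at_right 0)"
    using tendsto_mult[OF tendsto_mult[OF tendsto_const lim2] tendsto_power[OF lim],
      of "fact r" "Suc r"] by simp
  show "\<forall>\<^sub>F x::real in at_right 0. fact r * exp (-x) ^ r * (x / (1 - exp (-x))) ^ Suc r \<le> x ^ Suc r * pow_exp_sum r x"
    using eventually_at_right_less[of "0::real"]
  proof eventually_elim
    case (elim x)
    show ?case using mult_left_mono[OF pow_exp_sum_ge[OF elim assms], of "x ^ Suc r"] elim
      by (simp add: power_divide mult_ac)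
  qed
  show "\<forall>\<^sub>F x::real in at_right 0. x ^ Suc r * pow_exp_sum r x \<le> fact r * exp (-x) * (x / (1 - exp (-x))) ^ Suc r"
    using eventually_at_right_less[of "0::real"]
  proof eventually_elim
    case (elim x)
    show ?case using mult_left_mono[OF pow_exp_sum_le[OF elim], of "x ^ Suc r"] elim
      by (simp add: power_divide mult_ac)
  qed
qed

section \<open>Lambert series with divisor sums as t tends to 0\<close>

lemma power_mult_split: "(D * t) ^ Suc (b + l) = t ^ Suc (b + l) * D ^ b * D ^ Suc l" for D t :: real
  by (simp add: power_mult_distrib power_add mult_ac)

text \<open>For \<open>i = m * d\<close> the weight i^b m^l is m^(b+l) d^b, so the sum over
  \<open>m\<close> is \<open>pow_exp_sum\<close> at \<open>d * t\<close>. The majorant in the third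
  part does not depend on \<open>t\<close> and is summable over \<open>d\<close> because
  \<open>l \<ge> 1\<close>.\<close>

lemma divisor_series:
  assumes "l \<ge> 1" "t > 0"
  shows divisor_series_sums: "(\<lambda>i. real (Suc i) ^ b * divisor_sum l (Suc i) * exp (- (real (Suc i) * t))) sums
      (\<Sum>d. real (Suc d) ^ b * pow_exp_sum (b + l) (real (Suc d) * t))"
    and summable_divisor_series: "summable (\<lambda>d. real (Suc d) ^ b * pow_exp_sum (b + l) (real (Suc d) * t))"
    and divisor_series_le: "t ^ Suc (b + l) * (real (Suc d) ^ b * pow_exp_sum (b + l) (real (Suc d) * t)) \<le>
      fact (b + l) * real (Suc (b + l)) ^ Suc (b + l) * (1 / real (Suc d) ^ Suc l)"
proof -
  let ?r = "b + l"
  let ?C = "fact ?r * real (Suc ?r) ^ Suc ?r"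
  let ?G = "\<lambda>m d. real m ^ ?r * real d ^ b * exp (- (real (m * d) * t))"
  show le: "t ^ Suc ?r * (real (Suc d) ^ b * pow_exp_sum ?r (real (Suc d) * t)) \<le> ?C * (1 / real (Suc d) ^ Suc l)" for d
  proof -
    have "(real (Suc d) * t) ^ Suc ?r * pow_exp_sum ?r (real (Suc d) * t) \<le> ?C"
      using assms by (intro pow_exp_sum_bound) auto
    then have "t ^ Suc ?r * (real (Suc d) ^ b * pow_exp_sum ?r (real (Suc d) * t)) * real (Suc d) ^ Suc l \<le> ?C"
      unfolding power_mult_split by (simp only: mult_ac)
    then show ?thesis
      by (subst times_divide_eq_right, subst pos_le_divide_eq) auto
  qed
  have zs: "summable (\<lambda>d. 1 / real (Suc d) ^ Suc l)"
    using inverse_power_summable[of "Suc l", where 'a = real] assms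
    by (subst summable_Suc_iff) (simp add: inverse_eq_divide)
  have "summable (\<lambda>d. t ^ Suc ?r * (real (Suc d) ^ b * pow_exp_sum ?r (real (Suc d) * t)))"
    by (rule summable_comparison_test'[OF summable_mult[OF zs, of ?C], of 0])
       (use le assms pow_exp_sum_nonneg in \<open>auto simp: abs_mult simp del: of_nat_Suc power_Suc\<close>)
  then show s: "summable (\<lambda>d. real (Suc d) ^ b * pow_exp_sum ?r (real (Suc d) * t))"
    by (rule summable_mult_D) (use assms in simp)
  have "(\<lambda>i. \<Sum>m | m dvd Suc i. ?G m (Suc i div m)) sums (\<Sum>d. real (Suc d) ^ b * pow_exp_sum ?r (real (Suc d) * t))"
  proof (rule lambert_rearrangement)
    fix d
    have "summable (\<lambda>m. real (Suc m) ^ ?r * exp (- (real (Suc m) * (real (Suc d) * t))))"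
      by (rule summable_pow_exp) (use assms in auto)
    from sums_mult[OF summable_sums[OF this], of "real (Suc d) ^ b"]
    show "(\<lambda>m. ?G (Suc m) (Suc d)) sums (real (Suc d) ^ b * pow_exp_sum ?r (real (Suc d) * t))"
      by (simp only: pow_exp_sum_def mult_ac of_nat_mult)
  qed (use s in \<open>auto intro: summable_sums\<close>)
  also have "(\<lambda>i. \<Sum>m | m dvd Suc i. ?G m (Suc i div m)) =
     (\<lambda>i. real (Suc i) ^ b * divisor_sum l (Suc i) * exp (- (real (Suc i) * t)))"
  proof
    fix i
    have "?G m (Suc i div m) = real (Suc i) ^ b * real m ^ l * exp (- (real (Suc i) * t))" if "m dvd Suc i" for m
    proof -
      have "m * (Suc i div m) = Suc i" using that by simp
      then have *: "real (Suc i) = real m * real (Suc i div m)" by (metis of_nat_mult)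
      define d where "d = Suc i div m"
      from * show ?thesis
        unfolding d_def[symmetric] by (simp add: power_add power_mult_distrib mult_ac del: of_nat_Suc)

    qed
    then show "(\<Sum>m | m dvd Suc i. ?G m (Suc i div m)) = real (Suc i) ^ b * divisor_sum l (Suc i) * exp (- (real (Suc i) * t))"
      by (simp add: divisor_sum_def sum_distrib_left sum_distrib_right)
  qed
  finally show "(\<lambda>i. real (Suc i) ^ b * divisor_sum l (Suc i) * exp (- (real (Suc i) * t))) sums
      (\<Sum>d. real (Suc d) ^ b * pow_exp_sum ?r (real (Suc d) * t))" .
qed

text \<open>Up to the sign (-1)^b this is the b-th derivative of the Lambert series of
  \<open>divisor_sum l\<close>. For \<open>l = 1\<close> the values \<open>b = 0, 1, 2\<close> are,
  up to sign and a factor 2, the first three derivatives in \<open>t\<close> of the logarithm of the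
  generating function of pairs.\<close>

definition divisor_series :: "nat \<Rightarrow> nat \<Rightarrow> real \<Rightarrow> real" where
  "divisor_series b l t = (\<Sum>i. real (Suc i) ^ b * divisor_sum l (Suc i) * exp (- (real (Suc i) * t)))"

text \<open>After multiplication by the power of \<open>t\<close>, the summand at \<open>d\<close>
  is a function of \<open>d * t\<close> divided by d^(l+1). Each summand converges by
  \<open>pow_exp_sum_tendsto\<close>, and Tannery's theorem exchanges limit and sum.\<close>

lemma divisor_series_tendsto:
  assumes "l \<ge> 1"
  shows "((\<lambda>t. t ^ Suc (b + l) * divisor_series b l t) \<longlongrightarrow> fact (b + l) * (\<Sum>d. 1 / real (Suc d) ^ Suc l)) (at_right 0)"
proof -
  let ?r = "b + l"
  let ?C = "fact ?r * real (Suc ?r) ^ Suc ?r"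
  let ?f = "\<lambda>d t. t ^ Suc ?r * (real (Suc d) ^ b * pow_exp_sum ?r (real (Suc d) * t))"
  have zs: "summable (\<lambda>d. 1 / real (Suc d) ^ Suc l)"
    using inverse_power_summable[of "Suc l", where 'a = real] assms
    by (subst summable_Suc_iff) (simp add: inverse_eq_divide)
  have lim: "(?f d \<longlongrightarrow> fact ?r * (1 / real (Suc d) ^ Suc l)) (at_right 0)" for d
  proof -
    have "((\<lambda>t. (real (Suc d) * t) ^ Suc ?r * pow_exp_sum ?r (real (Suc d) * t)) \<longlongrightarrow> fact ?r) (at_right 0)"
    proof (rule filterlim_compose[OF pow_exp_sum_tendsto])
      show "filterlim ((*) (real (Suc d))) (at_right 0) (at_right 0)"
        by (rule filterlim_times_pos[where p = 0]) (auto simp: filterlim_ident)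
    qed (use assms in auto)
    from tendsto_mult[OF tendsto_const[of "1 / real (Suc d) ^ Suc l"] this]
    have "((\<lambda>t. 1 / real (Suc d) ^ Suc l * ((real (Suc d) * t) ^ Suc ?r * pow_exp_sum ?r (real (Suc d) * t)))
       \<longlongrightarrow> fact ?r * (1 / real (Suc d) ^ Suc l)) (at_right 0)" by (simp add: mult.commute)
    moreover have "1 / real (Suc d) ^ Suc l * ((real (Suc d) * t) ^ Suc ?r * pow_exp_sum ?r (real (Suc d) * t)) = ?f d t" for t
      unfolding power_mult_split by (simp del: of_nat_Suc power_Suc)
    ultimately show ?thesis by simp
  qed
  have "((\<lambda>t. suminf (\<lambda>d. ?f d t)) \<longlongrightarrow> (\<Sum>d. fact ?r * (1 / real (Suc d) ^ Suc l))) (at_right 0)"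
  proof (rule conjunct2[OF conjunct2[OF tannerys_theorem[where M = "\<lambda>d. ?C * (1 / real (Suc d) ^ Suc l)"]]])
    show "\<forall>\<^sub>F (k, t) in sequentially \<times>\<^sub>F at_right 0. norm (?f k t) \<le> ?C * (1 / real (Suc k) ^ Suc l)"
    proof (rule eventually_mono[OF eventually_prodI[OF eventually_True eventually_at_right_less[of "0::real"]]])
      fix x :: "nat \<times> real" assume "True \<and> 0 < snd x"
      then show "case x of (k, t) \<Rightarrow> norm (?f k t) \<le> ?C * (1 / real (Suc k) ^ Suc l)"
        using divisor_series_le[OF assms, of "snd x" b "fst x"] pow_exp_sum_nonneg[of "real (Suc (fst x)) * snd x" ?r]
        by (auto simp: case_prod_unfold abs_mult simp del: of_nat_Suc power_Suc)
    qed
    show "summable (\<lambda>d. ?C * (1 / real (Suc d) ^ Suc l))" by (rule summable_mult[OF zs])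
  qed (use lim in auto)
  also have "(\<Sum>d. fact ?r * (1 / real (Suc d) ^ Suc l)) = fact ?r * (\<Sum>d. 1 / real (Suc d) ^ Suc l)"
    by (rule suminf_mult[OF zs])
  finally show ?thesis
  proof (rule Lim_transform_eventually)
    show "\<forall>\<^sub>F t in at_right 0. suminf (\<lambda>d. ?f d t) = t ^ Suc ?r * divisor_series b l t"
      using eventually_at_right_less[of "0::real"]
    proof eventually_elim
      case (elim t)
      have "divisor_series b l t = (\<Sum>d. real (Suc d) ^ b * pow_exp_sum ?r (real (Suc d) * t))"
        using divisor_series_sums[OF assms elim] by (simp add: divisor_series_def sums_iff)
      then show ?case
        using suminf_mult[OF summable_divisor_series[OF assms elim]] by simp
    qed
  qed
qed

section \<open>The Euler product near its singularity\<close>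

lemma sinh_ge_self: "0 \<le> y \<Longrightarrow> y \<le> sinh (y::real)"
proof -
  assume y: "0 \<le> y"
  have "sinh 0 - 0 \<le> sinh y - y"
    by (rule DERIV_nonneg_imp_nondecreasing[OF y])
       (auto intro!: exI derivative_eq_intros simp: cosh_real_ge_1)
  then show ?thesis by simp
qed

lemma sinh_le_mult_cosh: "0 \<le> y \<Longrightarrow> sinh (y::real) \<le> y * cosh y"
proof -
  assume y: "0 \<le> y"
  have "0 * cosh 0 - sinh 0 \<le> y * cosh y - sinh y"
  proof (rule DERIV_nonneg_imp_nondecreasing[OF y])
    fix x :: real assume x: "0 \<le> x" "x \<le> y"
    have "((\<lambda>y. y * cosh y - sinh y) has_real_derivative x * sinh x) (at x)"
      by (auto intro!: derivative_eq_intros)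
    then show "\<exists>d. ((\<lambda>y. y * cosh y - sinh y) has_real_derivative d) (at x) \<and> 0 \<le> d"
      using x by (intro exI[of _ "x * sinh x"]) auto
  qed
  then show ?thesis by simp
qed

lemma exp_over_square_eq_sinh:
  assumes "x > 0"
  shows "exp (-x) / (1 - exp (-x))\<^sup>2 = 1 / (4 * sinh (x / 2) ^ 2 :: real)"
proof -
  define e where "e = exp (x / 2)"
  have e: "e > 1" using assms by (simp add: e_def)
  have 1: "exp (-x) = inverse (e ^ 2)"
    by (simp add: e_def exp_minus exp_double[symmetric])
  have 2: "sinh (x / 2) = (e - inverse e) / 2"
    by (simp add: sinh_field_def e_def exp_minus)
  have "e * e > 1" using e by (simp add: less_1_mult)
  then show ?thesis
    unfolding 1 2 using e by (simp add: divide_simps power2_eq_square)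
qed

text \<open>With \<open>y = x / 2\<close> the quotient is \<open>1 / (4 * sinh y ^ 2)\<close>. The
  inequalities \<open>y \<le> sinh y\<close> and \<open>sinh y \<le> y * cosh y\<close> place
  \<open>1 / y\<^sup>2 - 1 / sinh y ^ 2\<close> between 0 and 1.\<close>

lemma exp_over_square_bounds:
  assumes "x > (0::real)"
  shows "exp (-x) / (1 - exp (-x))\<^sup>2 \<le> 1 / x\<^sup>2"
    and "1 / x\<^sup>2 - exp (-x) / (1 - exp (-x))\<^sup>2 \<le> 1"
proof -
  define y where "y = x / 2"
  have y: "y > 0" using assms by (simp add: y_def)
  have eq: "exp (-x) / (1 - exp (-x))\<^sup>2 = 1 / (4 * sinh y ^ 2)"
    unfolding y_def by (rule exp_over_square_eq_sinh[OF assms])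
  have x: "x = 2 * y" by (simp add: y_def)
  have s: "sinh y > 0" "y \<le> sinh y" "sinh y \<le> y * cosh y"
    using y sinh_ge_self[of y] sinh_le_mult_cosh[of y] by auto
  have "y ^ 2 \<le> sinh y ^ 2" using s y by (intro power_mono) auto
  then show "exp (-x) / (1 - exp (-x))\<^sup>2 \<le> 1 / x\<^sup>2"
    unfolding eq unfolding x using y s by (simp add: power_mult_distrib divide_simps)
  have sq: "sinh y ^ 2 \<le> y ^ 2 * cosh y ^ 2"
    using power_mono[OF s(3), of 2] s by (simp add: power_mult_distrib)
  have c: "cosh y ^ 2 = 1 + sinh y ^ 2" using cosh_square_eq[of y] by simp
  define v where "v = 1 / y\<^sup>2 - 1 / sinh y ^ 2"
  have v: "v \<le> 1"
    unfolding v_def using sq c y s by (simp add: divide_simps) (simp add: algebra_simps)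
  have eq': "1 / x\<^sup>2 - exp (-x) / (1 - exp (-x))\<^sup>2 = v / 4"
    unfolding eq v_def unfolding x by (simp add: power_mult_distrib diff_divide_distrib)
  show "1 / x\<^sup>2 - exp (-x) / (1 - exp (-x))\<^sup>2 \<le> 1" unfolding eq' using v by simp
qed

text \<open>Interpolation between the bounds 1 and 1/x^2. An exponent above 1 makes sums over the
  multiples of \<open>t\<close> converge, and one below 2 keeps their growth as \<open>t\<close>
  tends to 0 small.\<close>

lemma min_one_inverse_square_le_powr:
  assumes "x > (0::real)" "0 \<le> a" "a \<le> 2" "z \<le> 1" "z \<le> 1 / x\<^sup>2"
  shows "z \<le> x powr (-a)"
proof (cases "x \<le> 1")
  case True
  have "x powr 0 \<le> x powr (-a)"
    using assms True by (intro powr_mono') auto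
  then show ?thesis using assms by simp
next
  case False
  have "1 / x\<^sup>2 = x powr (-2)"
    using assms by (simp add: powr_minus powr_numeral inverse_eq_divide)
  also have "\<dots> \<le> x powr (-a)"
    using assms False by (intro powr_mono) auto
  finally show ?thesis using assms by simp
qed

lemma pow_exp_sum_1:
  assumes "x > 0"
  shows "pow_exp_sum 1 x = exp (-x) / (1 - exp (-x))\<^sup>2"
proof -
  have "(\<lambda>m. exp (-x) * (real ((1 + m) choose m) * exp (-x) ^ m)) sums (exp (-x) * (1 / (1 - exp (-x)) ^ Suc 1))"
    by (intro sums_mult choose_sums) (use assms in auto)
  moreover have "exp (-x) * (real ((1 + m) choose m) * exp (-x) ^ m) = real (Suc m) ^ 1 * exp (- (real (Suc m) * x))" for m
    by (simp add: exp_of_nat_mult[symmetric] algebra_simps exp_add[symmetric] mult_exp_exp)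
  ultimately have "(\<lambda>m. real (Suc m) ^ 1 * exp (- (real (Suc m) * x))) sums (exp (-x) * (1 / (1 - exp (-x)) ^ Suc 1))"
    by (simp only:)
  then show ?thesis unfolding pow_exp_sum_def by (simp add: sums_iff power2_eq_square del: of_nat_Suc)
qed

lemma zeta_2_sums: "(\<lambda>d. 1 / real (Suc d) ^ 2) sums (pi\<^sup>2 / 6)"
  using inverse_squares_sums by (simp add: add.commute)

text \<open>The leading order alone would not do: this series is the linear term of the expansion on
  the circle and gets multiplied by an angle of order t^(3/2). The exponent 5/4 lies above 1, for
  convergence over \<open>d\<close>, and below 3/2, so that the product still tends to 0.\<close>

lemma divisor_series_0_1_approx:
  obtains C where "\<And>t. t > 0 \<Longrightarrow> \<bar>divisor_series 0 1 t - pi\<^sup>2 / 6 / t\<^sup>2\<bar> \<le> C * t powr (-5/4)"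
proof
  fix t :: real assume t: "t > 0"
  let ?q = "\<lambda>x. exp (-x) / (1 - exp (-x))\<^sup>2 :: real"
  have "(\<lambda>d. ?q (real (Suc d) * t)) sums divisor_series 0 1 t"
    using divisor_series_sums[of 1 t 0] summable_divisor_series[of 1 t 0] t
    by (simp add: divisor_series_def pow_exp_sum_1[unfolded One_nat_def] sums_iff del: of_nat_Suc)
  moreover have "(\<lambda>d. 1 / (real (Suc d) * t)\<^sup>2) sums (pi\<^sup>2 / 6 / t\<^sup>2)"
    using sums_divide[OF zeta_2_sums, of "t\<^sup>2"] by (simp add: power_mult_distrib del: of_nat_Suc)
  ultimately have s: "(\<lambda>d. ?q (real (Suc d) * t) - 1 / (real (Suc d) * t)\<^sup>2) sums (divisor_series 0 1 t - pi\<^sup>2 / 6 / t\<^sup>2)"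
    by (rule sums_diff)
  have zs: "summable (\<lambda>d. real (Suc d) powr (-5/4))"
    by (subst summable_Suc_iff) (simp add: summable_real_powr_iff)
  have bd: "norm (?q (real (Suc d) * t) - 1 / (real (Suc d) * t)\<^sup>2) \<le> t powr (-5/4) * real (Suc d) powr (-5/4)" for d
  proof -
    define x where "x = real (Suc d) * t"
    have x: "x > 0" using t by (simp add: x_def)
    have "1 / x\<^sup>2 - ?q x \<le> x powr (-(5/4))"
      using exp_over_square_bounds[OF x] x by (intro min_one_inverse_square_le_powr) auto
    moreover have "?q x \<le> 1 / x\<^sup>2" using exp_over_square_bounds(1)[OF x] .
    ultimately have "norm (?q x - 1 / x\<^sup>2) \<le> x powr (-5/4)" by (simp add: abs_if)
    also have "x powr (-5/4) = t powr (-5/4) * real (Suc d) powr (-5/4)"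
      using t by (simp add: x_def powr_mult del: of_nat_Suc)
    finally show ?thesis unfolding x_def .
  qed
  have "norm (\<Sum>d. ?q (real (Suc d) * t) - 1 / (real (Suc d) * t)\<^sup>2) \<le> (\<Sum>d. t powr (-5/4) * real (Suc d) powr (-5/4))"
    by (rule norm_suminf_le[OF bd summable_mult[OF zs]])
  also have "\<dots> = t powr (-5/4) * (\<Sum>d. real (Suc d) powr (-5/4))"
    by (rule suminf_mult[OF zs])
  finally show "\<bar>divisor_series 0 1 t - pi\<^sup>2 / 6 / t\<^sup>2\<bar> \<le> (\<Sum>d. real (Suc d) powr (-5/4)) * t powr (-5/4)"
    using s by (simp add: sums_iff mult.commute)
qed

text \<open>Taylor expansions of \<open>K\<close> and \<open>k\<close> at the left end agree up to
  the term with \<open>k'\<close>; what remains is \<open>k''\<close> at two points with weights 1/4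
  and 1/6, whose sum is below 1.\<close>

lemma trapezoid_error:
  fixes K k k' k'' :: "real \<Rightarrow> real"
  assumes h: "h > 0"
    and K: "\<And>x. a \<le> x \<Longrightarrow> x \<le> a + h \<Longrightarrow> (K has_real_derivative k x) (at x)"
    and k: "\<And>x. a \<le> x \<Longrightarrow> x \<le> a + h \<Longrightarrow> (k has_real_derivative k' x) (at x)"
    and k': "\<And>x. a \<le> x \<Longrightarrow> x \<le> a + h \<Longrightarrow> (k' has_real_derivative k'' x) (at x)"
    and B: "\<And>x. a \<le> x \<Longrightarrow> x \<le> a + h \<Longrightarrow> \<bar>k'' x\<bar> \<le> B"
  shows "\<bar>h * (k a + k (a + h)) / 2 - (K (a + h) - K a)\<bar> \<le> h ^ 3 * B"
proof -
  define diff where "diff = (\<lambda>m::nat. if m = 0 then K else if m = 1 then k else if m = 2 then k' else k'')"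
  define diff2 where "diff2 = (\<lambda>m::nat. if m = 0 then k else if m = 1 then k' else k'')"
  have "\<exists>t. a < t \<and> t < a + h \<and> K (a + h) = (\<Sum>m<3. (diff m a / fact m) * (a + h - a)^m) + (diff 3 t / fact 3) * (a + h - a)^3"
  proof (rule Taylor_up)
    show "\<forall>m t. m < 3 \<and> a \<le> t \<and> t \<le> a + h \<longrightarrow> (diff m has_real_derivative diff (Suc m) t) (at t)"
    proof (intro allI impI)
      fix m :: nat and t assume "m < 3 \<and> a \<le> t \<and> t \<le> a + h"
      then show "(diff m has_real_derivative diff (Suc m) t) (at t)"
        using K k k' by (cases "m = 0"; cases "m = 1"; cases "m = 2") (auto simp: diff_def)
    qed
  qed (use h in \<open>auto simp: diff_def\<close>)
  then obtain \<xi> where \<xi>: "a < \<xi>" "\<xi> < a + h"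
    "K (a + h) = K a + k a * h + k' a / 2 * h ^ 2 + k'' \<xi> / 6 * h ^ 3"
    by (auto simp: diff_def eval_nat_numeral)
  have "\<exists>t. a < t \<and> t < a + h \<and> k (a + h) = (\<Sum>m<2. (diff2 m a / fact m) * (a + h - a)^m) + (diff2 2 t / fact 2) * (a + h - a)^2"
  proof (rule Taylor_up)
    show "\<forall>m t. m < 2 \<and> a \<le> t \<and> t \<le> a + h \<longrightarrow> (diff2 m has_real_derivative diff2 (Suc m) t) (at t)"
    proof (intro allI impI)
      fix m :: nat and t assume "m < 2 \<and> a \<le> t \<and> t \<le> a + h"
      then show "(diff2 m has_real_derivative diff2 (Suc m) t) (at t)"
        using k k' by (cases "m = 0"; cases "m = 1") (auto simp: diff2_def)
    qed
  qed (use h in \<open>auto simp: diff2_def\<close>)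
  then obtain \<eta> where \<eta>: "a < \<eta>" "\<eta> < a + h" "k (a + h) = k a + k' a * h + k'' \<eta> / 2 * h ^ 2"
    by (auto simp: diff2_def eval_nat_numeral)
  have "h * (k a + k (a + h)) / 2 - (K (a + h) - K a) = h ^ 3 * (k'' \<eta> / 4 - k'' \<xi> / 6)"
    unfolding \<xi>(3) \<eta>(3) by (simp add: algebra_simps power2_eq_square power3_eq_cube add_divide_distrib)
  also have "\<bar>\<dots>\<bar> = h ^ 3 * \<bar>k'' \<eta> / 4 - k'' \<xi> / 6\<bar>"
    using h by (simp add: abs_mult)
  also have "\<dots> \<le> h ^ 3 * B"
  proof (rule mult_left_mono)
    show "\<bar>k'' \<eta> / 4 - k'' \<xi> / 6\<bar> \<le> B" using B[of \<eta>] B[of \<xi>] \<eta> \<xi> by linarith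
  qed (use h in simp)
  finally show ?thesis .
qed

text \<open>The term \<open>n = 0\<close> vanishes because \<open>x / 0 = 0\<close>.\<close>

definition dilog :: "real \<Rightarrow> real" where
  "dilog y = (\<Sum>n. y ^ n / real n ^ 2)"

lemma summable_dilog: "0 \<le> y \<Longrightarrow> y \<le> 1 \<Longrightarrow> summable (\<lambda>n. y ^ n / real n ^ 2)"
  by (rule summable_comparison_test'[OF inverse_power_summable[of 2, where 'a = real], of 0])
     (auto simp: divide_simps power_le_one)

lemma dilog_has_derivative:
  assumes "0 < y" "y < 1"
  shows "(dilog has_real_derivative - ln (1 - y) / y) (at y)"
proof -
  have "((\<lambda>y. \<Sum>n. 1 / real n ^ 2 * y ^ n) has_real_derivative (\<Sum>n. diffs (\<lambda>n. 1 / real n ^ 2) n * y ^ n)) (at y)"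
    by (rule termdiffs_strong[where K = 1]) (use summable_dilog[of 1] assms in auto)
  also have "(\<lambda>y. \<Sum>n. 1 / real n ^ 2 * y ^ n) = dilog"
    by (simp add: dilog_def fun_eq_iff)
  also have "(\<Sum>n. diffs (\<lambda>n. 1 / real n ^ 2) n * y ^ n) = - ln (1 - y) / y"
  proof -
    have "(\<lambda>n. y ^ n / real n) sums - ln (1 - y)"
      using sums_minus[OF ln_series'[of "-y"]] assms by simp
    then have "(\<lambda>n. y ^ Suc n / real (Suc n)) sums - ln (1 - y)"
      by (subst sums_Suc_iff) simp
    from sums_divide[OF this, of y]
    have "(\<lambda>n. y ^ n / real (Suc n)) sums (- ln (1 - y) / y)" using assms by simp
    moreover have "diffs (\<lambda>n. 1 / real n ^ 2) n * y ^ n = y ^ n / real (Suc n)" for n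
      by (simp add: diffs_def power2_eq_square divide_simps del: of_nat_Suc)
    ultimately show ?thesis by (simp add: sums_iff)
  qed
  finally show ?thesis .
qed

lemma dilog_exp_tendsto:
  "((\<lambda>x. dilog (exp (-x))) \<longlongrightarrow> pi\<^sup>2 / 6) (at_right 0)"
  "((\<lambda>x. dilog (exp (-x))) \<longlongrightarrow> 0) at_top"
proof -
  let ?f = "\<lambda>n x. exp (- x) ^ n / real n ^ 2"
  have M: "summable (\<lambda>n. 1 / real n ^ 2)" using summable_dilog[of 1] by simp
  have le: "norm (?f n x) \<le> 1 / real n ^ 2" if "x > 0" for n x
    using that by (auto simp: divide_simps power_le_one)
  have "((\<lambda>x. \<Sum>n. ?f n x) \<longlongrightarrow> (\<Sum>n. 1 / real n ^ 2)) (at_right 0)"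
  proof (rule conjunct2[OF conjunct2[OF tannerys_theorem[OF _ _ M]]])
    have "((\<lambda>x::real. exp (-x)) \<longlongrightarrow> 1) (at_right 0)" by real_asymp
    from tendsto_divide[OF tendsto_power[OF this] tendsto_const]
    show "(?f n \<longlongrightarrow> 1 / real n ^ 2) (at_right 0)" for n
      by (cases "n = 0") (simp_all add: tendsto_divide_zero)
    show "\<forall>\<^sub>F (k, x) in sequentially \<times>\<^sub>F at_right 0. norm (?f k x) \<le> 1 / real k ^ 2"
      by (rule eventually_mono[OF eventually_prodI[OF eventually_True eventually_at_right_less[of "0::real"]]])
         (use le in auto)
  qed auto
  moreover have "(\<Sum>n. 1 / real n ^ 2) = pi\<^sup>2 / 6"
    using sums_Suc[OF zeta_2_sums] by (simp add: sums_iff)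
  ultimately show "((\<lambda>x. dilog (exp (-x))) \<longlongrightarrow> pi\<^sup>2 / 6) (at_right 0)"
    by (simp add: dilog_def)
  have "((\<lambda>x. \<Sum>n. ?f n x) \<longlongrightarrow> (\<Sum>n::nat. 0)) at_top"
  proof (rule conjunct2[OF conjunct2[OF tannerys_theorem[OF _ _ M]]])
    fix n :: nat
    show "(?f n \<longlongrightarrow> 0) at_top"
    proof (cases n)
      case (Suc m)
      have "((\<lambda>x::real. exp (-x)) \<longlongrightarrow> 0) at_top" by real_asymp
      from tendsto_power[OF this, of n] show ?thesis using Suc by (auto intro: tendsto_divide_zero)
    qed auto
    show "\<forall>\<^sub>F (k, x) in sequentially \<times>\<^sub>F at_top. norm (?f k x) \<le> 1 / real k ^ 2"
      by (rule eventually_mono[OF eventually_prodI[OF eventually_True eventually_gt_at_top[of "0::real"]]])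
         (use le in auto)
  qed auto
  then show "((\<lambda>x. dilog (exp (-x))) \<longlongrightarrow> 0) at_top"
    by (simp add: dilog_def)
qed

section \<open>The logarithm of the Euler product by trapezoidal summation\<close>

definition log_euler :: "real \<Rightarrow> real" where
  "log_euler t = (\<Sum>d. - ln (1 - exp (- (real (Suc d) * t))))"

text \<open>The sum of \<open>ln (1 + 1 / x\<^sup>2) / 2\<close> over \<open>x = t, 2 t, 3 t, \<dots>\<close> is known exactly from the product formula of the
  sine, and subtracting it removes the logarithmic singularity of \<open>- ln (1 - exp (-x))\<close> at \<open>0\<close>. What remains
  is summed by the trapezoidal rule, so that the constant in the asymptotics comes from the sine product.\<close>

definition log_remainder :: "real \<Rightarrow> real" where
  "log_remainder x = - ln (1 - exp (-x)) - ln (1 + 1 / x\<^sup>2) / 2"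

text \<open>An antiderivative of \<open>log_remainder\<close>. Its limits -pi^2/6 at 0 and -pi/2 at
  infinity supply the terms of order 1/t in the asymptotics.\<close>

definition log_remainder_prim :: "real \<Rightarrow> real" where
  "log_remainder_prim x = - dilog (exp (-x)) - (x / 2 * ln (1 + 1 / x\<^sup>2) + arctan x)"

definition log_remainder' :: "real \<Rightarrow> real" where
  "log_remainder' x = - exp (-x) / (1 - exp (-x)) + 1 / (x * (x\<^sup>2 + 1))"

definition log_remainder'' :: "real \<Rightarrow> real" where
  "log_remainder'' x = exp (-x) / (1 - exp (-x))\<^sup>2 - (3 * x\<^sup>2 + 1) / (x\<^sup>2 * (x\<^sup>2 + 1)\<^sup>2)"

lemma one_plus_inverse_square_pos: "1 + 1 / x\<^sup>2 > (0::real)"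
  by (simp add: add_pos_nonneg)

lemma ln_one_plus_inverse_square_deriv:
  assumes "x > 0"
  shows "((\<lambda>x::real. ln (1 + 1 / x\<^sup>2) / 2) has_real_derivative - (1 / (x * (x\<^sup>2 + 1)))) (at x)"
proof -
  have "x * x * x + x \<noteq> 0" "1 + x * x > 0"
    using assms by (auto simp: add_pos_nonneg add_pos_pos intro!: less_imp_neq[symmetric])
  then show ?thesis
    using assms one_plus_inverse_square_pos[of x]
    by (auto intro!: derivative_eq_intros simp: power2_eq_square) (simp add: field_simps)
qed

lemma log_remainder_prim_deriv:
  assumes "x > 0"
  shows "(log_remainder_prim has_real_derivative log_remainder x) (at x)"
proof -
  have d: "((\<lambda>x. dilog (exp (-x))) has_real_derivative ln (1 - exp (-x))) (at x)"
  proof -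
    have "((\<lambda>x. dilog (exp (-x))) has_real_derivative - ln (1 - exp (-x)) / exp (-x) * (- exp (-x))) (at x)"
    proof (rule DERIV_chain2[where f = dilog and g = "\<lambda>x. exp (-x)"])
      show "(dilog has_real_derivative - ln (1 - exp (-x)) / exp (-x)) (at (exp (-x)))"
        by (rule dilog_has_derivative) (use assms in auto)
    qed (auto intro!: derivative_eq_intros)
    then show ?thesis by simp
  qed
  have "((\<lambda>x. x * (ln (1 + 1 / x\<^sup>2) / 2) + arctan x) has_real_derivative
      (1 * (ln (1 + 1 / x\<^sup>2) / 2) + - (1 / (x * (x\<^sup>2 + 1))) * x) + inverse (1 + x\<^sup>2)) (at x)"
    by (intro DERIV_add DERIV_mult DERIV_ident ln_one_plus_inverse_square_deriv assms DERIV_arctan)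
  moreover have "(1 * (ln (1 + 1 / x\<^sup>2) / 2) + - (1 / (x * (x\<^sup>2 + 1))) * x) + inverse (1 + x\<^sup>2) = ln (1 + 1 / x\<^sup>2) / 2"
    using assms by (simp add: inverse_eq_divide add.commute)
  ultimately have "((\<lambda>x. x / 2 * ln (1 + 1 / x\<^sup>2) + arctan x) has_real_derivative ln (1 + 1 / x\<^sup>2) / 2) (at x)"
    by simp
  from DERIV_diff[OF DERIV_minus[OF d] this] show ?thesis
    by (simp add: log_remainder_prim_def[abs_def] log_remainder_def)
qed

lemma log_remainder_deriv:
  assumes "x > 0"
  shows "(log_remainder has_real_derivative log_remainder' x) (at x)"
proof -
  have "((\<lambda>x. - ln (1 - exp (-x))) has_real_derivative - exp (-x) / (1 - exp (-x))) (at x)"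
    using assms by (auto intro!: derivative_eq_intros)
  moreover note ln_one_plus_inverse_square_deriv[OF assms]
  ultimately show ?thesis
    unfolding log_remainder_def[abs_def] log_remainder'_def using DERIV_diff by fastforce
qed

lemma log_remainder'_deriv:
  assumes "x > 0"
  shows "(log_remainder' has_real_derivative log_remainder'' x) (at x)"
proof -
  have "((\<lambda>x. - exp (-x) / (1 - exp (-x))) has_real_derivative exp (-x) / (1 - exp (-x))\<^sup>2) (at x)"
    using assms by (auto intro!: derivative_eq_intros simp: power2_eq_square algebra_simps)
  moreover have "((\<lambda>x. 1 / (x * (x\<^sup>2 + 1))) has_real_derivative (- 1 - 3 * x\<^sup>2) / (x\<^sup>2 * (x\<^sup>2 + 1)\<^sup>2)) (at x)"
  proof -
    have "x\<^sup>2 + 1 > 0" by (simp add: add_nonneg_pos)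
    then have "x * (x\<^sup>2 + 1) \<noteq> 0" using assms by auto
    then show ?thesis
      by (auto intro!: derivative_eq_intros simp: power2_eq_square algebra_simps)
  qed
  moreover have "(- 1 - 3 * x\<^sup>2) / (x\<^sup>2 * (x\<^sup>2 + 1)\<^sup>2) = - ((3 * x\<^sup>2 + 1) / (x\<^sup>2 * (x\<^sup>2 + 1)\<^sup>2))"
    unfolding minus_divide_left by simp
  ultimately show ?thesis
    unfolding log_remainder'_def[abs_def] log_remainder''_def using DERIV_add by fastforce
qed

text \<open>The poles 1/x^2 of the two parts cancel; subtracting 1/x^2 from each leaves quantities
  bounded by both 1 and 1/x^2. With the interpolated exponent 3/2 the trapezoidal errors add up to
  order t^(3 - 3/2), and division by \<open>t\<close> leaves t^(1/2).\<close>

lemma log_remainder''_bound: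
  assumes "x > 0"
  shows "\<bar>log_remainder'' x\<bar> \<le> 2 * x powr (-(3/2))"
proof -
  define A where "A = 1 / x\<^sup>2 - exp (-x) / (1 - exp (-x))\<^sup>2"
  define B where "B = (x\<^sup>2 - 1) / (x\<^sup>2 + 1)\<^sup>2"
  have p: "x\<^sup>2 + 1 > 0" by (simp add: add_nonneg_pos)
  have "1 / x\<^sup>2 - (3 * x\<^sup>2 + 1) / (x\<^sup>2 * (x\<^sup>2 + 1)\<^sup>2) = B"
    unfolding B_def using assms p by (simp add: divide_simps) (simp add: algebra_simps power2_eq_square)
  then have eq: "log_remainder'' x = B - A" by (simp add: log_remainder''_def A_def)
  have A0: "0 \<le> A" using exp_over_square_bounds(1)[OF assms] by (simp add: A_def)
  have "A \<le> x powr (-(3/2))"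
    using exp_over_square_bounds[OF assms] assms unfolding A_def
    by (intro min_one_inverse_square_le_powr) auto
  have "\<bar>B\<bar> = \<bar>x\<^sup>2 - 1\<bar> / (x\<^sup>2 + 1)\<^sup>2" by (simp add: B_def)
  also have "\<dots> \<le> (x\<^sup>2 + 1) / (x\<^sup>2 + 1)\<^sup>2"
    by (intro divide_right_mono) (auto simp: abs_le_iff)
  also have "\<dots> = 1 / (x\<^sup>2 + 1)" using p by (simp add: power2_eq_square)
  finally have B: "\<bar>B\<bar> \<le> 1 / (x\<^sup>2 + 1)" .
  have "1 / (x\<^sup>2 + 1) \<le> 1" "1 / (x\<^sup>2 + 1) \<le> 1 / x\<^sup>2"
    using assms p by (auto simp: divide_simps)
  then have "\<bar>B\<bar> \<le> x powr (-(3/2))"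
    using B assms by (intro min_one_inverse_square_le_powr) auto
  with A0 \<open>A \<le> x powr (-(3/2))\<close> eq show ?thesis by linarith
qed

lemma log_remainder_tendsto_0: "(log_remainder \<longlongrightarrow> 0) (at_right 0)"
  unfolding log_remainder_def by real_asymp

lemma log_remainder_prim_tendsto_at_0: "(log_remainder_prim \<longlongrightarrow> - (pi\<^sup>2 / 6)) (at_right 0)"
proof -
  have "((\<lambda>x::real. x / 2 * ln (1 + 1 / x\<^sup>2) + arctan x) \<longlongrightarrow> 0) (at_right 0)" by real_asymp
  from tendsto_diff[OF tendsto_minus[OF dilog_exp_tendsto(1)] this] show ?thesis
    by (simp add: log_remainder_prim_def[abs_def])
qed

lemma log_remainder_prim_tendsto_at_top: "(log_remainder_prim \<longlongrightarrow> - (pi / 2)) at_top"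
proof -
  have "((\<lambda>x::real. x / 2 * ln (1 + 1 / x\<^sup>2) + arctan x) \<longlongrightarrow> pi / 2) at_top" by real_asymp
  from tendsto_diff[OF tendsto_minus[OF dilog_exp_tendsto(2)] this] show ?thesis
    by (simp add: log_remainder_prim_def[abs_def])
qed

text \<open>The grid starts at \<open>t\<close> and not at 0; this shows that the missing interval
  contributes nothing in the limit.\<close>

lemma log_remainder_prim_quotient_tendsto: "((\<lambda>t. (log_remainder_prim t + pi\<^sup>2 / 6) / t) \<longlongrightarrow> 0) (at_right 0)"
proof (rule lhopital_right_0[where f' = log_remainder and g' = "\<lambda>_. 1"])
  show "((\<lambda>t. log_remainder_prim t + pi\<^sup>2 / 6) \<longlongrightarrow> 0) (at_right 0)"
    using tendsto_add[OF log_remainder_prim_tendsto_at_0 tendsto_const[of "pi\<^sup>2 / 6"]] by simp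
  show "\<forall>\<^sub>F x in at_right 0. ((\<lambda>t. log_remainder_prim t + pi\<^sup>2 / 6) has_real_derivative log_remainder x) (at x)"
    using eventually_at_right_less[of "0::real"]
    by eventually_elim (auto intro!: derivative_eq_intros log_remainder_prim_deriv)
  show "\<forall>\<^sub>F x in at_right 0. x \<noteq> (0::real)"
    using eventually_at_right_less[of "0::real"] by eventually_elim auto
qed (use log_remainder_tendsto_0 in \<open>auto simp: tendsto_ident_at\<close>)

text \<open>The sine product at the imaginary point \<open>\<i> * a\<close>, to be used with
  \<open>a = 1 / t\<close>.\<close>

lemma sinh_product_sums:
  fixes a :: real
  assumes "a > 0"
  shows "(\<lambda>d. ln (1 + a\<^sup>2 / real (Suc d) ^ 2)) sums ln (sinh (pi * a) / (pi * a))"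
proof -
  let ?P = "\<lambda>n. \<Prod>k=1..n. 1 + a\<^sup>2 / real k ^ 2"
  have pos: "0 < ?P n" for n by (intro prod_pos) (auto intro!: add_pos_nonneg)
  have "(\<lambda>n. of_real pi * (\<i> * of_real a) * (\<Prod>k=1..n. 1 - (\<i> * of_real a)^2 / of_nat k^2)) \<longlonglongrightarrow> sin (of_real pi * (\<i> * of_real a))"
    by (rule sin_product_formula_complex)
  also have "(\<lambda>n. of_real pi * (\<i> * of_real a) * (\<Prod>k=1..n. 1 - (\<i> * of_real a)^2 / of_nat k^2)) =
     (\<lambda>n. \<i> * of_real (pi * a * ?P n))"
    by (simp add: power_mult_distrib fun_eq_iff)
  also have "sin (of_real pi * (\<i> * of_real a)) = \<i> * of_real (sinh (pi * a))"
  proof -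
    have "sin (of_real pi * (\<i> * of_real a)) = sin (\<i> * complex_of_real (pi * a))" by (simp add: mult_ac)
    also have "\<dots> = \<i> * of_real (sinh (pi * a))"
      unfolding sin_i_times by (simp add: sinh_field_def exp_minus exp_of_real del: of_real_mult)
    finally show ?thesis .
  qed
  finally have "(\<lambda>n. -\<i> * (\<i> * of_real (pi * a * ?P n))) \<longlonglongrightarrow> -\<i> * (\<i> * of_real (sinh (pi * a)))"
    by (rule tendsto_mult[OF tendsto_const])
  then have "(\<lambda>n. complex_of_real (pi * a * ?P n)) \<longlonglongrightarrow> of_real (sinh (pi * a))"
    by (simp add: mult.assoc[symmetric])
  then have "(\<lambda>n. pi * a * ?P n) \<longlonglongrightarrow> sinh (pi * a)" by (simp only: tendsto_of_real_iff)
  from tendsto_divide[OF this tendsto_const[of "pi * a"]] assms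
  have "?P \<longlonglongrightarrow> sinh (pi * a) / (pi * a)" by simp
  then have "(\<lambda>n. ln (?P n)) \<longlonglongrightarrow> ln (sinh (pi * a) / (pi * a))"
    by (rule tendsto_ln) (use assms in auto)
  moreover have "ln (?P n) = (\<Sum>d<n. ln (1 + a\<^sup>2 / real (Suc d) ^ 2))" for n
  proof (induction n)
    case (Suc n)
    have "ln (?P (Suc n)) = ln (?P n * (1 + a\<^sup>2 / real (Suc n) ^ 2))" by simp
    also have "\<dots> = ln (?P n) + ln (1 + a\<^sup>2 / real (Suc n) ^ 2)"
      by (rule ln_mult_pos) (use pos[of n] in \<open>auto intro!: add_pos_nonneg\<close>)
    finally show ?case using Suc by simp
  qed auto
  ultimately show ?thesis by (simp only: sums_def)
qed

lemma summable_log_euler: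
  assumes "t > 0"
  shows "summable (\<lambda>d. - ln (1 - exp (- (real (Suc d) * t))))"
proof (rule summable_comparison_test')
  show "summable (\<lambda>d. exp (-t) ^ Suc d / (1 - exp (-t)))"
    using assms by (intro summable_divide) (subst summable_Suc_iff, simp add: summable_geometric)
next
  fix d :: nat
  define y where "y = exp (- (real (Suc d) * t))"
  have y: "0 < y" "y \<le> exp (-t)" "y < 1" using assms by (auto simp: y_def mult_le_cancel_right1)
  have "ln (1 / (1 - y)) \<le> 1 / (1 - y) - 1" using y by (intro ln_le_minus_one) auto
  also have "\<dots> = y / (1 - y)" using y by (simp add: field_simps)
  also have "\<dots> \<le> y / (1 - exp (-t))" using y assms by (intro divide_left_mono mult_pos_pos) auto
  finally have "- ln (1 - y) \<le> y / (1 - exp (-t))" using y by (simp add: ln_div)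
  moreover have eq: "exp (-t) ^ Suc d = y" by (subst exp_of_nat_mult[symmetric]) (simp add: y_def)
  moreover have "ln (1 - y) \<le> 0" using y by simp
  ultimately show "norm (- ln (1 - exp (- (real (Suc d) * t)))) \<le> exp (-t) ^ Suc d / (1 - exp (-t))"
    unfolding eq y_def[symmetric] by (simp del: power_Suc)
qed

text \<open>So the partition generating function at exp(-t) is asymptotic to sqrt(t/(2 pi))
  exp(pi^2/(6 t)). The exponential comes from the primitive at 0, the square root from the sine
  product.\<close>

lemma log_euler_asymptotics:
  "((\<lambda>t. log_euler t - pi\<^sup>2 / (6 * t) - ln (t / (2 * pi)) / 2) \<longlongrightarrow> 0) (at_right 0)"
proof -
  define Z where "Z = (\<Sum>d. real (Suc d) powr (-(3/2)))"
  have zs: "summable (\<lambda>d. real (Suc d) powr (-(3/2)))"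
    by (subst summable_Suc_iff) (simp add: summable_real_powr_iff)
  \<comment> \<open>The trapezoidal error divided by \<open>t\<close>: the grid sum with its first
    value halved, minus the integral from \<open>t\<close> to infinity over
    \<open>t\<close>.\<close>
  define R where "R = (\<lambda>t. (log_euler t - ln (sinh (pi * (1 / t)) / (pi * (1 / t))) / 2)
     - (- (pi / 2) - log_remainder_prim t) / t - log_remainder t / 2)"
  have main: "\<bar>R t\<bar> \<le> 2 * Z * t powr (1/2)" if t: "t > 0" for t
  proof -
    have "(\<lambda>d. - ln (1 - exp (- (real (Suc d) * t))) - ln (1 + (1 / t)\<^sup>2 / real (Suc d) ^ 2) / 2) sums
       (log_euler t - ln (sinh (pi * (1 / t)) / (pi * (1 / t))) / 2)"
      unfolding log_euler_def
      by (intro sums_diff sums_divide sinh_product_sums summable_sums summable_log_euler) (use t in auto)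
    also have "(\<lambda>d. - ln (1 - exp (- (real (Suc d) * t))) - ln (1 + (1 / t)\<^sup>2 / real (Suc d) ^ 2) / 2) =
       (\<lambda>d. log_remainder (real (Suc d) * t))"
      by (simp add: log_remainder_def fun_eq_iff power_mult_distrib power_divide mult.commute del: of_nat_Suc)
    finally have S: "(\<lambda>d. log_remainder (real (Suc d) * t)) sums (log_euler t - ln (sinh (pi * (1 / t)) / (pi * (1 / t))) / 2)" .
    then have S2: "(\<lambda>d. log_remainder (real (Suc (Suc d)) * t)) sums
       (log_euler t - ln (sinh (pi * (1 / t)) / (pi * (1 / t))) / 2 - log_remainder t)"
      by (subst sums_Suc_iff) simp
    have "(\<lambda>n. log_remainder_prim (real (Suc n) * t)) \<longlonglongrightarrow> - (pi / 2)"
    proof (rule filterlim_compose[OF log_remainder_prim_tendsto_at_top])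
      show "filterlim (\<lambda>n. real (Suc n) * t) at_top sequentially"
        using t by real_asymp
    qed
    from telescope_sums[OF this]
    have T: "(\<lambda>n. log_remainder_prim (real (Suc (Suc n)) * t) - log_remainder_prim (real (Suc n) * t)) sums (- (pi / 2) - log_remainder_prim t)"
      by simp
    have "(\<lambda>n. t * (log_remainder (real (Suc n) * t) + log_remainder (real (Suc (Suc n)) * t)) / 2 -
        (log_remainder_prim (real (Suc (Suc n)) * t) - log_remainder_prim (real (Suc n) * t))) sums
       (t * ((log_euler t - ln (sinh (pi * (1 / t)) / (pi * (1 / t))) / 2) +
         (log_euler t - ln (sinh (pi * (1 / t)) / (pi * (1 / t))) / 2 - log_remainder t)) / 2 - (- (pi / 2) - log_remainder_prim t))"
      (is "?E sums ?s")
      by (intro sums_diff[OF _ T] sums_divide sums_mult sums_add S S2)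
    moreover have "?s = t * R t" using t by (simp add: R_def field_simps)
    ultimately have E: "?E sums (t * R t)" by simp
    have bd: "norm (?E n) \<le> 2 * t powr (3/2) * real (Suc n) powr (-(3/2))" for n
    proof -
      define a where "a = real (Suc n) * t"
      have a: "a > 0" using t by (simp add: a_def)
      have at: "real (Suc (Suc n)) * t = a + t" by (simp add: a_def algebra_simps)
      have "\<bar>t * (log_remainder a + log_remainder (a + t)) / 2 - (log_remainder_prim (a + t) - log_remainder_prim a)\<bar> \<le> t ^ 3 * (2 * a powr (-(3/2)))"
      proof (rule trapezoid_error[where k' = log_remainder' and k'' = log_remainder''])
        fix x assume x: "a \<le> x" "x \<le> a + t"
        have "\<bar>log_remainder'' x\<bar> \<le> 2 * x powr (-(3/2))" using x a by (intro log_remainder''_bound) auto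
        also have "\<dots> \<le> 2 * a powr (-(3/2))" using x a by (intro mult_left_mono powr_mono2') auto
        finally show "\<bar>log_remainder'' x\<bar> \<le> 2 * a powr (-(3/2))" .
      qed (use t a in \<open>auto intro: log_remainder_prim_deriv log_remainder_deriv log_remainder'_deriv\<close>)
      also have "\<dots> = 2 * t powr (3/2) * real (Suc n) powr (-(3/2))"
      proof -
        have "t ^ 3 * a powr (-(3/2)) = t powr 3 * t powr (-(3/2)) * real (Suc n) powr (-(3/2))"
          using t by (simp add: a_def powr_mult powr_numeral del: of_nat_Suc)
        also have "t powr 3 * t powr (-(3/2)) = t powr (3/2)" by (simp add: powr_add[symmetric])
        finally show ?thesis by simp
      qed
      finally show ?thesis unfolding at a_def[symmetric] by simp
    qed
    have "norm (suminf ?E) \<le> (\<Sum>n. 2 * t powr (3/2) * real (Suc n) powr (-(3/2)))"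
      by (rule norm_suminf_le[OF bd summable_mult[OF zs]])
    also have "\<dots> = 2 * t powr (3/2) * Z" unfolding Z_def by (rule suminf_mult[OF zs])
    finally have "t * \<bar>R t\<bar> \<le> 2 * t powr (3/2) * Z" using E t by (simp add: sums_iff abs_mult)
    also have "t powr (3/2) = t * t powr (1/2)"
      using t powr_add[of t 1 "1/2"] by simp
    finally have "t * \<bar>R t\<bar> \<le> t * (2 * Z * t powr (1/2))" by (simp only: mult_ac)
    then show ?thesis using t by (simp only: mult_le_cancel_left_pos)
  qed
  have R: "(R \<longlongrightarrow> 0) (at_right 0)"
  proof (rule Lim_null_comparison)
    show "\<forall>\<^sub>F t in at_right 0. norm (R t) \<le> 2 * Z * t powr (1/2)"
      using eventually_at_right_less[of "0::real"] by eventually_elim (use main in auto)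
    have "((\<lambda>t::real. t powr (1/2)) \<longlongrightarrow> 0) (at_right 0)" by real_asymp
    from tendsto_mult_right_zero[OF this, of "2 * Z"]
    show "((\<lambda>t. 2 * Z * t powr (1/2)) \<longlongrightarrow> 0) (at_right 0)" .
  qed
  \<comment> \<open>The growth \<open>pi / (2 * t)\<close> of the sine product is cancelled by the
    value \<open>- (pi / 2)\<close> of the primitive at infinity.\<close>
  have "((\<lambda>t::real. ln (sinh (pi * (1 / t)) / (pi * (1 / t))) / 2 - pi / (2 * t) - ln (t / (2 * pi)) / 2) \<longlongrightarrow> 0) (at_right 0)"
    by real_asymp
  from tendsto_add[OF tendsto_diff[OF tendsto_add[OF this R] log_remainder_prim_quotient_tendsto] tendsto_divide[OF log_remainder_tendsto_0 tendsto_const[of 2]]]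
  have "((\<lambda>t. ln (sinh (pi * (1 / t)) / (pi * (1 / t))) / 2 - pi / (2 * t) - ln (t / (2 * pi)) / 2 + R t
      - (log_remainder_prim t + pi\<^sup>2 / 6) / t + log_remainder t / 2) \<longlongrightarrow> 0) (at_right 0)" by simp
  then show ?thesis
  proof (rule Lim_transform_eventually)
    show "\<forall>\<^sub>F t in at_right 0. ln (sinh (pi * (1 / t)) / (pi * (1 / t))) / 2 - pi / (2 * t) - ln (t / (2 * pi)) / 2 + R t
      - (log_remainder_prim t + pi\<^sup>2 / 6) / t + log_remainder t / 2 = log_euler t - pi\<^sup>2 / (6 * t) - ln (t / (2 * pi)) / 2"
      using eventually_at_right_less[of "0::real"]
    proof eventually_elim
      case (elim t)
      then show ?case unfolding R_def
        by (simp only: diff_divide_distrib add_divide_distrib minus_divide_left divide_divide_eq_left)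
    qed
  qed
qed

section \<open>The generating function of pairs of partitions\<close>

definition cfps :: "(nat \<Rightarrow> real) \<Rightarrow> complex fps" where
  "cfps f = Abs_fps (\<lambda>n. complex_of_real (f n))"

definition exp_summable :: "(nat \<Rightarrow> real) \<Rightarrow> bool" where
  "exp_summable f \<longleftrightarrow> (\<forall>t>0. summable (\<lambda>i. f i * exp (- (real i * t))))"

definition exp_sum :: "(nat \<Rightarrow> real) \<Rightarrow> real \<Rightarrow> real" where
  "exp_sum f t = (\<Sum>i. f i * exp (- (real i * t)))"

lemma cfps_nth [simp]: "fps_nth (cfps f) n = of_real (f n)"
  by (simp add: cfps_def)

lemma conv_radius_cfps:
  assumes "exp_summable f"
  shows "fps_conv_radius (cfps f) \<ge> 1"
  unfolding fps_conv_radius_def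
proof (rule conv_radius_geI_ex')
  fix r :: real assume r: "0 < r" "ereal r < 1"
  define t where "t = - ln r"
  have t: "t > 0" "r = exp (-t)" using r by (auto simp: t_def)
  have "exp (- (real n * t)) = r ^ n" for n
    unfolding t(2) by (simp add: exp_of_nat_mult[symmetric])
  then have "summable (\<lambda>n. f n * r ^ n)"
    using assms t(1) by (auto simp: exp_summable_def)
  then have "summable (\<lambda>n. complex_of_real (f n * r ^ n))" by (rule summable_of_real)
  then show "summable (\<lambda>n. fps_nth (cfps f) n * of_real r ^ n)"
    by simp
qed

lemma less_conv_radius_cfps:
  assumes "exp_summable f" "norm z < 1"
  shows "ereal (norm z) < fps_conv_radius (cfps f)"
  by (rule order_less_le_trans[OF _ conv_radius_cfps[OF assms(1)]]) (use assms(2) in \<open>simp add: one_ereal_def\<close>)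

lemma eval_cfps_exp:
  assumes "exp_summable f" "t > 0"
  shows "eval_fps (cfps f) (of_real (exp (-t))) = of_real (exp_sum f t)"
proof -
  have eq: "of_real (f n) * complex_of_real (exp (-t)) ^ n = of_real (f n * exp (- (real n * t)))" for n
    by (simp add: exp_of_nat_mult[symmetric] of_real_power[symmetric] del: of_real_power)
  show ?thesis
    unfolding eval_fps_def cfps_nth eq exp_sum_def
    by (rule suminf_of_real[symmetric]) (use assms in \<open>auto simp: exp_summable_def\<close>)
qed

definition log_gf_coeff :: "nat \<Rightarrow> real" where
  "log_gf_coeff i = 2 * divisor_sum 1 i / real i"

lemma log_gf_coeff_0 [simp]: "log_gf_coeff 0 = 0"
  by (simp add: log_gf_coeff_def)

lemma divisor_sum_ge: "i > 0 \<Longrightarrow> real i \<le> divisor_sum 1 i"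
proof -
  assume i: "i > 0"
  have "(\<Sum>m\<in>{i}. real m ^ 1) \<le> divisor_sum 1 i"
    unfolding divisor_sum_def by (rule sum_mono2) (use i in auto)
  then show ?thesis by simp
qed

lemma log_gf_coeff_ge: "i > 0 \<Longrightarrow> 2 \<le> log_gf_coeff i"
  using divisor_sum_ge[of i] by (simp add: log_gf_coeff_def field_simps)

lemma divisor_sum_nonneg: "0 \<le> divisor_sum l i"
  by (auto simp: divisor_sum_def intro: sum_nonneg)

lemma sum_inverse_divisors:
  assumes "N > 0"
  shows "(\<Sum>m | m dvd N. 1 / real m) = (\<Sum>m | m dvd N. real m / real N)"
  by (rule sum.reindex_bij_witness[where i = "\<lambda>m. N div m" and j = "\<lambda>m. N div m"])
     (use assms in \<open>auto elim!: dvdE\<close>)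

text \<open>Each logarithm is expanded and the double series regrouped by the product of the
  indices; replacing a divisor \<open>m\<close> of \<open>N\<close> by \<open>N div m\<close> turns
  the sum of the 1/m into sigma(N)/N.\<close>

lemma log_gf_sums:
  assumes "t > 0"
  shows "(\<lambda>i. log_gf_coeff i * exp (- (real i * t))) sums (2 * log_euler t)"
proof -
  let ?G = "\<lambda>m d. 1 / real m * exp (- (real (m * d) * t))"
  have "(\<lambda>i. \<Sum>m | m dvd Suc i. ?G m (Suc i div m)) sums log_euler t"
  proof (rule lambert_rearrangement)
    fix d
    define y where "y = exp (- (real (Suc d) * t))"
    have y: "0 < y" "y < 1" using assms by (auto simp: y_def)
    have "(\<lambda>n. y ^ n / real n) sums - ln (1 - y)"
      using sums_minus[OF ln_series'[of "-y"]] y by simp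
    then have "(\<lambda>n. y ^ Suc n / real (Suc n)) sums - ln (1 - y)"
      by (subst sums_Suc_iff) simp
    moreover have "y ^ Suc n / real (Suc n) = ?G (Suc n) (Suc d)" for n
      unfolding y_def exp_of_nat_mult[symmetric] by (simp add: algebra_simps)
    ultimately show "(\<lambda>m. ?G (Suc m) (Suc d)) sums (- ln (1 - exp (- (real (Suc d) * t))))"
      unfolding y_def by (simp only:)
  next
    show "(\<lambda>d. - ln (1 - exp (- (real (Suc d) * t)))) sums log_euler t"
      unfolding log_euler_def by (rule summable_sums[OF summable_log_euler[OF assms]])
  qed auto
  from sums_mult[OF this, of 2]
  have "(\<lambda>i. 2 * (\<Sum>m | m dvd Suc i. ?G m (Suc i div m))) sums (2 * log_euler t)" .
  also have "(\<lambda>i. 2 * (\<Sum>m | m dvd Suc i. ?G m (Suc i div m))) =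
     (\<lambda>i. log_gf_coeff (Suc i) * exp (- (real (Suc i) * t)))"
  proof
    fix i
    have "(\<Sum>m | m dvd Suc i. ?G m (Suc i div m)) = (\<Sum>m | m dvd Suc i. 1 / real m * exp (- (real (Suc i) * t)))"
      by (intro sum.cong) auto
    also have "\<dots> = (\<Sum>m | m dvd Suc i. 1 / real m) * exp (- (real (Suc i) * t))"
      by (simp add: sum_distrib_right)
    also have "(\<Sum>m | m dvd Suc i. 1 / real m) = (\<Sum>m | m dvd Suc i. real m / real (Suc i))"
      by (rule sum_inverse_divisors) simp
    also have "\<dots> = divisor_sum 1 (Suc i) / real (Suc i)"
      by (simp add: divisor_sum_def sum_divide_distrib)
    finally show "2 * (\<Sum>m | m dvd Suc i. ?G m (Suc i div m)) = log_gf_coeff (Suc i) * exp (- (real (Suc i) * t))"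
      by (simp add: log_gf_coeff_def)
  qed
  finally show ?thesis by (subst (asm) sums_Suc_iff) simp
qed

lemma exp_summable_log_gf: "exp_summable log_gf_coeff"
  using log_gf_sums by (auto simp: exp_summable_def sums_iff)

lemma exp_sum_log_gf: "t > 0 \<Longrightarrow> exp_sum log_gf_coeff t = 2 * log_euler t"
  using log_gf_sums by (auto simp: exp_sum_def sums_iff)

definition pair_gf_log :: "complex \<Rightarrow> complex" where
  "pair_gf_log z = eval_fps (cfps log_gf_coeff) z"

lemma pair_moment_0_0: "pair_moment 0 0 = 1"
proof -
  have "L = {#}" if "0 \<notin># L" "sum_mset L = 0" for L :: "nat multiset"
    using that by (cases L) auto
  then have "partition_pairs 0 = {({#}, {#})}"
    by (auto simp: partition_pairs_def simp del: sum_mset_0_iff)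
  then show ?thesis by (simp add: pair_moment_def)
qed

text \<open>The power series of the exponential satisfies P' = L' P with P(0) = 1, which is
  \<open>pair_moment_0_recurrence\<close> read in coefficients. Summability of
  \<open>pair_moment 0\<close> thus follows from holomorphy of the exponential on the unit
  disc.\<close>

lemma pair_gf:
  shows exp_summable_pair_moment_0: "exp_summable (pair_moment 0)"
    and eval_pair_gf: "norm z < 1 \<Longrightarrow> eval_fps (cfps (pair_moment 0)) z = exp (pair_gf_log z)"
proof -
  let ?L = "cfps log_gf_coeff"
  let ?F = "\<lambda>z. exp (pair_gf_log z)"
  define P where "P = fps_expansion ?F 0"
  have holo_L: "pair_gf_log holomorphic_on ball 0 1"
    unfolding pair_gf_log_def[abs_def]
    by (rule holomorphic_on_eval_fps) (use less_conv_radius_cfps[OF exp_summable_log_gf] in auto)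
  then have holo: "?F holomorphic_on ball 0 1" by (intro holomorphic_intros)
  have exp: "?F has_fps_expansion P"
    unfolding P_def by (rule has_fps_expansion_fps_expansion[OF _ _ holo]) auto
  have rad_P: "fps_conv_radius P \<ge> 1"
    unfolding P_def using holo by (intro conv_radius_fps_expansion) (auto simp: one_ereal_def)
  have eval_P: "eval_fps P z = ?F z" if "norm z < 1" for z
    unfolding P_def using eval_fps_expansion'[of ?F 0 1 z] holo that by (auto simp: one_ereal_def)
  have L_exp: "eval_fps (fps_deriv ?L) has_fps_expansion fps_deriv ?L"
  proof (rule eval_fps_has_fps_expansion)
    have "1 \<le> fps_conv_radius (fps_deriv ?L)"
      using conv_radius_cfps[OF exp_summable_log_gf] fps_conv_radius_deriv[of ?L] by (rule order_trans)
    then show "0 < fps_conv_radius (fps_deriv ?L)" by (rule order_less_le_trans[rotated]) simp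
  qed
  have "deriv ?F has_fps_expansion fps_deriv P"
    by (rule has_fps_expansion_deriv[OF exp])
  also have "?this \<longleftrightarrow> (\<lambda>z. ?F z * eval_fps (fps_deriv ?L) z) has_fps_expansion fps_deriv P"
  proof (rule has_fps_expansion_cong)
    have "\<forall>\<^sub>F z in nhds 0. z \<in> ball (0::complex) 1" by (intro eventually_nhds_in_open) auto
    then show "\<forall>\<^sub>F z in nhds 0. deriv ?F z = ?F z * eval_fps (fps_deriv ?L) z"
    proof eventually_elim
      case (elim z)
      have "(pair_gf_log has_field_derivative eval_fps (fps_deriv ?L) z) (at z)"
        unfolding pair_gf_log_def[abs_def]
        by (rule has_field_derivative_eval_fps) (use elim less_conv_radius_cfps[OF exp_summable_log_gf] in auto)
      then have "(?F has_field_derivative ?F z * eval_fps (fps_deriv ?L) z) (at z)"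
        by (rule DERIV_fun_exp)
      then show ?case by (rule DERIV_imp_deriv)
    qed
  qed auto
  finally have "(\<lambda>z. ?F z * eval_fps (fps_deriv ?L) z) has_fps_expansion fps_deriv P" .
  moreover have "(\<lambda>z. ?F z * eval_fps (fps_deriv ?L) z) has_fps_expansion P * fps_deriv ?L"
    by (intro has_fps_expansion_mult exp L_exp)
  ultimately have "fps_deriv P = P * fps_deriv ?L" by (rule fps_expansion_unique_complex)
  then have ode: "fps_deriv P = fps_deriv ?L * P" by (subst mult.commute)
  have P0: "fps_nth P 0 = 1"
    using eval_P[of 0] by (simp add: eval_fps_at_0 pair_gf_log_def)
  have coeff: "fps_nth P n = of_real (pair_moment 0 n)" for n
  proof (induction n rule: less_induct)
    case (less n)
    show ?case
    proof (cases n)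
      case 0
      then show ?thesis using P0 by (simp add: pair_moment_0_0)
    next
      case (Suc m)
      have "of_nat n * fps_nth P n = fps_nth (fps_deriv P) m" using Suc by simp
      also have "\<dots> = (\<Sum>i=0..m. fps_nth P (m - i) * (of_nat (Suc i) * of_real (log_gf_coeff (Suc i))))"
        unfolding ode fps_mult_nth by (rule sum.cong) (simp_all add: mult_ac)
      also have "\<dots> = (\<Sum>i=0..m. of_real (2 * divisor_sum 1 (Suc i) * pair_moment 0 (n - Suc i)))"
        using less Suc by (intro sum.cong) (auto simp: log_gf_coeff_def simp del: of_nat_Suc)
      also have "\<dots> = of_real (\<Sum>i=1..n. 2 * divisor_sum 1 i * pair_moment 0 (n - i))"
        unfolding Suc of_real_sum by (simp only: sum.shift_bounds_cl_Suc_ivl One_nat_def)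
      also have "\<dots> = of_real (real n * pair_moment 0 n)" by (simp only: pair_moment_0_recurrence)
      finally have "of_nat n * fps_nth P n = of_nat n * of_real (pair_moment 0 n)" by simp
      then show ?thesis using Suc by (simp del: of_nat_Suc)
    qed
  qed
  have P: "P = cfps (pair_moment 0)" by (rule fps_ext) (simp add: coeff)
  show "exp_summable (pair_moment 0)" unfolding exp_summable_def
  proof (intro allI impI)
    fix t :: real assume t: "t > 0"
    have "summable (\<lambda>n. fps_nth P n * of_real (exp (-t)) ^ n)"
      by (rule summable_fps, rule order_less_le_trans[OF _ rad_P]) (use t in \<open>simp add: one_ereal_def\<close>)
    also have "(\<lambda>n. fps_nth P n * of_real (exp (-t)) ^ n) = (\<lambda>n. complex_of_real (pair_moment 0 n * exp (- (real n * t))))"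
      by (auto simp: coeff exp_of_nat_mult[symmetric] of_real_power[symmetric] simp del: of_real_power)
    finally show "summable (\<lambda>n. pair_moment 0 n * exp (- (real n * t)))"
      by (simp only: summable_of_real_iff)
  qed
  show "eval_fps (cfps (pair_moment 0)) z = exp (pair_gf_log z)" if "norm z < 1"
    using eval_P[OF that] P by simp
qed

section \<open>Extraction of coefficients by integration over a circle\<close>

lemma integral_exp_int:
  fixes k :: int
  shows "(\<integral>x. indicator {-pi..pi} x *\<^sub>R exp (\<i> * of_real (of_int k * x)) \<partial>lborel) = (if k = 0 then 2 * of_real pi else 0)"
    and "integrable lborel (\<lambda>x. indicator {-pi..pi} x *\<^sub>R exp (\<i> * of_real (of_int k * x)))"
proof -
  show "integrable lborel (\<lambda>x. indicator {-pi..pi} x *\<^sub>R exp (\<i> * of_real (of_int k * x)))"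
    by (rule borel_integrable_compact) (auto intro!: continuous_intros)
  show "(\<integral>x. indicator {-pi..pi} x *\<^sub>R exp (\<i> * of_real (of_int k * x)) \<partial>lborel) = (if k = 0 then 2 * of_real pi else 0)"
  proof (cases "k = 0")
    case True
    then show ?thesis by (simp add: scaleR_conv_of_real)
  next
    case False
    define c :: complex where "c = \<i> * of_int k"
    have c: "c \<noteq> 0" using False by (simp add: c_def)
    have eq: "\<i> * of_real (of_int k * x) = c * of_real x" for x by (simp add: c_def)
    have "(\<integral>x. indicator {-pi..pi} x *\<^sub>R exp (c * of_real x) \<partial>lborel) =
        exp (c * of_real pi) / c - exp (c * of_real (-pi)) / c"
    proof (rule integral_FTC_Icc)
      fix x :: real
      have "((\<lambda>z. exp (c * z) / c) has_field_derivative exp (c * of_real x)) (at (of_real x))"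
        using c by (auto intro!: derivative_eq_intros)
      from field_vector_diff_chain_at[OF has_vector_derivative_of_real[OF DERIV_ident] this]
      have "((\<lambda>x. exp (c * of_real x) / c) has_vector_derivative exp (c * of_real x)) (at x)"
        by (simp add: o_def)
      then show "((\<lambda>x. exp (c * of_real x) / c) has_vector_derivative exp (c * of_real x)) (at x within {- pi..pi})"
        by (rule has_vector_derivative_at_within)
    qed (auto intro!: continuous_intros)
    also have "exp (c * of_real pi) = exp (c * of_real (-pi))"
      unfolding exp_eq by (rule exI[of _ k]) (simp add: c_def algebra_simps)
    finally have "(\<integral>x. indicator {-pi..pi} x *\<^sub>R exp (c * of_real x) \<partial>lborel) = 0" by simp
    then show ?thesis using False by (simp only: eq if_False)
  qed
qed

lemma coeff_integral:
  fixes f :: "complex fps" and r :: real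
  assumes "r > 0" "ereal r < fps_conv_radius f"
  shows "(\<integral>x. indicator {-pi..pi} x *\<^sub>R (eval_fps f (of_real r * exp (\<i> * of_real x)) * exp (- (\<i> * of_real (real n * x)))) \<partial>lborel)
     = 2 * of_real pi * fps_nth f n * of_real r ^ n"
proof -
  let ?g = "\<lambda>m x. indicator {-pi..pi} x *\<^sub>R (exp (\<i> * of_real (of_int (int m - int n) * x)) :: complex)"
  let ?h = "\<lambda>m x. fps_nth f m * of_real r ^ m * ?g m x"
  have ss: "summable (\<lambda>m. norm (fps_nth f m) * r ^ m)"
    using norm_summable_fps[of "of_real r" f] assms by (simp add: norm_mult norm_power)
  have "(\<lambda>m. integral\<^sup>L lborel (?h m)) sums (\<integral>x. (\<Sum>m. ?h m x) \<partial>lborel)"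
  proof (rule sums_integral)
    show "integrable lborel (?h m)" for m
      by (intro integrable_mult_right integral_exp_int)
    have nle: "norm (?h m x) \<le> norm (fps_nth f m) * r ^ m" for m x
      using assms by (auto simp: norm_mult norm_power indicator_def)
    show "AE x in lborel. summable (\<lambda>m. norm (?h m x))"
      by (rule AE_I2, rule summable_comparison_test'[OF ss, of 0]) (use nle in auto)
    have "(\<integral>x. norm (?h m x) \<partial>lborel) = norm (fps_nth f m) * r ^ m * (2 * pi)" for m
    proof -
      have "(\<integral>x. norm (?h m x) \<partial>lborel) = (\<integral>x. norm (fps_nth f m) * r ^ m * indicator {-pi..pi} x \<partial>lborel)"
        using assms by (intro Bochner_Integration.integral_cong) (auto simp: norm_mult norm_power indicator_def)
      then show ?thesis by simp
    qed
    then show "summable (\<lambda>m. \<integral>x. norm (?h m x) \<partial>lborel)"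
      using summable_mult2[OF ss] by simp
  qed
  moreover have "integral\<^sup>L lborel (?h m) = (if m = n then 2 * of_real pi * fps_nth f n * of_real r ^ n else 0)" for m
  proof -
    have "integral\<^sup>L lborel (?h m) = fps_nth f m * of_real r ^ m * integral\<^sup>L lborel (?g m)"
      by (rule integral_mult_right_zero)
    then show ?thesis unfolding integral_exp_int by simp
  qed
  moreover have "(\<lambda>m. if m = n then 2 * of_real pi * fps_nth f n * of_real r ^ n else 0) sums (2 * of_real pi * fps_nth f n * of_real r ^ n)"
    by (rule sums_single)
  ultimately have "(\<integral>x. (\<Sum>m. ?h m x) \<partial>lborel) = 2 * of_real pi * fps_nth f n * of_real r ^ n"
    by (simp add: sums_iff)
  moreover have "(\<Sum>m. ?h m x) = indicator {-pi..pi} x *\<^sub>R (eval_fps f (of_real r * exp (\<i> * of_real x)) * exp (- (\<i> * of_real (real n * x))))" for x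
  proof -
    let ?z = "of_real r * exp (\<i> * of_real x)"
    have sz: "summable (\<lambda>m. fps_nth f m * ?z ^ m)"
      by (rule summable_fps) (use assms in \<open>auto simp: norm_mult\<close>)
    have "?h m x = indicator {-pi..pi} x *\<^sub>R (fps_nth f m * ?z ^ m * exp (- (\<i> * of_real (real n * x))))" for m
    proof -
      have "exp (\<i> * of_real x) ^ m * exp (- (\<i> * of_real (real n * x))) = exp (\<i> * of_real (of_int (int m - int n) * x))"
        by (simp add: exp_of_nat_mult[symmetric] exp_add[symmetric] algebra_simps)
      then show ?thesis by (simp add: power_mult_distrib mult.assoc)
    qed
    then have "(\<lambda>m. ?h m x) sums (indicator {-pi..pi} x *\<^sub>R (eval_fps f ?z * exp (- (\<i> * of_real (real n * x)))))"
      unfolding eval_fps_def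
      by (simp only: bounded_linear.sums[OF bounded_linear_scaleR_right] sums_mult2 summable_sums[OF sz])
    then show ?thesis by (rule sums_unique[symmetric])
  qed
  ultimately show ?thesis by simp
qed

section \<open>Bounds on the circle of integration\<close>

definition circ :: "real \<Rightarrow> real \<Rightarrow> complex" where
  "circ t x = of_real (exp (-t)) * exp (\<i> * of_real x)"

lemma circ_0: "circ t 0 = of_real (exp (-t))"
  by (simp add: circ_def)

lemma norm_circ: "norm (circ t x) = exp (-t)"
  by (simp add: circ_def norm_mult)

lemma circ_power: "circ t x ^ n = of_real (exp (- (real n * t))) * exp (\<i> * of_real (real n * x))"
  by (simp add: circ_def power_mult_distrib exp_of_nat_mult[symmetric] of_real_power[symmetric] mult_ac
      del: of_real_power)

lemma eval_cfps_circ_sums: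
  assumes "exp_summable f" "t > 0"
  shows "(\<lambda>n. of_real (f n * exp (- (real n * t))) * exp (\<i> * of_real (real n * x))) sums eval_fps (cfps f) (circ t x)"
proof -
  have "(\<lambda>n. fps_nth (cfps f) n * circ t x ^ n) sums eval_fps (cfps f) (circ t x)"
    unfolding eval_fps_def
    by (rule summable_sums, rule summable_fps, rule less_conv_radius_cfps) (use assms in \<open>auto simp: norm_circ\<close>)
  then show ?thesis by (simp add: circ_power mult.assoc)
qed

section \<open>Decay of the generating function away from the positive axis\<close>

lemma pi_square_le_10: "pi\<^sup>2 \<le> 10"
proof -
  have "pi\<^sup>2 \<le> 3.1415926535899\<^sup>2" by (rule power_mono) (use pi_approx in auto)
  also have "\<dots> \<le> 10" by (simp add: power2_eq_square)
  finally show ?thesis .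
qed

text \<open>Fourth-order Taylor expansion with \<open>x\<^sup>2 \<le> 10\<close>: the constant is
  1/2 - 10/24 = 1/12.\<close>

lemma one_minus_cos_ge:
  fixes x :: real
  assumes "\<bar>x\<bar> \<le> pi"
  shows "1 - cos x \<ge> x\<^sup>2 / 12"
proof -
  obtain s where s: "cos x = (\<Sum>m<4. cos_coeff m * x ^ m) + (cos (s + 1/2 * real 4 * pi) / fact 4) * x ^ 4"
    using Maclaurin_cos_expansion[of x 4] by blast
  have "(\<Sum>m<4. cos_coeff m * x ^ m) = 1 - x\<^sup>2 / 2"
  proof -
    have "{..<4::nat} = {0, 1, 2, 3}" by auto
    then show ?thesis by (simp add: cos_coeff_def)
  qed
  moreover have "(cos (s + 1/2 * real 4 * pi) / fact 4) * x ^ 4 \<le> 1 / fact 4 * x ^ 4"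
    by (intro mult_right_mono divide_right_mono) auto
  ultimately have 1: "cos x \<le> 1 - x\<^sup>2 / 2 + x ^ 4 / 24"
    using s by (simp add: fact_numeral)
  have "x\<^sup>2 \<le> pi\<^sup>2" using assms by (metis abs_le_square_iff abs_of_nonneg pi_ge_zero)
  also note pi_square_le_10
  finally have "x\<^sup>2 * x\<^sup>2 \<le> 10 * x\<^sup>2" by (rule mult_right_mono) simp
  then have "x ^ 4 \<le> 10 * x\<^sup>2" by (simp add: power2_eq_square eval_nat_numeral mult_ac)
  with 1 show ?thesis by linarith
qed

text \<open>Every term \<open>1 - cos (n * x)\<close> is nonnegative and enters with a coefficient
  of at least 2 for \<open>n > 0\<close>, so the drop dominates that of twice the geometric series,
  which is explicit.\<close>

lemma pair_gf_log_Re_diff: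
  assumes t: "t > 0"
  shows "Re (pair_gf_log (circ t 0) - pair_gf_log (circ t x)) \<ge> 2 * Re (1 / (1 - circ t 0) - 1 / (1 - circ t x))"
proof -
  have g: "(\<lambda>n. log_gf_coeff n * exp (- (real n * t)) * cos (real n * x)) sums Re (pair_gf_log (circ t x))" for x
    using sums_Re[OF eval_cfps_circ_sums[OF exp_summable_log_gf t]] by (simp add: pair_gf_log_def Re_exp)
  have q: "(\<lambda>n. exp (- (real n * t)) * cos (real n * x)) sums Re (1 / (1 - circ t x))" for x
  proof -
    have "(\<lambda>n. circ t x ^ n) sums (1 / (1 - circ t x))"
      by (rule geometric_sums) (use t in \<open>auto simp: norm_circ\<close>)
    from sums_Re[OF this] show ?thesis by (simp add: circ_power Re_exp)
  qed
  have "2 * (exp (- (real n * t)) * cos (real n * 0) - exp (- (real n * t)) * cos (real n * x)) \<le>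
      log_gf_coeff n * exp (- (real n * t)) * cos (real n * 0) - log_gf_coeff n * exp (- (real n * t)) * cos (real n * x)" for n
  proof (cases "n = 0")
    case False
    have "2 * (exp (- (real n * t)) * (1 - cos (real n * x))) \<le> log_gf_coeff n * (exp (- (real n * t)) * (1 - cos (real n * x)))"
      using False by (intro mult_right_mono log_gf_coeff_ge) auto
    then show ?thesis by (simp add: algebra_simps)
  qed auto
  from sums_le[OF this sums_mult[OF sums_diff[OF q q]] sums_diff[OF g g]] show ?thesis
    by simp
qed

lemma Re_geometric_diff:
  assumes t: "t > 0"
  defines "r \<equiv> exp (-t)"
  shows "Re (1 / (1 - circ t 0) - 1 / (1 - circ t x)) =
    r * (1 + r) / (1 - r) * ((1 - cos x) / ((1 - r)\<^sup>2 + 2 * r * (1 - cos x)))"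
proof -
  have r: "0 < r" "r < 1" using t by (auto simp: r_def)
  define D where "D = (1 - r)\<^sup>2 + 2 * r * (1 - cos x)"
  have D: "D > 0" unfolding D_def using r by (intro add_pos_nonneg) auto
  have "1 - circ t x = Complex (1 - r * cos x) (- (r * sin x))"
    by (simp add: complex_eq_iff circ_def r_def Re_exp Im_exp)
  moreover have "(1 - r * cos x)\<^sup>2 + (r * sin x)\<^sup>2 = D"
  proof -
    have "(r * sin x)\<^sup>2 = r\<^sup>2 * (1 - (cos x)\<^sup>2)" by (simp add: power_mult_distrib sin_squared_eq)
    then show ?thesis unfolding D_def by (simp add: power2_eq_square algebra_simps)
  qed
  ultimately have "Re (1 / (1 - circ t x)) = (1 - r * cos x) / D"
    by (simp add: Re_divide)
  moreover have "Re (1 / (1 - circ t 0)) = 1 / (1 - r)"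
  proof -
    have "1 / (1 - circ t 0) = of_real (1 / (1 - r))" by (simp add: circ_0 r_def)
    then show ?thesis by (simp only: Re_complex_of_real)
  qed
  ultimately have "Re (1 / (1 - circ t 0) - 1 / (1 - circ t x)) = 1 / (1 - r) - (1 - r * cos x) / D" by simp
  also have "\<dots> = (D - (1 - r * cos x) * (1 - r)) / ((1 - r) * D)"
    using r D by (simp add: field_simps)
  also have "D - (1 - r * cos x) * (1 - r) = r * (1 + r) * (1 - cos x)"
    unfolding D_def by (simp add: power2_eq_square algebra_simps)
  finally show ?thesis unfolding D_def by simp
qed

lemma frac_mono:
  fixes a x y :: real
  assumes "a > 0" "0 \<le> y" "y \<le> x"
  shows "y / (a + 2 * y) \<le> x / (a + 2 * x)"
  using assms by (simp add: frac_le_eq divide_simps add_pos_nonneg) (auto simp: algebra_simps mult_left_mono)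

text \<open>The closed form increases with \<open>1 - cos\<close>, so the quadratic lower bound for
  the latter may be inserted, while \<open>1 - r\<close> is at most \<open>t\<close>. The constant
  1/16 is 3/4, from \<open>r \<ge> 1/2\<close>, times 1/12, from the cosine.\<close>

lemma Re_geometric_diff_ge:
  assumes t: "0 < t" "t \<le> 1/2" and s: "\<bar>t powr (3/2) * s\<bar> \<le> pi"
  shows "Re (1 / (1 - circ t 0) - 1 / (1 - circ t (t powr (3/2) * s))) \<ge> s\<^sup>2 / (1 + t * s\<^sup>2) / 16"
proof -
  define r where "r = exp (-t)"
  define th where "th = t powr (3/2) * s"
  define y where "y = th\<^sup>2 / 12"
  define x where "x = 1 - cos th"
  have r: "0 < r" "r < 1" using t by (auto simp: r_def)
  have rt: "1 - r \<le> t" using exp_ge_add_one_self[of "-t"] by (simp add: r_def)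
  have r2: "1/2 \<le> r" using rt t by simp
  have y0: "0 \<le> y" by (simp add: y_def)
  have xy: "y \<le> x" unfolding x_def y_def using one_minus_cos_ge[of th] s by (simp add: th_def)
  have x0: "0 \<le> x" using xy y0 by simp
  have "(t powr (3/2))\<^sup>2 = t powr 3" using t by (simp add: power2_eq_square powr_add[symmetric])
  also have "\<dots> = t ^ 3" using t by (simp add: powr_numeral)
  finally have th2: "th\<^sup>2 = t ^ 3 * s\<^sup>2" by (simp add: th_def power_mult_distrib)
  have "1/2 * (1 + 1/2) \<le> r * (1 + r)" using r2 r by (intro mult_mono) auto
  then have a: "3 / 4 / t \<le> r * (1 + r) / (1 - r)"
    using r rt t by (intro frac_le) auto
  have "y / (t\<^sup>2 + 2 * y) \<le> x / (t\<^sup>2 + 2 * x)"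
    by (rule frac_mono) (use t y0 xy in auto)
  also have "\<dots> \<le> x / ((1 - r)\<^sup>2 + 2 * r * x)"
  proof (rule divide_left_mono)
    have "(1 - r)\<^sup>2 \<le> t\<^sup>2" using rt r by (intro power_mono) auto
    moreover have "r * x \<le> 1 * x" using r x0 by (intro mult_right_mono) auto
    ultimately show "(1 - r)\<^sup>2 + 2 * r * x \<le> t\<^sup>2 + 2 * x" by simp
    show "0 < (t\<^sup>2 + 2 * x) * ((1 - r)\<^sup>2 + 2 * r * x)"
      using t r x0 by (intro mult_pos_pos add_pos_nonneg) auto
  qed (rule x0)
  finally have b: "y / (t\<^sup>2 + 2 * y) \<le> x / ((1 - r)\<^sup>2 + 2 * r * x)" .
  have "s\<^sup>2 / (1 + t * s\<^sup>2) / 16 \<le> s\<^sup>2 / (1 + t * s\<^sup>2 / 6) / 16"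
    using t by (intro divide_right_mono divide_left_mono mult_pos_pos add_pos_nonneg) auto
  also have "\<dots> = 3 / 4 / t * (y / (t\<^sup>2 + 2 * y))"
  proof -
    define w where "w = 1 + t * s\<^sup>2 / 6"
    have w: "w > 0" unfolding w_def using t by (intro add_pos_nonneg) auto
    have "t\<^sup>2 + 2 * y = t\<^sup>2 * w"
      unfolding y_def th2 w_def by (simp add: power2_eq_square power3_eq_cube algebra_simps)
    then have "y / (t\<^sup>2 + 2 * y) = t * s\<^sup>2 / 12 / w"
      unfolding y_def th2 using t by (simp add: power2_eq_square power3_eq_cube)
    then show ?thesis unfolding w_def[symmetric] using t w by simp
  qed
  also have "\<dots> \<le> r * (1 + r) / (1 - r) * (x / ((1 - r)\<^sup>2 + 2 * r * x))"
    by (rule mult_mono[OF a b]) (use r t y0 in auto)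
  also have "\<dots> = Re (1 / (1 - circ t 0) - 1 / (1 - circ t th))"
    unfolding x_def r_def using Re_geometric_diff[OF t(1), of th] by simp
  finally show ?thesis by (simp add: th_def)
qed

text \<open>Below \<open>t * s\<^sup>2 = 1\<close> the exponent is at least of order \<open>s\<^sup>2\<close>; above it is at least of order \<open>1 / t\<close>, and
  \<open>\<bar>t powr (3/2) * s\<bar> \<le> pi\<close> bounds \<open>t ^ 3\<close> by a multiple of \<open>1 / s\<^sup>2\<close>.\<close>

lemma pair_gf_ratio_bound:
  assumes t: "0 < t" "t \<le> 1/2" and s: "\<bar>t powr (3/2) * s\<bar> \<le> pi"
  shows "norm (exp (pair_gf_log (circ t (t powr (3/2) * s)) - pair_gf_log (circ t 0))) \<le> 3000000 / (1 + s\<^sup>2)"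
proof -
  define q where "q = s\<^sup>2 / (1 + t * s\<^sup>2)"
  define u where "u = q / 8"
  have "norm (exp (pair_gf_log (circ t (t powr (3/2) * s)) - pair_gf_log (circ t 0))) \<le> exp (- u)"
  proof -
    define B where "B = Re (1 / (1 - circ t 0) - 1 / (1 - circ t (t powr (3/2) * s)))"
    have "q / 16 \<le> B" unfolding B_def q_def by (rule Re_geometric_diff_ge[OF assms])
    moreover have "2 * B \<le> Re (pair_gf_log (circ t 0) - pair_gf_log (circ t (t powr (3/2) * s)))"
      unfolding B_def by (rule pair_gf_log_Re_diff[OF t(1)])
    ultimately have "q / 8 \<le> Re (pair_gf_log (circ t 0)) - Re (pair_gf_log (circ t (t powr (3/2) * s)))"
      unfolding minus_complex.sel by linarith
    then show ?thesis by (simp add: u_def)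
  qed
  also have "exp (- u) \<le> 3000000 / (1 + s\<^sup>2)"
  proof (cases "t * s\<^sup>2 \<le> 1")
    case True
    have "s\<^sup>2 / 2 \<le> q" unfolding q_def
      using True t by (intro divide_left_mono mult_pos_pos add_pos_nonneg) auto
    then have "s\<^sup>2 / 16 \<le> u" by (simp add: u_def)
    then have "1 + s\<^sup>2 / 16 \<le> exp u" using exp_ge_add_one_self[of u] by linarith
    then have "1 + s\<^sup>2 \<le> 3000000 * exp u" using exp_gt_zero[of u] by linarith
    then show ?thesis by (simp add: exp_minus divide_simps add_pos_nonneg)
  next
    case False
    have s0: "s\<^sup>2 > 0" using False by (metis less_eq_real_def mult_zero_right not_le zero_less_one zero_less_power2 zero_power2)
    have s1: "1 \<le> s\<^sup>2"
    proof (rule ccontr)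
      assume "\<not> 1 \<le> s\<^sup>2"
      then have "t * s\<^sup>2 \<le> 1 * 1" using t by (intro mult_mono) auto
      with False show False by simp
    qed
    have "s\<^sup>2 / (2 * (t * s\<^sup>2)) \<le> q" unfolding q_def
      using False t s0 by (intro divide_left_mono mult_pos_pos add_pos_nonneg) auto
    then have "1 / (2 * t) \<le> q" using s0 by simp
    then have "1 / (2 * t) / 8 \<le> u" unfolding u_def by (rule divide_right_mono) simp
    then have u: "1 / (16 * t) \<le> u" by simp
    define v where "v = 1 / (16 * t)"
    have v: "v > 0" "v \<le> u" using u t by (auto simp: v_def)
    have "(v / 3) ^ 3 \<le> (1 + v / of_nat 3) ^ 3"
      using v by (intro power_mono) auto
    also have "\<dots> \<le> exp v" by (rule exp_ge_one_plus_x_over_n_power_n) (use v in auto)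
    also have "\<dots> \<le> exp u" using v by simp
    finally have e: "v ^ 3 / 27 \<le> exp u" by (simp add: power_divide)
    have "(t powr (3/2))\<^sup>2 = t powr 3" using t by (simp add: power2_eq_square powr_add[symmetric])
    also have "\<dots> = t ^ 3" using t by (simp add: powr_numeral)
    finally have th2: "(t powr (3/2) * s)\<^sup>2 = t ^ 3 * s\<^sup>2" by (simp add: power_mult_distrib)
    have "(t powr (3/2) * s)\<^sup>2 \<le> pi\<^sup>2" using s by (metis abs_le_square_iff abs_of_nonneg pi_ge_zero)
    also note pi_square_le_10
    finally have ts: "t ^ 3 * s\<^sup>2 \<le> 10" unfolding th2 .
    have "1 + s\<^sup>2 \<le> 2 * s\<^sup>2" using s1 by simp
    also have "\<dots> \<le> 20 / t ^ 3" using ts t by (simp add: field_simps)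
    \<comment> \<open>Here 4096 is 16^3. Together with the 27 from the cubic lower bound of
      \<open>exp v\<close> this gives 20 * 4096 * 27 = 2211840, which fixes the size of the constant
      3000000.\<close>
    also have "\<dots> = 20 * 4096 * v ^ 3" using t by (simp add: v_def power_divide power_mult_distrib)
    also have "\<dots> \<le> 3000000 * (v ^ 3 / 27)" using v by simp
    also have "\<dots> \<le> 3000000 * exp u" using e by simp
    finally show ?thesis by (simp add: exp_minus divide_simps add_pos_nonneg)
  qed
  finally show ?thesis .
qed

text \<open>Second-order Taylor expansion of each \<open>exp (\<i> * (N * x))\<close>. The
  coefficient 2 sigma(N)/N cancels one factor \<open>N\<close>, so linear term, quadratic term and
  cubic error are divisor series with \<open>b = 0, 1, 2\<close>.\<close>

lemma pair_gf_log_expansion: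
  assumes t: "t > 0"
  shows "norm (pair_gf_log (circ t x) - pair_gf_log (circ t 0) - \<i> * of_real (x * (2 * divisor_series 0 1 t))
      + of_real (x\<^sup>2 * divisor_series 1 1 t)) \<le> \<bar>x\<bar> ^ 3 / 3 * divisor_series 2 1 t"
proof -
  let ?e = "\<lambda>n. exp (- (real n * t))"
  have G: "(\<lambda>n. of_real (log_gf_coeff (Suc n) * ?e (Suc n)) * exp (\<i> * of_real (real (Suc n) * x))) sums pair_gf_log (circ t x)" for x
    unfolding pair_gf_log_def using eval_cfps_circ_sums[OF exp_summable_log_gf t, of x]
    by (subst sums_Suc_iff) (simp del: of_nat_Suc)
  have D: "(\<lambda>i. real (Suc i) ^ b * divisor_sum 1 (Suc i) * ?e (Suc i)) sums divisor_series b 1 t" for b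
    using divisor_series_sums[of 1 t b] t by (simp add: divisor_series_def sums_iff del: of_nat_Suc)
  have "(\<lambda>n. of_real (log_gf_coeff (Suc n) * ?e (Suc n)) * exp (\<i> * of_real (real (Suc n) * x))
      - of_real (log_gf_coeff (Suc n) * ?e (Suc n)) * exp (\<i> * of_real (real (Suc n) * 0))
      - \<i> * of_real (x * (2 * (real (Suc n) ^ 0 * divisor_sum 1 (Suc n) * ?e (Suc n))))
      + of_real (x\<^sup>2 * (real (Suc n) ^ 1 * divisor_sum 1 (Suc n) * ?e (Suc n)))) sums
     (pair_gf_log (circ t x) - pair_gf_log (circ t 0) - \<i> * of_real (x * (2 * divisor_series 0 1 t))
      + of_real (x\<^sup>2 * divisor_series 1 1 t))" (is "?f sums ?s")
    by (intro sums_add sums_diff G sums_mult sums_of_real D)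
  moreover have "norm (?f n) \<le> \<bar>x\<bar> ^ 3 / 3 * (real (Suc n) ^ 2 * divisor_sum 1 (Suc n) * ?e (Suc n))" for n
  proof -
    define N where "N = real (Suc n)"
    have N: "N > 0" by (simp add: N_def)
    define S where "S = divisor_sum 1 (Suc n) * ?e (Suc n)"
    have S: "S \<ge> 0" by (simp add: S_def divisor_sum_nonneg)
    have c: "log_gf_coeff (Suc n) * ?e (Suc n) = 2 * S / N"
      by (simp add: log_gf_coeff_def S_def N_def)
    have "?f n = of_real (2 * S / N) * (exp (\<i> * of_real (N * x)) - (\<Sum>k\<le>2. (\<i> * of_real (N * x)) ^ k / fact k))"
    proof -
      have h0: "real (Suc n) ^ 0 * divisor_sum 1 (Suc n) * ?e (Suc n) = S"
        and h1: "real (Suc n) ^ 1 * divisor_sum 1 (Suc n) * ?e (Suc n) = N * S"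
        by (simp_all add: S_def N_def mult.assoc)
      define C where "C = 2 * S / N"
      have sum3: "(\<Sum>k\<le>2. (\<i> * of_real (N * x)) ^ k / fact k) = 1 + \<i> * of_real (N * x) - of_real ((N * x)\<^sup>2 / 2)"
        by (simp add: numeral_2_eq_2 power_mult_distrib)
      have r1: "x * (2 * S) = 2 * S / N * (N * x)" and r2: "x\<^sup>2 * (N * S) = 2 * S / N * ((N * x)\<^sup>2 / 2)"
        using N by (simp_all add: power2_eq_square)
      show ?thesis
        unfolding c h0 h1 unfolding N_def[symmetric] sum3 r1 r2 unfolding C_def[symmetric] by (simp add: algebra_simps)
    qed
    also have "norm \<dots> = 2 * S / N * norm (exp (\<i> * of_real (N * x)) - (\<Sum>k\<le>2. (\<i> * of_real (N * x)) ^ k / fact k))"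
      using S N by (simp only: norm_mult norm_of_real) simp
    also have "\<dots> \<le> 2 * S / N * (\<bar>N * x\<bar> ^ Suc 2 / fact (Suc 2))"
      using S N by (intro mult_left_mono iexp_approx1) auto
    also have "\<dots> = \<bar>x\<bar> ^ 3 / 3 * (N ^ 2 * S)"
      using N by (simp add: abs_mult power_mult_distrib eval_nat_numeral fact_numeral)
    finally show ?thesis by (simp add: N_def S_def mult.assoc)
  qed
  moreover have "(\<lambda>n. \<bar>x\<bar> ^ 3 / 3 * (real (Suc n) ^ 2 * divisor_sum 1 (Suc n) * ?e (Suc n))) sums (\<bar>x\<bar> ^ 3 / 3 * divisor_series 2 1 t)"
    by (intro sums_mult D)
  ultimately show ?thesis
    using norm_suminf_le[of ?f "\<lambda>n. \<bar>x\<bar> ^ 3 / 3 * (real (Suc n) ^ 2 * divisor_sum 1 (Suc n) * ?e (Suc n))"]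
    by (simp only: sums_iff)
qed

section \<open>The saddle point\<close>

lemma powr_three_halves_power:
  assumes "t > (0::real)"
  shows "(t powr (3/2))\<^sup>2 = t ^ 3" "(t powr (3/2)) ^ 3 = t powr (1/2) * t ^ 4"
proof -
  have "(t powr (3/2))\<^sup>2 = t powr 3" by (simp add: power2_eq_square powr_add[symmetric])
  also have "\<dots> = t ^ 3" using assms by (simp add: powr_numeral)
  finally show "(t powr (3/2))\<^sup>2 = t ^ 3" .
  have "(t powr (3/2)) ^ 3 = t powr (9/2)" by (simp add: power3_eq_cube powr_add[symmetric])
  also have "\<dots> = t powr (1/2) * t powr 4" by (simp add: powr_add[symmetric])
  also have "\<dots> = t powr (1/2) * t ^ 4" using assms by (simp add: powr_numeral)
  finally show "(t powr (3/2)) ^ 3 = t powr (1/2) * t ^ 4" .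
qed

text \<open>At the angle t^(3/2) s the cubic error is of order t^(9/2 - 4), and the quadratic term
  tends to 2 zeta(2) s^2. The linear term diverges and is kept in its leading form, with an error of
  order t^(3/2 - 5/4).\<close>

lemma pair_gf_log_limit:
  "((\<lambda>t. pair_gf_log (circ t (t powr (3/2) * s)) - pair_gf_log (circ t 0)
      - \<i> * of_real (pi\<^sup>2 / 3 / t\<^sup>2 * (t powr (3/2) * s))) \<longlongrightarrow> of_real (- (pi\<^sup>2 / 3 * s\<^sup>2))) (at_right 0)"
proof -
  let ?x = "\<lambda>t::real. t powr (3/2) * s"
  define A where "A = (\<lambda>t. pair_gf_log (circ t (?x t)) - pair_gf_log (circ t 0) - \<i> * of_real (?x t * (2 * divisor_series 0 1 t))
      + of_real ((?x t)\<^sup>2 * divisor_series 1 1 t))"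
  have zeta2: "(\<Sum>d. 1 / real (Suc d) ^ Suc 1) = pi\<^sup>2 / 6"
    using zeta_2_sums by (simp add: sums_iff eval_nat_numeral)
  have pos: "\<forall>\<^sub>F t in at_right 0. t > (0::real)" by (rule eventually_at_right_less)
  have A: "(A \<longlongrightarrow> 0) (at_right 0)"
  proof (rule Lim_null_comparison)
    show "\<forall>\<^sub>F t in at_right 0. norm (A t) \<le> \<bar>s\<bar> ^ 3 / 3 * (t powr (1/2) * (t ^ Suc (2 + 1) * divisor_series 2 1 t))"
      using pos
    proof eventually_elim
      case (elim t)
      have "norm (A t) \<le> \<bar>?x t\<bar> ^ 3 / 3 * divisor_series 2 1 t"
        unfolding A_def by (rule pair_gf_log_expansion[OF elim])
      also have "\<bar>?x t\<bar> ^ 3 = \<bar>s\<bar> ^ 3 * (t powr (1/2) * t ^ 4)"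
        using powr_three_halves_power(2)[OF elim] by (simp add: abs_mult power_mult_distrib)
      finally show ?case by (simp add: eval_nat_numeral mult_ac)
    qed
    have "((\<lambda>t::real. t powr (1/2)) \<longlongrightarrow> 0) (at_right 0)" by real_asymp
    from tendsto_mult[OF this divisor_series_tendsto[of 1 2]]
    have "((\<lambda>t. t powr (1/2) * (t ^ Suc (2 + 1) * divisor_series 2 1 t)) \<longlongrightarrow> 0) (at_right 0)" by simp
    from tendsto_mult_right_zero[OF this, of "\<bar>s\<bar> ^ 3 / 3"]
    show "((\<lambda>t. \<bar>s\<bar> ^ 3 / 3 * (t powr (1/2) * (t ^ Suc (2 + 1) * divisor_series 2 1 t))) \<longlongrightarrow> 0) (at_right 0)" .
  qed
  obtain C where C: "\<And>t. t > 0 \<Longrightarrow> \<bar>divisor_series 0 1 t - pi\<^sup>2 / 6 / t\<^sup>2\<bar> \<le> C * t powr (-5/4)"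
    using divisor_series_0_1_approx by blast
  have B: "((\<lambda>t. ?x t * (2 * divisor_series 0 1 t - pi\<^sup>2 / 3 / t\<^sup>2)) \<longlongrightarrow> 0) (at_right 0)"
  proof (rule Lim_null_comparison)
    show "\<forall>\<^sub>F t in at_right 0. norm (?x t * (2 * divisor_series 0 1 t - pi\<^sup>2 / 3 / t\<^sup>2)) \<le> 2 * \<bar>s\<bar> * C * t powr (1/4)"
      using pos
    proof eventually_elim
      case (elim t)
      have eq: "2 * divisor_series 0 1 t - pi\<^sup>2 / 3 / t\<^sup>2 = 2 * (divisor_series 0 1 t - pi\<^sup>2 / 6 / t\<^sup>2)"
        by simp
      have "norm (?x t * (2 * divisor_series 0 1 t - pi\<^sup>2 / 3 / t\<^sup>2)) =
          2 * \<bar>s\<bar> * t powr (3/2) * \<bar>divisor_series 0 1 t - pi\<^sup>2 / 6 / t\<^sup>2\<bar>"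
        unfolding eq real_norm_def abs_mult by simp
      also have "\<dots> \<le> 2 * \<bar>s\<bar> * t powr (3/2) * (C * t powr (-5/4))"
        by (intro mult_left_mono C elim) auto
      also have "\<dots> = 2 * \<bar>s\<bar> * C * (t powr (3/2) * t powr (-5/4))" by (simp only: mult_ac)
      also have "t powr (3/2) * t powr (-5/4) = t powr (1/4)" by (simp add: powr_add[symmetric])
      finally show ?case .
    qed
    have "((\<lambda>t::real. t powr (1/4)) \<longlongrightarrow> 0) (at_right 0)" by real_asymp
    from tendsto_mult_right_zero[OF this, of "2 * \<bar>s\<bar> * C"]
    show "((\<lambda>t. 2 * \<bar>s\<bar> * C * t powr (1/4)) \<longlongrightarrow> 0) (at_right 0)" .
  qed
  have D: "((\<lambda>t. (?x t)\<^sup>2 * divisor_series 1 1 t) \<longlongrightarrow> pi\<^sup>2 / 3 * s\<^sup>2) (at_right 0)"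
  proof -
    have "((\<lambda>t. s\<^sup>2 * (t ^ Suc (1 + 1) * divisor_series 1 1 t)) \<longlongrightarrow> s\<^sup>2 * (fact (1 + 1) * (\<Sum>d. 1 / real (Suc d) ^ Suc 1))) (at_right 0)"
      by (intro tendsto_mult tendsto_const divisor_series_tendsto) auto
    also have "s\<^sup>2 * (fact (1 + 1) * (\<Sum>d. 1 / real (Suc d) ^ Suc 1)) = pi\<^sup>2 / 3 * s\<^sup>2"
      unfolding zeta2 by (simp add: fact_numeral)
    finally show ?thesis
    proof (rule Lim_transform_eventually)
      show "\<forall>\<^sub>F t in at_right 0. s\<^sup>2 * (t ^ Suc (1 + 1) * divisor_series 1 1 t) = (?x t)\<^sup>2 * divisor_series 1 1 t"
        using pos
      proof eventually_elim
        case (elim t)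
        show ?case unfolding power_mult_distrib powr_three_halves_power(1)[OF elim]
          by (simp add: eval_nat_numeral mult_ac)
      qed
    qed
  qed
  have "((\<lambda>t. A t + \<i> * of_real (?x t * (2 * divisor_series 0 1 t - pi\<^sup>2 / 3 / t\<^sup>2)) - of_real ((?x t)\<^sup>2 * divisor_series 1 1 t))
     \<longlongrightarrow> 0 + \<i> * of_real 0 - of_real (pi\<^sup>2 / 3 * s\<^sup>2)) (at_right 0)"
    by (intro tendsto_add tendsto_diff A tendsto_mult tendsto_const tendsto_of_real B D)
  moreover have "A t + \<i> * of_real (?x t * (2 * divisor_series 0 1 t - pi\<^sup>2 / 3 / t\<^sup>2)) - of_real ((?x t)\<^sup>2 * divisor_series 1 1 t) =
     pair_gf_log (circ t (?x t)) - pair_gf_log (circ t 0) - \<i> * of_real (pi\<^sup>2 / 3 / t\<^sup>2 * ?x t)" for t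
    unfolding A_def right_diff_distrib of_real_diff by (simp add: mult_ac)
  ultimately show ?thesis by simp
qed

section \<open>The kernel factor on the circle\<close>

lemma norm_eval_cfps_circ_le:
  assumes "exp_summable e" "\<And>i. 0 \<le> e i" "t > 0"
  shows "norm (eval_fps (cfps e) (circ t x)) \<le> exp_sum e t"
proof -
  have "norm (\<Sum>n. of_real (e n * exp (- (real n * t))) * exp (\<i> * of_real (real n * x))) \<le> (\<Sum>n. e n * exp (- (real n * t)))"
    by (rule norm_suminf_le) (use assms in \<open>auto simp: norm_mult exp_summable_def\<close>)
  then show ?thesis using eval_cfps_circ_sums[OF assms(1,3), of x] by (simp add: sums_iff exp_sum_def)
qed

text \<open>The increment of exp(i n x) costs a factor n |x|. Half of the exponential decay absorbs
  the \<open>n\<close>, which is why the right side is evaluated at \<open>t / 2\<close>.\<close>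

lemma norm_eval_cfps_circ_diff_le:
  assumes e: "exp_summable e" "\<And>i. 0 \<le> e i" and t: "t > 0"
  shows "norm (eval_fps (cfps e) (circ t x) - eval_fps (cfps e) (circ t 0)) \<le> 2 * \<bar>x\<bar> / t * exp_sum e (t / 2)"
proof -
  let ?f = "\<lambda>n. of_real (e n * exp (- (real n * t))) * exp (\<i> * of_real (real n * x)) -
      of_real (e n * exp (- (real n * t))) * exp (\<i> * of_real (real n * 0))"
  have "?f sums (eval_fps (cfps e) (circ t x) - eval_fps (cfps e) (circ t 0))"
    by (intro sums_diff eval_cfps_circ_sums e t)
  moreover have "norm (?f n) \<le> 2 * \<bar>x\<bar> / t * (e n * exp (- (real n * (t / 2))))" for n
  proof -
    have "?f n = of_real (e n * exp (- (real n * t))) * (exp (\<i> * of_real (real n * x)) - 1)"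
      by (simp add: algebra_simps)
    also have "norm \<dots> = e n * exp (- (real n * t)) * norm (exp (\<i> * of_real (real n * x)) - 1)"
      using e(2)[of n] by (simp only: norm_mult norm_of_real) (simp add: abs_mult)
    also have "\<dots> \<le> e n * exp (- (real n * t)) * \<bar>real n * x\<bar>"
      using iexp_approx1[of "real n * x" 0] e(2)[of n] by (intro mult_left_mono) auto
    also have "\<dots> = 2 * \<bar>x\<bar> / t * (e n * (real n * (t / 2) * exp (- (real n * t))))"
      using t by (simp add: abs_mult field_simps)
    also have "\<dots> \<le> 2 * \<bar>x\<bar> / t * (e n * exp (- (real n * (t / 2))))"
    proof (intro mult_left_mono)
      have "real n * (t / 2) * exp (- (real n * t)) \<le> exp (real n * (t / 2)) * exp (- (real n * t))"
      proof (rule mult_right_mono)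
        show "real n * (t / 2) \<le> exp (real n * (t / 2))"
          using exp_ge_add_one_self[of "real n * (t / 2)"] by linarith
      qed simp
      also have "\<dots> = exp (- (real n * (t / 2)))" by (simp add: exp_add[symmetric] field_simps)
      finally show "real n * (t / 2) * exp (- (real n * t)) \<le> exp (- (real n * (t / 2)))" .
    qed (use e t in auto)
    finally show ?thesis .
  qed
  moreover have "(\<lambda>n. 2 * \<bar>x\<bar> / t * (e n * exp (- (real n * (t / 2))))) sums (2 * \<bar>x\<bar> / t * exp_sum e (t / 2))"
  proof -
    have "summable (\<lambda>n. e n * exp (- (real n * (t / 2))))"
      using e(1) t unfolding exp_summable_def by (metis half_gt_zero)
    then show ?thesis unfolding exp_sum_def by (intro sums_mult summable_sums)
  qed
  ultimately show ?thesis
    using norm_suminf_le[of ?f "\<lambda>n. 2 * \<bar>x\<bar> / t * (e n * exp (- (real n * (t / 2))))"]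
    by (simp only: sums_iff)
qed

text \<open>The growth of order t^(-k) makes the quotient of \<open>exp_sum e\<close> at
  \<open>t / 2\<close> and at \<open>t\<close> tend to 2^k, so the relative change is of order
  |x|/t, that is t^(1/2).\<close>

lemma eval_cfps_circ_ratio_limit:
  assumes e: "exp_summable e" "\<And>i. 0 \<le> e i" and c: "c > 0"
    and lim: "((\<lambda>t. t ^ k * exp_sum e t) \<longlongrightarrow> c) (at_right 0)"
  shows "((\<lambda>t. eval_fps (cfps e) (circ t (t powr (3/2) * s)) / of_real (exp_sum e t)) \<longlongrightarrow> 1) (at_right 0)"
proof -
  let ?E = "\<lambda>t x. eval_fps (cfps e) (circ t x)"
  have pos: "\<forall>\<^sub>F t in at_right 0. t > (0::real)" by (rule eventually_at_right_less)
  have "\<forall>\<^sub>F t in at_right 0. t ^ k * exp_sum e t > 0"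
    using order_tendstoD(1)[OF lim c] .
  then have Epos: "\<forall>\<^sub>F t in at_right 0. exp_sum e t > 0"
    using pos by eventually_elim (simp add: zero_less_mult_iff)
  have half: "((\<lambda>t. (t / 2) ^ k * exp_sum e (t / 2)) \<longlongrightarrow> c) (at_right 0)"
  proof (rule filterlim_compose[OF lim])
    show "filterlim (\<lambda>t::real. t / 2) (at_right 0) (at_right 0)" by real_asymp
  qed
  have "((\<lambda>t. ?E t (t powr (3/2) * s) / of_real (exp_sum e t) - 1) \<longlongrightarrow> 0) (at_right 0)"
  proof (rule Lim_null_comparison)
    show "\<forall>\<^sub>F t in at_right 0. norm (?E t (t powr (3/2) * s) / of_real (exp_sum e t) - 1) \<le>
        2 * \<bar>s\<bar> * t powr (1/2) * (2 ^ k * ((t / 2) ^ k * exp_sum e (t / 2)) / (t ^ k * exp_sum e t))"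
      using pos Epos
    proof eventually_elim
      case (elim t)
      have E0: "?E t 0 = of_real (exp_sum e t)"
        unfolding circ_0 by (rule eval_cfps_exp[OF e(1) elim(1)])
      have "norm (?E t (t powr (3/2) * s) / of_real (exp_sum e t) - 1) =
          norm ((?E t (t powr (3/2) * s) - ?E t 0) / of_real (exp_sum e t))"
        unfolding E0 using elim by (simp add: diff_divide_distrib)
      also have "\<dots> = norm (?E t (t powr (3/2) * s) - ?E t 0) / exp_sum e t"
        using elim by (simp add: norm_divide)
      also have "\<dots> \<le> 2 * \<bar>t powr (3/2) * s\<bar> / t * exp_sum e (t / 2) / exp_sum e t"
        using elim by (intro divide_right_mono norm_eval_cfps_circ_diff_le e) auto
      also have "2 * \<bar>t powr (3/2) * s\<bar> / t = 2 * \<bar>s\<bar> * t powr (1/2)"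
      proof -
        have "t powr (3/2) = t * t powr (1/2)" using elim powr_add[of t 1 "1/2"] by simp
        then show ?thesis using elim by (simp add: abs_mult)
      qed
      finally show ?case using elim by (simp add: power_divide)
    qed
    have "((\<lambda>t::real. t powr (1/2)) \<longlongrightarrow> 0) (at_right 0)" by real_asymp
    from tendsto_mult[OF tendsto_mult[OF tendsto_const[of "2 * \<bar>s\<bar>"] this]
       tendsto_divide[OF tendsto_mult[OF tendsto_const[of "2 ^ k"] half] lim]] c
    show "((\<lambda>t. 2 * \<bar>s\<bar> * t powr (1/2) * (2 ^ k * ((t / 2) ^ k * exp_sum e (t / 2)) / (t ^ k * exp_sum e t))) \<longlongrightarrow> 0) (at_right 0)"
      by simp
  qed
  from tendsto_add[OF this tendsto_const[of 1]] show ?thesis by simp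
qed

section \<open>The Gaussian integral, the saddle and the limit\<close>

lemma integral_gaussian_pi:
  "(\<integral>x. complex_of_real (exp (- (pi\<^sup>2 / 3 * x\<^sup>2))) \<partial>lborel) = of_real (sqrt (3 / pi))"
proof -
  define \<sigma> where "\<sigma> = sqrt (3 / (2 * pi\<^sup>2))"
  have \<sigma>: "\<sigma> > 0" "\<sigma>\<^sup>2 = 3 / (2 * pi\<^sup>2)" by (simp_all add: \<sigma>_def)
  have "2 * pi * \<sigma>\<^sup>2 = 3 / pi" unfolding \<sigma>(2) by (simp add: power2_eq_square)
  moreover have "- x\<^sup>2 / (2 * \<sigma>\<^sup>2) = - (pi\<^sup>2 / 3 * x\<^sup>2)" for x :: real
    unfolding \<sigma>(2) by (simp add: field_simps)
  ultimately have "sqrt (3 / pi) * normal_density 0 \<sigma> x = exp (- (pi\<^sup>2 / 3 * x\<^sup>2))" for x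
    unfolding normal_density_def by simp
  then have "(\<integral>x. exp (- (pi\<^sup>2 / 3 * x\<^sup>2)) \<partial>lborel) = (\<integral>x. sqrt (3 / pi) * normal_density 0 \<sigma> x \<partial>lborel)"
    by simp
  also have "\<dots> = sqrt (3 / pi)" using integral_normal_density[OF \<sigma>(1), of 0] by simp
  finally show ?thesis by (simp only: integral_complex_of_real)
qed

lemma integrable_inverse_one_plus_square: "integrable lborel (\<lambda>s::real. 3000000 / (1 + s\<^sup>2))"
proof -
  have "integrable lborel (\<lambda>s::real. inverse (1 + s\<^sup>2))"
    using integrable_inverse_1_plus_square by (simp add: set_integrable_def)
  from integrable_mult_right[OF this, of 3000000] show ?thesis by (simp add: divide_inverse)
qed

text \<open>The stationary point of \<open>n * t + pi\<^sup>2 / (3 * t)\<close>. With this choice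
  the linear phase of the generating function has slope exactly \<open>n\<close> and cancels the
  phase of the coefficient integral.\<close>

definition saddle :: "nat \<Rightarrow> real" where
  "saddle n = pi / sqrt (3 * real n)"

lemma saddle_pos: "n > 0 \<Longrightarrow> saddle n > 0"
  by (simp add: saddle_def)

lemma saddle_filterlim: "filterlim saddle (at_right 0) sequentially"
  unfolding saddle_def by real_asymp

lemma saddle_square: "n > 0 \<Longrightarrow> pi\<^sup>2 / 3 / (saddle n)\<^sup>2 = real n"
  by (simp add: saddle_def power_divide)

lemma saddle_le_half: "n \<ge> 16 \<Longrightarrow> saddle n \<le> 1 / 2"
proof -
  assume n: "n \<ge> 16"
  have "2 * pi \<le> sqrt (3 * real n)"
  proof (rule real_le_rsqrt)
    show "(2 * pi)\<^sup>2 \<le> 3 * real n" using n pi_square_le_10 by (simp add: power_mult_distrib)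
  qed
  then show ?thesis using n by (simp add: saddle_def divide_simps)
qed

lemma saddle_point_integral:
  assumes e: "exp_summable e" "\<And>i. 0 \<le> e i" and n: "n > 0"
  defines "t \<equiv> saddle n"
  shows "(\<integral>s. indicator {-pi..pi} (t powr (3/2) * s) *\<^sub>R
      (eval_fps (cfps e) (circ t (t powr (3/2) * s)) * exp (pair_gf_log (circ t (t powr (3/2) * s))
         - \<i> * of_real (pi\<^sup>2 / 3 / t\<^sup>2 * (t powr (3/2) * s)))) \<partial>lborel) =
    of_real (2 * pi * (\<Sum>i\<le>n. e i * pair_moment 0 (n - i)) * exp (- (real n * t)) / t powr (3/2))"
proof -
  have t: "t > 0" using n by (simp add: t_def saddle_pos)
  define \<delta> where "\<delta> = t powr (3/2)"
  have \<delta>: "\<delta> > 0" using t by (simp add: \<delta>_def)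
  let ?P = "cfps e * cfps (pair_moment 0)"
  let ?h = "\<lambda>x. indicator {-pi..pi} x *\<^sub>R (eval_fps ?P (circ t x) * exp (- (\<i> * of_real (real n * x))))"
  have rad: "ereal (norm (circ t x)) < fps_conv_radius (cfps e)" "ereal (norm (circ t x)) < fps_conv_radius (cfps (pair_moment 0))" for x
    using t less_conv_radius_cfps[OF e(1), of "circ t x"] less_conv_radius_cfps[OF exp_summable_pair_moment_0, of "circ t x"]
    by (auto simp: norm_circ)
  have "ereal (exp (-t)) < fps_conv_radius ?P"
    using rad[of 0] fps_conv_radius_mult[of "cfps e" "cfps (pair_moment 0)"]
    unfolding norm_circ by (intro order_less_le_trans[OF _ fps_conv_radius_mult]) simp
  from coeff_integral[OF _ this, of n]
  have "integral\<^sup>L lborel ?h = 2 * of_real pi * fps_nth ?P n * of_real (exp (-t)) ^ n"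
    by (simp add: circ_def)
  also have "\<dots> = of_real (2 * pi * (\<Sum>i\<le>n. e i * pair_moment 0 (n - i)) * exp (- (real n * t)))"
    by (simp add: fps_mult_nth atLeast0AtMost exp_of_nat_mult[symmetric] of_real_power[symmetric] del: of_real_power)
  finally have 1: "integral\<^sup>L lborel ?h = of_real (2 * pi * (\<Sum>i\<le>n. e i * pair_moment 0 (n - i)) * exp (- (real n * t)))" .
  have 2: "integral\<^sup>L lborel ?h = \<bar>\<delta>\<bar> *\<^sub>R (\<integral>s. ?h (0 + \<delta> * s) \<partial>lborel)"
    by (rule lborel_integral_real_affine) (use \<delta> in simp)
  have 3: "?h (0 + \<delta> * s) = indicator {-pi..pi} (\<delta> * s) *\<^sub>R
      (eval_fps (cfps e) (circ t (\<delta> * s)) * exp (pair_gf_log (circ t (\<delta> * s))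
         - \<i> * of_real (pi\<^sup>2 / 3 / t\<^sup>2 * (\<delta> * s))))" for s
  proof -
    have f1: "eval_fps ?P (circ t (\<delta> * s)) = eval_fps (cfps e) (circ t (\<delta> * s)) * exp (pair_gf_log (circ t (\<delta> * s)))"
      using rad t by (subst eval_fps_mult) (auto simp: eval_pair_gf norm_circ)
    have f2: "pi\<^sup>2 / 3 / t\<^sup>2 = real n" unfolding t_def by (rule saddle_square[OF n])
    show ?thesis unfolding f2 add_0 f1 unfolding exp_diff exp_minus divide_inverse mult.assoc by (rule refl)
  qed
  have I: "I = of_real (X / \<delta>)" if "of_real X = \<bar>\<delta>\<bar> *\<^sub>R I" for I :: complex and X
    using that \<delta> by (simp add: scaleR_conv_of_real field_simps)
  show ?thesis
    unfolding \<delta>_def[symmetric] 3[symmetric] by (rule I) (rule trans[OF 1[symmetric] 2])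
qed

text \<open>The integrand is normalised by its value at angle 0. Nonnegativity of \<open>e\<close>
  bounds the kernel quotient by 1 and \<open>pair_gf_ratio_bound\<close> supplies an integrable
  majorant, so dominated convergence leads to the Gaussian integral.\<close>

lemma saddle_point_limit:
  assumes e: "exp_summable e" "\<And>i. 0 \<le> e i" and c: "c > 0"
    and lim: "((\<lambda>t. t ^ k * exp_sum e t) \<longlongrightarrow> c) (at_right 0)"
  shows "(\<lambda>n. (\<Sum>i\<le>n. e i * pair_moment 0 (n - i)) * exp (- (real n * saddle n)) /
      (exp_sum e (saddle n) * exp (2 * log_euler (saddle n)) * saddle n powr (3/2))) \<longlonglongrightarrow> sqrt (3 / pi) / (2 * pi)"
proof -
  define a where "a = (\<lambda>n. \<Sum>i\<le>n. e i * pair_moment 0 (n - i))"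
  define N where "N = (\<lambda>t. exp_sum e t * exp (2 * log_euler t))"
  define \<Psi> where "\<Psi> = (\<lambda>t s. indicator {-pi..pi} (t powr (3/2) * s) *\<^sub>R
      (eval_fps (cfps e) (circ t (t powr (3/2) * s)) / of_real (exp_sum e t) *
       exp (pair_gf_log (circ t (t powr (3/2) * s)) - pair_gf_log (circ t 0)
         - \<i> * of_real (pi\<^sup>2 / 3 / t\<^sup>2 * (t powr (3/2) * s)))))"
  have gf0: "exp (pair_gf_log (circ t 0)) = of_real (exp (2 * log_euler t))" if "t > 0" for t
    unfolding pair_gf_log_def circ_0 eval_cfps_exp[OF exp_summable_log_gf that] exp_sum_log_gf[OF that]
    by (rule exp_of_real)
  have int: "integral\<^sup>L lborel (\<Psi> (saddle n)) =
      of_real (2 * pi * (a n * exp (- (real n * saddle n)) / (N (saddle n) * saddle n powr (3/2))))" if "n > 0" for n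
  proof -
    let ?t = "saddle n"
    let ?g = "\<lambda>s. indicator {-pi..pi} (?t powr (3/2) * s) *\<^sub>R
      (eval_fps (cfps e) (circ ?t (?t powr (3/2) * s)) * exp (pair_gf_log (circ ?t (?t powr (3/2) * s))
         - \<i> * of_real (pi\<^sup>2 / 3 / ?t\<^sup>2 * (?t powr (3/2) * s))))"
    have "\<Psi> ?t s = ?g s / of_real (N ?t)" for s
    proof -
      have "exp (pair_gf_log (circ ?t (?t powr (3/2) * s)) - pair_gf_log (circ ?t 0)
         - \<i> * of_real (pi\<^sup>2 / 3 / ?t\<^sup>2 * (?t powr (3/2) * s))) =
        exp (pair_gf_log (circ ?t (?t powr (3/2) * s)) - \<i> * of_real (pi\<^sup>2 / 3 / ?t\<^sup>2 * (?t powr (3/2) * s))) /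
        of_real (exp (2 * log_euler ?t))"
        unfolding gf0[OF saddle_pos[OF that], symmetric] exp_diff[symmetric] by (simp only: algebra_simps)
      then show ?thesis unfolding \<Psi>_def N_def by (simp only: scaleR_conv_of_real of_real_mult) (simp add: mult_ac)
    qed
    then have "\<Psi> ?t = (\<lambda>s. ?g s / of_real (N ?t))" by (rule ext)
    then have "integral\<^sup>L lborel (\<Psi> ?t) = integral\<^sup>L lborel ?g / of_real (N ?t)"
      by (simp only: integral_divide_zero)
    also have "integral\<^sup>L lborel ?g = of_real (2 * pi * a n * exp (- (real n * ?t)) / ?t powr (3/2))"
      unfolding a_def by (rule saddle_point_integral[OF e that])
    finally show ?thesis by (simp add: field_simps)
  qed
  have meas: "\<Psi> t \<in> borel_measurable lborel" if t: "t > 0" for t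
  proof -
    have cont: "continuous_on UNIV (\<lambda>s. eval_fps (cfps f) (circ t (t powr (3/2) * s)))" if "exp_summable f" for f
    proof (rule continuous_on_eval_fps')
      show "continuous_on UNIV (\<lambda>s. circ t (t powr (3/2) * s))"
        unfolding circ_def by (intro continuous_intros)
      have "ereal (norm (circ t x)) < fps_conv_radius (cfps f)" for x
        by (rule less_conv_radius_cfps[OF that]) (use t in \<open>simp add: norm_circ\<close>)
      then show "(\<lambda>s. circ t (t powr (3/2) * s)) ` UNIV \<subseteq> eball 0 (fps_conv_radius (cfps f))"
        by auto
    qed
    have "continuous_on UNIV (\<lambda>s. eval_fps (cfps e) (circ t (t powr (3/2) * s)) / of_real (exp_sum e t) *
       exp (pair_gf_log (circ t (t powr (3/2) * s)) - pair_gf_log (circ t 0)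
         - \<i> * of_real (pi\<^sup>2 / 3 / t\<^sup>2 * (t powr (3/2) * s))))"
    proof (cases "exp_sum e t = 0")
      case True
      then show ?thesis by simp
    next
      case False
      have c1: "continuous_on UNIV (\<lambda>s. \<i> * complex_of_real (pi\<^sup>2 / 3 / t\<^sup>2 * (t powr (3/2) * s)))"
        by (intro continuous_intros)
      show ?thesis
        unfolding pair_gf_log_def using False
        by (intro continuous_on_mult[OF continuous_on_divide[OF cont[OF e(1)] continuous_on_const]
           continuous_on_exp[OF continuous_on_diff[OF continuous_on_diff[OF cont[OF exp_summable_log_gf] continuous_on_const] c1]]]) auto
    qed
    from borel_measurable_continuous_onI[OF this] show ?thesis unfolding \<Psi>_def
      by (intro borel_measurable_scaleR) (auto intro!: borel_measurable_indicator')
  qed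
  have ev: "\<forall>\<^sub>F n in sequentially. exp_sum e (saddle n) > 0"
  proof -
    have "\<forall>\<^sub>F t in at_right 0. t ^ k * exp_sum e t > 0" using order_tendstoD(1)[OF lim c] .
    then have "\<forall>\<^sub>F t in at_right 0. exp_sum e t > 0"
      using eventually_at_right_less[of "0::real"] by eventually_elim (simp add: zero_less_mult_iff)
    then show ?thesis using saddle_filterlim by (rule eventually_compose_filterlim)
  qed
  then obtain n0 where n0: "\<And>n. n \<ge> n0 \<Longrightarrow> exp_sum e (saddle n) > 0"
    by (auto simp: eventually_sequentially)
  \<comment> \<open>Past \<open>n0\<close> the normalising factor \<open>exp_sum e\<close> is
    positive, past 16 the saddle is at most 1/2; dropping the first \<open>m\<close> indices makes
    the majorant valid for every remaining one.\<close>
  define m where "m = max n0 16"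
  have "(\<lambda>n. integral\<^sup>L lborel (\<Psi> (saddle (n + m)))) \<longlonglongrightarrow> (\<integral>s. complex_of_real (exp (- (pi\<^sup>2 / 3 * s\<^sup>2))) \<partial>lborel)"
  proof (rule integral_dominated_convergence[where w = "\<lambda>s. 3000000 / (1 + s\<^sup>2)"])
    show "\<Psi> (saddle (n + m)) \<in> borel_measurable lborel" for n
      by (rule meas, rule saddle_pos) (simp add: m_def max_def)
    show "AE s in lborel. norm (\<Psi> (saddle (n + m)) s) \<le> 3000000 / (1 + s\<^sup>2)" for n
    proof (rule AE_I2)
      fix s :: real
      define t where "t = saddle (n + m)"
      have t: "t > 0" "t \<le> 1/2" "exp_sum e t > 0"
        unfolding t_def by (rule saddle_pos saddle_le_half n0, simp add: m_def max_def)+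
      show "norm (\<Psi> t s) \<le> 3000000 / (1 + s\<^sup>2)"
      proof (cases "t powr (3/2) * s \<in> {-pi..pi}")
        case True
        have 1: "norm (eval_fps (cfps e) (circ t (t powr (3/2) * s)) / of_real (exp_sum e t)) \<le> 1"
          using norm_eval_cfps_circ_le[OF e t(1)] t by (simp add: norm_divide)
        have "norm (\<Psi> t s) = norm (eval_fps (cfps e) (circ t (t powr (3/2) * s)) / of_real (exp_sum e t)) *
            norm (exp (pair_gf_log (circ t (t powr (3/2) * s)) - pair_gf_log (circ t 0)))"
        proof -
          have nx: "norm (exp (w - \<i> * of_real y)) = norm (exp w)" for w y by simp
          show ?thesis unfolding \<Psi>_def by (simp only: indicator_simps(1)[OF True] scaleR_one norm_mult nx)
        qed
        also have "\<dots> \<le> 1 * (3000000 / (1 + s\<^sup>2))"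
          using True by (intro mult_mono 1 pair_gf_ratio_bound t) auto
        finally show ?thesis by simp
      qed (simp add: \<Psi>_def)
    qed
    show "AE s in lborel. (\<lambda>n. \<Psi> (saddle (n + m)) s) \<longlonglongrightarrow> complex_of_real (exp (- (pi\<^sup>2 / 3 * s\<^sup>2)))"
    proof (rule AE_I2)
      fix s :: real
      have "((\<lambda>t. eval_fps (cfps e) (circ t (t powr (3/2) * s)) / of_real (exp_sum e t) *
       exp (pair_gf_log (circ t (t powr (3/2) * s)) - pair_gf_log (circ t 0)
         - \<i> * of_real (pi\<^sup>2 / 3 / t\<^sup>2 * (t powr (3/2) * s)))) \<longlongrightarrow> 1 * exp (of_real (- (pi\<^sup>2 / 3 * s\<^sup>2)))) (at_right 0)"
        by (intro tendsto_mult eval_cfps_circ_ratio_limit[OF e c lim] tendsto_exp pair_gf_log_limit)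
      moreover have "((\<lambda>t::real. t powr (3/2) * s) \<longlongrightarrow> 0 * s) (at_right 0)"
        by (intro tendsto_mult tendsto_const) real_asymp
      then have "\<forall>\<^sub>F t in at_right 0. \<bar>t powr (3/2) * s\<bar> < pi"
        by (intro order_tendstoD(2)[where y = 0] tendsto_rabs_zero) auto
      then have "\<forall>\<^sub>F t in at_right 0. eval_fps (cfps e) (circ t (t powr (3/2) * s)) / of_real (exp_sum e t) *
       exp (pair_gf_log (circ t (t powr (3/2) * s)) - pair_gf_log (circ t 0)
         - \<i> * of_real (pi\<^sup>2 / 3 / t\<^sup>2 * (t powr (3/2) * s))) = \<Psi> t s"
        by eventually_elim (auto simp: \<Psi>_def indicator_def)
      ultimately have "((\<lambda>t. \<Psi> t s) \<longlongrightarrow> 1 * exp (of_real (- (pi\<^sup>2 / 3 * s\<^sup>2)))) (at_right 0)"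
        by (rule Lim_transform_eventually)
      from filterlim_compose[OF this saddle_filterlim]
      have "(\<lambda>n. \<Psi> (saddle n) s) \<longlonglongrightarrow> of_real (exp (- (pi\<^sup>2 / 3 * s\<^sup>2)))"
        by (simp only: mult_1 exp_of_real)
      then show "(\<lambda>n. \<Psi> (saddle (n + m)) s) \<longlonglongrightarrow> complex_of_real (exp (- (pi\<^sup>2 / 3 * s\<^sup>2)))"
        by (rule LIMSEQ_ignore_initial_segment)
    qed
  qed (auto intro: integrable_inverse_one_plus_square)
  then have "(\<lambda>n. integral\<^sup>L lborel (\<Psi> (saddle (n + m)))) \<longlonglongrightarrow> of_real (sqrt (3 / pi))"
    unfolding integral_gaussian_pi .
  then have "(\<lambda>n. integral\<^sup>L lborel (\<Psi> (saddle n))) \<longlonglongrightarrow> of_real (sqrt (3 / pi))"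
    by (rule LIMSEQ_offset)
  then have "(\<lambda>n. complex_of_real (2 * pi * (a n * exp (- (real n * saddle n)) / (N (saddle n) * saddle n powr (3/2))))) \<longlonglongrightarrow> of_real (sqrt (3 / pi))"
    by (rule Lim_transform_eventually)
       (use int in \<open>auto intro!: eventually_mono[OF eventually_gt_at_top[of 0]]\<close>)
  then have "(\<lambda>n. 2 * pi * (a n * exp (- (real n * saddle n)) / (N (saddle n) * saddle n powr (3/2)))) \<longlonglongrightarrow> sqrt (3 / pi)"
    by (simp only: tendsto_of_real_iff)
  from tendsto_divide[OF this tendsto_const[of "2 * pi"]]
  show ?thesis by (simp add: a_def N_def)
qed

section \<open>The partial fractions of the cotangent and Bernoulli polynomials\<close>

definition zeta_suc :: "nat \<Rightarrow> real" where
  "zeta_suc l = (\<Sum>d. 1 / real (Suc d) ^ Suc l)"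

lemma zeta_suc_sums: "l \<ge> 1 \<Longrightarrow> (\<lambda>d. 1 / real (Suc d) ^ Suc l) sums zeta_suc l"
  unfolding zeta_suc_def using inverse_power_summable[of "Suc l", where 'a = real]
  by (intro summable_sums) (subst summable_Suc_iff, simp add: inverse_eq_divide)

lemma zeta_suc_pos: "l \<ge> 1 \<Longrightarrow> zeta_suc l > 0"
  unfolding zeta_suc_def using zeta_suc_sums[of l]
  by (intro suminf_pos) (auto simp: sums_iff)

text \<open>Differentiating both sides of the reflection formula for \<open>rGamma\<close> expresses
  the cotangent through \<open>Digamma (1 - z) - Digamma z\<close>, and the Digamma series gives the
  fractions. Multiplied out by the sine, the identity also covers \<open>z = 0\<close>.\<close>

lemma cot_partial_fractions:
  fixes z :: complex
  assumes "norm z < 1"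
  shows "(\<lambda>k. 2 * z\<^sup>2 / (of_nat (Suc k) ^ 2 - z\<^sup>2)) sums S \<Longrightarrow>
    sin (of_real pi * z) * S = sin (of_real pi * z) - of_real pi * z * cos (of_real pi * z)"
proof (cases "z = 0")
  case False
  assume S: "(\<lambda>k. 2 * z\<^sup>2 / (of_nat (Suc k) ^ 2 - z\<^sup>2)) sums S"
  have nz: "of_nat (Suc k) \<noteq> w" "of_nat (Suc k) + w \<noteq> 0" if "norm w < 1" for k and w :: complex
  proof -
    have "norm (of_nat (Suc k) :: complex) = real (Suc k)" by (simp only: norm_of_nat)
    then show "of_nat (Suc k) \<noteq> w" using that by auto
    have "norm (- w) = norm w" by simp
    with \<open>norm (of_nat (Suc k) :: complex) = real (Suc k)\<close> that
    show "of_nat (Suc k) + w \<noteq> 0" by (metis add_eq_0_iff2 add.commute le_add1 not_le of_nat_1 of_nat_le_iff plus_1_eq_Suc)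
  qed
  have int: "z \<notin> \<int>"
  proof
    assume "z \<in> \<int>"
    then obtain m :: int where "z = of_int m" by (auto elim: Ints_cases)
    with assms have "\<bar>real_of_int m\<bar> < 1" by simp
    then have "m = 0" by linarith
    with \<open>z = of_int m\<close> False show False by simp
  qed
  then have int': "z \<notin> \<int>\<^sub>\<le>\<^sub>0" "1 - z \<notin> \<int>\<^sub>\<le>\<^sub>0" "1 - z \<notin> \<int>"
  proof -
    show *: "1 - z \<notin> \<int>" using int by (metis Ints_1 Ints_diff add_diff_cancel_left' diff_add_cancel)
    show "z \<notin> \<int>\<^sub>\<le>\<^sub>0" "1 - z \<notin> \<int>\<^sub>\<le>\<^sub>0" using int * by (auto dest: nonpos_Ints_Int)
  qed
  have eq: "(\<lambda>z. rGamma z * rGamma (1 - z)) = (\<lambda>z::complex. sin (of_real pi * z) / of_real pi)"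
    by (rule ext) (rule rGamma_reflection_complex)
  have d1: "((\<lambda>z. sin (of_real pi * z) / of_real pi) has_field_derivative cos (of_real pi * z)) (at z)"
    by (auto intro!: derivative_eq_intros)
  have d2: "((\<lambda>z. rGamma z * rGamma (1 - z)) has_field_derivative
      rGamma z * rGamma (1 - z) * (Digamma (1 - z) - Digamma z)) (at z)"
    using int' by (auto intro!: derivative_eq_intros simp: algebra_simps)
  have "cos (of_real pi * z) = sin (of_real pi * z) / of_real pi * (Digamma (1 - z) - Digamma z)"
    using DERIV_unique[OF d1[folded eq] d2] unfolding rGamma_reflection_complex .
  then have c: "of_real pi * z * cos (of_real pi * z) = sin (of_real pi * z) * (z * (Digamma (1 - z) - Digamma z))"
    by simp
  have D: "(\<lambda>k. inverse (of_nat (Suc k)) - inverse (w + of_nat k)) sums (Digamma w + euler_mascheroni)" if "w \<noteq> 0" for w :: complex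
    using summable_sums[OF summable_Digamma[OF that]] by (simp add: Digamma_def)
  have "1 - z \<noteq> 0" "1 + z \<noteq> 0" using nz[of z 0] assms by auto
  from sums_mult[OF sums_diff[OF D[OF this(1)] D[OF this(2)]], of z]
  have "(\<lambda>k. z * (inverse (1 + z + of_nat k) - inverse (1 - z + of_nat k))) sums (z * (Digamma (1 - z) - Digamma (1 + z)))"
    by (simp add: algebra_simps)
  moreover have "z * (inverse (1 + z + of_nat k) - inverse (1 - z + of_nat k)) = - (2 * z\<^sup>2 / (of_nat (Suc k) ^ 2 - z\<^sup>2))" for k
  proof -
    define n :: complex where "n = of_nat (Suc k)"
    have n: "n + z \<noteq> 0" "n - z \<noteq> 0" using nz[of z k] assms by (auto simp: n_def)
    have e: "1 + z + of_nat k = n + z" "1 - z + of_nat k = n - z" by (simp_all add: n_def)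
    have e': "n\<^sup>2 - z\<^sup>2 = (n + z) * (n - z)" by (simp add: power2_eq_square algebra_simps)
    show ?thesis
      unfolding e unfolding n_def[symmetric] e' using n by (simp add: divide_simps) (simp add: power2_eq_square algebra_simps)
  qed
  ultimately have "(\<lambda>k. - (2 * z\<^sup>2 / (of_nat (Suc k) ^ 2 - z\<^sup>2))) sums (z * (Digamma (1 - z) - Digamma (1 + z)))"
    by (simp only:)
  from sums_unique2[OF this sums_minus[OF S]]
  have "z * (Digamma (1 - z) - Digamma (1 + z)) = - S" .
  moreover have "Digamma (1 + z) = Digamma z + 1 / z"
    using Digamma_plus1[OF False] by (simp add: add.commute)
  ultimately have eq': "z * (Digamma (1 - z) - Digamma z) = 1 - S"
    using False by (simp add: algebra_simps)
  show ?thesis unfolding c eq' by (simp add: algebra_simps)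
qed auto

text \<open>Each fraction is expanded in powers of \<open>w / real (Suc k)\<close>. Only even powers
  occur, so all terms are nonnegative even for negative \<open>w\<close> and the double sum may be
  exchanged.\<close>

lemma zeta_power_series:
  fixes w :: real
  assumes w: "\<bar>w\<bar> < 1"
  shows "(\<lambda>l. (if odd l then 2 * zeta_suc l else 0) * w ^ Suc l) sums (\<Sum>k. 2 * w\<^sup>2 / (real (Suc k) ^ 2 - w\<^sup>2))"
    and "summable (\<lambda>k. 2 * w\<^sup>2 / (real (Suc k) ^ 2 - w\<^sup>2))"
proof -
  define f where "f = (\<lambda>k l. if odd l then 2 * (w / real (Suc k)) ^ Suc l else 0)"
  have w2: "w\<^sup>2 < 1" using w by (simp add: abs_square_less_1)
  have f0: "0 \<le> f k l" for k l
    by (auto simp: f_def zero_le_even_power simp del: power_Suc)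
  have inner: "f k sums (2 * w\<^sup>2 / (real (Suc k) ^ 2 - w\<^sup>2))" for k
  proof -
    define x where "x = w / real (Suc k)"
    have "\<bar>x\<bar> \<le> \<bar>w\<bar>" by (simp add: x_def divide_simps mult_le_cancel_left1)
    then have x: "\<bar>x\<bar> < 1" using w by simp
    have g: "(\<lambda>l. y ^ Suc l) sums (y / (1 - y))" if "\<bar>y\<bar> < 1" for y :: real
      using sums_mult[OF geometric_sums[of y], of y] that by simp
    from sums_add[OF g[of x] g[of "-x"]] x
    have "(\<lambda>l. x ^ Suc l + (- x) ^ Suc l) sums (x / (1 - x) + - x / (1 - - x))" by simp
    moreover have "x ^ Suc l + (- x) ^ Suc l = f k l" for l
      unfolding f_def x_def[symmetric] by (cases "even l") auto
    moreover have "x / (1 - x) + - x / (1 - - x) = 2 * w\<^sup>2 / (real (Suc k) ^ 2 - w\<^sup>2)"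
    proof -
      have "x * real (Suc k) = w" by (simp add: x_def del: of_nat_Suc)
      then have "w\<^sup>2 = x\<^sup>2 * real (Suc k) ^ 2" by (metis power_mult_distrib)
      then have "2 * w\<^sup>2 / (real (Suc k) ^ 2 - w\<^sup>2) = 2 * x\<^sup>2 * real (Suc k) ^ 2 / ((1 - x\<^sup>2) * real (Suc k) ^ 2)"
        by (simp add: algebra_simps)
      also have "\<dots> = 2 * x\<^sup>2 / (1 - x\<^sup>2)" by (simp del: of_nat_Suc)
      also have "\<dots> = x / (1 - x) + - x / (1 - - x)"
      proof -
        have "1 - x \<noteq> 0" "1 + x \<noteq> 0" using x by auto
        moreover have "1 - x\<^sup>2 = (1 - x) * (1 + x)" by (simp add: power2_eq_square algebra_simps)
        ultimately show ?thesis by (simp add: divide_simps) (simp add: power2_eq_square algebra_simps)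
      qed
      finally show ?thesis by simp
    qed
    ultimately show ?thesis by simp
  qed
  show sm: "summable (\<lambda>k. 2 * w\<^sup>2 / (real (Suc k) ^ 2 - w\<^sup>2))"
  proof (rule summable_comparison_test')
    show "summable (\<lambda>k. 2 / (1 - w\<^sup>2) * (1 / real (Suc k) ^ 2))"
      using zeta_2_sums by (intro summable_mult) (simp add: sums_iff)
    fix k :: nat
    have k1: "1 \<le> real (Suc k) ^ 2" by (rule one_le_power) simp
    have "w\<^sup>2 * 1 \<le> w\<^sup>2 * real (Suc k) ^ 2" using k1 by (intro mult_left_mono) auto
    then have *: "(1 - w\<^sup>2) * real (Suc k) ^ 2 \<le> real (Suc k) ^ 2 - w\<^sup>2" by (simp add: algebra_simps)
    have "0 < (1 - w\<^sup>2) * real (Suc k) ^ 2" using w2 by simp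
    with * have p: "0 < real (Suc k) ^ 2 - w\<^sup>2" by linarith
    have "2 * w\<^sup>2 / (real (Suc k) ^ 2 - w\<^sup>2) \<le> 2 / ((1 - w\<^sup>2) * real (Suc k) ^ 2)"
      using * w2 p by (intro frac_le) auto
    then show "norm (2 * w\<^sup>2 / (real (Suc k) ^ 2 - w\<^sup>2)) \<le> 2 / (1 - w\<^sup>2) * (1 / real (Suc k) ^ 2)"
      using p by (simp del: of_nat_Suc)
  qed
  define T where "T = (\<Sum>k. 2 * w\<^sup>2 / (real (Suc k) ^ 2 - w\<^sup>2))"
  have in': "((\<lambda>l. (\<lambda>(k, l). f k l) (k, l)) has_sum (2 * w\<^sup>2 / (real (Suc k) ^ 2 - w\<^sup>2))) UNIV" for k
    using sums_nonneg_imp_has_sum[OF inner f0] by simp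
  have S0: "0 \<le> 2 * w\<^sup>2 / (real (Suc k) ^ 2 - w\<^sup>2)" for k
    by (rule sums_le[OF f0 sums_zero inner])
  have out': "((\<lambda>k. 2 * w\<^sup>2 / (real (Suc k) ^ 2 - w\<^sup>2)) has_sum T) UNIV"
    unfolding T_def by (rule sums_nonneg_imp_has_sum[OF summable_sums[OF sm] S0])
  have "(\<lambda>(k, l). f k l) summable_on (UNIV \<times> UNIV)"
    by (rule summable_on_SigmaI[OF in']) (use out' f0 in \<open>auto simp: has_sum_imp_summable\<close>)
  then have "((\<lambda>(k, l). f k l) has_sum T) (UNIV \<times> UNIV)"
    by (intro has_sum_SigmaI[where g = "\<lambda>k. 2 * w\<^sup>2 / (real (Suc k) ^ 2 - w\<^sup>2)"] in' out') auto
  then have "((\<lambda>(l, k). f k l) has_sum T) (UNIV \<times> UNIV)"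
    by (subst (asm) has_sum_reindex_bij_witness[where j = prod.swap and i = prod.swap and T = "UNIV \<times> UNIV" and h = "\<lambda>(l, k). f k l" and s' = T]) auto
  then have "((\<lambda>l. (if odd l then 2 * zeta_suc l else 0) * w ^ Suc l) has_sum T) UNIV"
  proof (rule has_sum_SigmaD)
    fix l :: nat
    have "(\<lambda>k. f k l) sums ((if odd l then 2 * zeta_suc l else 0) * w ^ Suc l)"
    proof (cases "odd l")
      case True
      then have "l \<ge> 1" by (cases l) auto
      from sums_mult[OF zeta_suc_sums[OF this], of "2 * w ^ Suc l"] True show ?thesis
        by (simp add: f_def power_divide mult_ac del: of_nat_Suc power_Suc)
    qed (auto simp: f_def)
    from sums_nonneg_imp_has_sum[OF this f0]
    show "((\<lambda>k. case (l, k) of (l, k) \<Rightarrow> f k l) has_sum (if odd l then 2 * zeta_suc l else 0) * w ^ Suc l) UNIV"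
      by simp
  qed
  then show "(\<lambda>l. (if odd l then 2 * zeta_suc l else 0) * w ^ Suc l) sums (\<Sum>k. 2 * w\<^sup>2 / (real (Suc k) ^ 2 - w\<^sup>2))"
    unfolding T_def by (rule has_sum_imp_sums)
qed

definition zeta_coeff :: "nat \<Rightarrow> real" where
  "zeta_coeff l = (if odd l then 2 * zeta_suc l else 0)"

lemma exp_summable_zeta_coeff: "exp_summable zeta_coeff"
  unfolding exp_summable_def
proof (intro allI impI)
  fix t :: real assume t: "t > 0"
  have "summable (\<lambda>l. zeta_coeff l * exp (-t) ^ Suc l)"
    using zeta_power_series(1)[of "exp (-t)"] t by (simp add: zeta_coeff_def sums_iff)
  then have "summable (\<lambda>l. exp t * (zeta_coeff l * exp (-t) ^ Suc l))" by (rule summable_mult)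
  moreover have "exp t * (zeta_coeff l * exp (-t) ^ Suc l) = zeta_coeff l * exp (- (real l * t))" for l
  proof -
    have "exp t * exp (-t) = 1" by (simp add: exp_minus)
    moreover have "exp (-t) ^ l = exp (- (real l * t))" by (simp add: exp_of_nat_mult[symmetric])
    ultimately show ?thesis by simp
  qed
  ultimately show "summable (\<lambda>l. zeta_coeff l * exp (- (real l * t)))" by (simp only:)
qed

text \<open>The partial fractions match the zeta series at real points of (-1, 1). Analytic
  continuation extends the identity to the disc, and uniqueness of expansions moves it to formal
  power series.\<close>

lemma fps_sin_zeta_coeff:
  "fps_sin (of_real pi) * (fps_X * cfps zeta_coeff) =
    fps_sin (of_real pi) - fps_const (of_real pi) * fps_X * fps_cos (of_real pi)"
proof -
  define Z where "Z = cfps zeta_coeff"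
  define \<Phi> where "\<Phi> = (\<lambda>w. sin (of_real pi * w) * (w * eval_fps Z w) - (sin (of_real pi * w) - of_real pi * w * cos (of_real pi * w)))"
  have rad: "ereal (norm w) < fps_conv_radius Z" if "norm w < 1" for w
    unfolding Z_def by (rule less_conv_radius_cfps[OF exp_summable_zeta_coeff that])
  have real0: "\<Phi> (of_real w) = 0" if w: "\<bar>w\<bar> < 1" for w :: real
  proof -
    have S: "(\<lambda>k. 2 * w\<^sup>2 / (real (Suc k) ^ 2 - w\<^sup>2)) sums (\<Sum>k. 2 * w\<^sup>2 / (real (Suc k) ^ 2 - w\<^sup>2))" (is "_ sums ?S")
      using zeta_power_series(2)[OF w] by (rule summable_sums)
    have "(\<lambda>l. of_real (zeta_coeff l * w ^ Suc l)) sums complex_of_real ?S"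
      unfolding zeta_coeff_def by (intro sums_of_real zeta_power_series w)
    moreover have "(\<lambda>l. of_real w * (fps_nth Z l * of_real w ^ l)) sums (of_real w * eval_fps Z (of_real w))"
      unfolding eval_fps_def by (intro sums_mult summable_sums summable_fps rad) (use w in simp)
    moreover have "of_real (zeta_coeff l * w ^ Suc l) = of_real w * (fps_nth Z l * of_real w ^ l)" for l
      by (simp add: Z_def)
    ultimately have 1: "of_real w * eval_fps Z (of_real w) = of_real ?S"
      by (simp only: sums_unique2)
    have 2: "(\<lambda>k. 2 * (complex_of_real w)\<^sup>2 / (of_nat (Suc k) ^ 2 - (of_real w)\<^sup>2)) sums of_real ?S"
      using sums_of_real[OF S, where 'a = complex] by simp
    show ?thesis unfolding \<Phi>_def 1 using cot_partial_fractions[OF _ 2] w by simp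
  qed
  have holo: "\<Phi> holomorphic_on ball 0 1"
    unfolding \<Phi>_def by (intro holomorphic_intros) (use rad in auto)
  have zero: "\<Phi> w = 0" if "w \<in> ball 0 1" for w
  proof (rule analytic_continuation[OF holo, where U = "of_real ` {-1<..<1}" and \<xi> = 0])
    show "0 islimpt complex_of_real ` {- 1<..<1}"
      unfolding islimpt_sequential
    proof (intro exI conjI allI)
      show "complex_of_real (1 / real (n + 2)) \<in> complex_of_real ` {- 1<..<1} - {0}" for n
      proof (intro DiffI imageI)
        show "1 / real (n + 2) \<in> {- 1<..<1}" by (simp add: field_simps)
        have "1 / real (n + 2) \<noteq> 0" by simp
        then show "complex_of_real (1 / real (n + 2)) \<notin> {0}" by (simp only: of_real_eq_0_iff singleton_iff not_False_eq_True)
      qed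
      have "(\<lambda>n. 1 / real (n + 2)) \<longlonglongrightarrow> 0" by real_asymp
      then have "(\<lambda>n. complex_of_real (1 / real (n + 2))) \<longlonglongrightarrow> of_real 0" by (rule tendsto_of_real)
      then show "(\<lambda>n. complex_of_real (1 / real (n + 2))) \<longlonglongrightarrow> 0" by simp
    qed
  qed (use that real0 in auto)
  have rad0: "fps_conv_radius Z > 0" using rad[of 0] by (simp add: zero_ereal_def)
  have "\<Phi> has_fps_expansion fps_sin (of_real pi) * (fps_X * Z) -
      (fps_sin (of_real pi) - fps_const (of_real pi) * fps_X * fps_cos (of_real pi))"
    unfolding \<Phi>_def
    by (intro fps_expansion_intros eval_fps_has_fps_expansion rad0)
  moreover have "\<Phi> has_fps_expansion 0"
  proof -
    have "\<forall>\<^sub>F z in nhds 0. z \<in> ball (0::complex) 1" by (intro eventually_nhds_in_open) auto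
    then have "\<forall>\<^sub>F z in nhds 0. 0 = \<Phi> z" by eventually_elim (use zero in auto)
    then show ?thesis by (simp add: has_fps_expansion_def)
  qed
  ultimately have "fps_sin (of_real pi) * (fps_X * Z) -
      (fps_sin (of_real pi) - fps_const (of_real pi) * fps_X * fps_cos (of_real pi)) = 0"
    by (rule fps_expansion_unique_complex)
  then show ?thesis by (simp add: Z_def)
qed

text \<open>The recursion of the kernel in the limit of small \<open>t\<close>: a divisor sum of
  exponent \<open>l\<close> contributes \<open>fact l * zeta_suc l\<close> at order t^(-(l+1)),
  which together with t^(-(k-l)) always gives t^(-(k+1)).\<close>

fun lim_moment :: "nat \<Rightarrow> real" where
  "lim_moment 0 = 1"
| "lim_moment (Suc k) = (\<Sum>l\<le>k. moment_coeff k l * (fact l * zeta_suc l * lim_moment (k - l)))"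

declare lim_moment.simps(2) [simp del]

lemma lim_moment_nonneg: "0 \<le> lim_moment k"
proof (induction k rule: less_induct)
  case (less k)
  show ?case
  proof (cases k)
    case (Suc j)
    have "0 \<le> moment_coeff j l * (fact l * zeta_suc l * lim_moment (j - l))" for l
    proof (cases "odd l")
      case True
      then have "l \<ge> 1" by (cases l) auto
      then show ?thesis using less[of "j - l"] Suc zeta_suc_pos[of l]
        by (auto simp: moment_coeff_def intro!: mult_nonneg_nonneg)
    qed (auto simp: moment_coeff_def)
    then show ?thesis unfolding Suc lim_moment.simps by (intro sum_nonneg) auto
  qed auto
qed

text \<open>Positivity is what permits division by the leading term. All summands are nonnegative,
  and the one at \<open>l = 1\<close> contains the previous even moment.\<close>

lemma lim_moment_even_pos: "0 < lim_moment (2 * k)"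
proof (induction k)
  case (Suc k)
  let ?f = "\<lambda>l. moment_coeff (Suc (2 * k)) l * (fact l * zeta_suc l * lim_moment (Suc (2 * k) - l))"
  have nonneg: "0 \<le> ?f l" for l
  proof (cases "odd l")
    case True
    then have "l \<ge> 1" by (cases l) auto
    then show ?thesis using zeta_suc_pos[of l] lim_moment_nonneg
      by (auto simp: moment_coeff_def intro!: mult_nonneg_nonneg)
  qed (auto simp: moment_coeff_def)
  have "0 < ?f 1" using Suc zeta_suc_pos[of 1] by (auto simp: moment_coeff_def)
  also have "?f 1 = sum ?f {1}" by simp
  also have "\<dots> \<le> sum ?f {..Suc (2 * k)}" by (rule sum_mono2) (use nonneg in auto)
  finally show ?case using lim_moment.simps(2)[of "Suc (2 * k)"] by simp
qed auto

text \<open>The recursion is A' = Z A for the exponential generating function. With the cotangent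
  identity, Y = A sin(pi X) satisfies X Y' = Y, which annihilates every coefficient except the
  linear one.\<close>

lemma lim_moment_fps_sin:
  defines "A \<equiv> cfps (\<lambda>k. lim_moment k / fact k)"
  shows "A * fps_sin (of_real pi) = fps_const (of_real pi) * fps_X"
proof -
  define Z where "Z = cfps zeta_coeff"
  let ?s = "fps_sin (of_real pi) :: complex fps"
  let ?c = "fps_cos (of_real pi) :: complex fps"
  have ode: "fps_deriv A = Z * A"
  proof (rule fps_ext)
    fix k
    have "real (Suc k) * (lim_moment (Suc k) / fact (Suc k)) = lim_moment (Suc k) / fact k"
      by (simp del: of_nat_Suc)
    also have "\<dots> = (\<Sum>l\<le>k. zeta_coeff l * (lim_moment (k - l) / fact (k - l)))"
      unfolding lim_moment.simps sum_divide_distrib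
    proof (rule sum.cong[OF refl])
      fix l assume "l \<in> {..k}"
      then have "real (k choose l) = fact k / (fact l * fact (k - l))"
        by (simp add: binomial_fact)
      then show "moment_coeff k l * (fact l * zeta_suc l * lim_moment (k - l)) / fact k =
          zeta_coeff l * (lim_moment (k - l) / fact (k - l))"
        by (auto simp: moment_coeff_def zeta_coeff_def field_simps)
    qed
    finally have "complex_of_real (real (Suc k) * (lim_moment (Suc k) / fact (Suc k))) =
        of_real (\<Sum>l\<le>k. zeta_coeff l * (lim_moment (k - l) / fact (k - l)))" by (rule arg_cong)
    then show "fps_nth (fps_deriv A) k = fps_nth (Z * A) k"
      by (simp add: A_def Z_def fps_mult_nth atLeast0AtMost del: of_nat_Suc fact_Suc)
  qed
  define Y where "Y = A * ?s"
  have "fps_X * fps_deriv Y = fps_X * (Z * A * ?s + A * (fps_const (of_real pi) * ?c))"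
    unfolding Y_def by (simp add: ode fps_sin_deriv algebra_simps)
  also have "\<dots> = A * (?s * (fps_X * Z)) + A * (fps_const (of_real pi) * fps_X * ?c)"
    by (simp add: algebra_simps)
  also have "\<dots> = Y"
    unfolding Z_def fps_sin_zeta_coeff Y_def by (simp add: algebra_simps)
  finally have XY: "fps_X * fps_deriv Y = Y" .
  have "fps_nth Y n = fps_nth (fps_const (of_real pi) * fps_X) n" for n
  proof (cases "n = 1")
    case True
    have "fps_nth Y 1 = of_real pi"
      by (simp add: Y_def fps_mult_nth A_def fps_sin_def)
    then show ?thesis using True by simp
  next
    case False
    have "fps_nth (fps_X * fps_deriv Y) n = of_nat n * fps_nth Y n"
      by (cases n) (auto simp: fps_X_mult_nth)
    then have "of_nat n * fps_nth Y n = fps_nth Y n" by (simp only: XY)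
    then have "(of_nat n - 1) * fps_nth Y n = 0" by (simp add: algebra_simps)
    moreover have "(of_nat n :: complex) - 1 \<noteq> 0" using False by (metis of_nat_1 of_nat_eq_iff right_minus_eq)
    ultimately have "fps_nth Y n = 0" by simp
    then show ?thesis using False by simp
  qed
  then show ?thesis unfolding Y_def by (intro fps_ext) simp
qed

section \<open>Substitution of a complex multiple and the Bernoulli polynomials at 1/2\<close>

definition scale_fps :: "complex \<Rightarrow> real fps \<Rightarrow> complex fps" where
  "scale_fps c F = Abs_fps (\<lambda>n. c ^ n * of_real (fps_nth F n))"

lemma scale_fps_mult: "scale_fps c (F * G) = scale_fps c F * scale_fps c G"
proof (rule fps_ext)
  fix n
  have "c ^ n * of_real (\<Sum>i=0..n. fps_nth F i * fps_nth G (n - i)) =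
     (\<Sum>i=0..n. c ^ i * of_real (fps_nth F i) * (c ^ (n - i) * of_real (fps_nth G (n - i))))"
    unfolding of_real_sum sum_distrib_left
  proof (rule sum.cong[OF refl])
    fix i assume "i \<in> {0..n}"
    then have "c ^ n = c ^ i * c ^ (n - i)" by (simp add: power_add[symmetric])
    then show "c ^ n * of_real (fps_nth F i * fps_nth G (n - i)) =
       c ^ i * of_real (fps_nth F i) * (c ^ (n - i) * of_real (fps_nth G (n - i)))" by simp
  qed
  then show "fps_nth (scale_fps c (F * G)) n = fps_nth (scale_fps c F * scale_fps c G) n"
    by (simp add: scale_fps_def fps_mult_nth)
qed

text \<open>For c = 2 pi i, replacing the variable of t exp(t/2)/(exp(t) - 1) by c w gives pi
  w/sin(pi w). Both series are compared after multiplication by the nonzero series exp(c w) - 1, and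
  the even powers of \<open>c\<close> are real with sign (-1)^k.\<close>

lemma lim_moment_even:
  "lim_moment (2 * k) = (-1) ^ k * (2 * pi) ^ (2 * k) * bernoulli_poly (2 * k) (1 / 2)"
proof -
  define c :: complex where "c = 2 * of_real pi * \<i>"
  define A where "A = cfps (\<lambda>k. lim_moment k / fact k)"
  define H where "H = scale_fps c (Abs_fps (\<lambda>l. bernoulli_poly l (1 / 2) / fact l))"
  have e1: "scale_fps c (fps_exp 1 - 1) = fps_exp c - 1"
    by (rule fps_ext) (simp add: scale_fps_def)
  have e2: "scale_fps c (fps_X * fps_exp (1 / 2)) = fps_const c * fps_X * fps_exp (c / 2)"
  proof -
    have "scale_fps c fps_X = fps_const c * fps_X"
    proof (rule fps_ext)
      show "fps_nth (scale_fps c fps_X) n = fps_nth (fps_const c * fps_X) n" for n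
        by (cases "n = 1") (auto simp: scale_fps_def fps_X_def)
    qed
    moreover have "scale_fps c (fps_exp (1 / 2)) = fps_exp (c / 2)"
      by (rule fps_ext) (simp add: scale_fps_def power_divide)
    ultimately show ?thesis by (simp only: scale_fps_mult)
  qed
  have "H * scale_fps c (fps_exp 1 - 1) = scale_fps c (fps_X * fps_exp (1 / 2))"
    unfolding H_def scale_fps_mult[symmetric] bernoulli_poly_gf ..
  then have 1: "H * (fps_exp c - 1) = fps_const c * fps_X * fps_exp (c / 2)"
    unfolding e1 e2 .
  have s: "fps_const (2 * \<i>) * fps_sin (of_real pi) = fps_exp (c / 2) - fps_exp (- (c / 2))"
  proof -
    have c1: "c / 2 = \<i> * of_real pi" and c2: "- (\<i> * of_real pi) = - \<i> * of_real pi"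
      by (simp_all add: c_def)
    have "fps_const (2 * \<i>) * (D / fps_const (2 * \<i>)) = D" for D
      by (rule dvd_mult_div_cancel) (simp add: fps_dvd_iff)
    then show ?thesis unfolding c1 c2 fps_sin_fps_exp_ii .
  qed
  have "fps_exp (c / 2) * fps_exp (c / 2) = fps_exp c" "fps_exp (c / 2) * fps_exp (- (c / 2)) = 1"
    unfolding fps_exp_add_mult[symmetric] by simp_all
  then have "fps_exp c - 1 = fps_exp (c / 2) * (fps_const (2 * \<i>) * fps_sin (of_real pi))"
    unfolding s right_diff_distrib by (simp only:)
  then have "A * (fps_exp c - 1) = fps_exp (c / 2) * (fps_const (2 * \<i>) * (A * fps_sin (of_real pi)))"
    by (simp only: mult_ac)
  also have "A * fps_sin (of_real pi) = fps_const (of_real pi) * fps_X"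
    unfolding A_def by (rule lim_moment_fps_sin)
  also have "fps_exp (c / 2) * (fps_const (2 * \<i>) * (fps_const (of_real pi) * fps_X)) = fps_const c * fps_X * fps_exp (c / 2)"
  proof -
    have "fps_const c = fps_const (2 * \<i>) * fps_const (of_real pi)"
      by (simp add: c_def)
    then show ?thesis by (simp only: mult_ac)
  qed
  finally have "(A - H) * (fps_exp c - 1) = 0" unfolding left_diff_distrib 1 by simp
  moreover have "fps_exp c - 1 \<noteq> (0 :: complex fps)"
  proof
    assume "fps_exp c - 1 = (0 :: complex fps)"
    then have "fps_nth (fps_exp c - 1) 1 = 0" by simp
    then show False by (simp add: c_def)
  qed
  ultimately have "A = H" by simp
  then have "fps_nth A (2 * k) = fps_nth H (2 * k)" by simp
  moreover have "c ^ (2 * k) = of_real ((-1) ^ k * (2 * pi) ^ (2 * k))"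
  proof -
    have "c\<^sup>2 = of_real ((-1) * (2 * pi)\<^sup>2)" by (simp add: c_def power_mult_distrib)
    then have "c ^ (2 * k) = of_real (((-1) * (2 * pi)\<^sup>2) ^ k)" by (simp only: power_mult of_real_power)
    then show ?thesis by (simp only: power_mult_distrib[of "-1"] power_mult)
  qed
  ultimately have "complex_of_real (lim_moment (2 * k) / fact (2 * k)) =
      of_real ((-1) ^ k * (2 * pi) ^ (2 * k) * (bernoulli_poly (2 * k) (1 / 2) / fact (2 * k)))"
    by (simp add: A_def H_def scale_fps_def)
  then have "lim_moment (2 * k) / fact (2 * k) = (-1) ^ k * (2 * pi) ^ (2 * k) * (bernoulli_poly (2 * k) (1 / 2) / fact (2 * k))"
    by (simp only: of_real_eq_iff)
  then show ?thesis by (simp add: field_simps)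
qed

section \<open>Moments of pairs of partitions\<close>

fun moment_kernel :: "nat \<Rightarrow> nat \<Rightarrow> real" where
  "moment_kernel 0 n = of_bool (n = 0)"
| "moment_kernel (Suc k) n =
    (\<Sum>l\<le>k. moment_coeff k l * (\<Sum>i\<le>n. divisor_sum l i * moment_kernel (k - l) (n - i)))"

declare moment_kernel.simps(2) [simp del]

lemma divisor_sum_0 [simp]: "divisor_sum l 0 = 0"
  by (simp add: divisor_sum_def)

text \<open>Moments and kernels obey the same recursion, linear in the lower ones; only the starting
  values differ, \<open>pair_moment 0\<close> against the unit series. Hence P_k = K_k P_0 by strong
  induction.\<close>

lemma pair_moment_eq_kernel_convolution:
  "pair_moment k n = (\<Sum>i\<le>n. moment_kernel k i * pair_moment 0 (n - i))"
proof -
  define P where "P = (\<lambda>k. Abs_fps (pair_moment k))"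
  define K where "K = (\<lambda>k. Abs_fps (moment_kernel k))"
  define D where "D = (\<lambda>l. Abs_fps (divisor_sum l))"
  have P: "P (Suc k) = (\<Sum>l\<le>k. fps_const (moment_coeff k l) * (D l * P (k - l)))" for k
  proof (rule fps_ext)
    fix n
    have "(\<Sum>i=1..n. divisor_sum l i * pair_moment (k - l) (n - i)) =
       (\<Sum>i=0..n. divisor_sum l i * pair_moment (k - l) (n - i))" for l
      by (rule sum.mono_neutral_left) (auto simp: Suc_le_eq)
    then show "fps_nth (P (Suc k)) n = fps_nth (\<Sum>l\<le>k. fps_const (moment_coeff k l) * (D l * P (k - l))) n"
      unfolding fps_sum_nth fps_mult_left_const_nth
      by (simp add: P_def D_def fps_mult_nth pair_moment_Suc_recurrence)
  qed
  have K: "K (Suc k) = (\<Sum>l\<le>k. fps_const (moment_coeff k l) * (D l * K (k - l)))" for k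
    by (rule fps_ext, unfold fps_sum_nth fps_mult_left_const_nth)
       (simp add: K_def D_def fps_mult_nth moment_kernel.simps atLeast0AtMost)
  have "P k = K k * P 0"
  proof (induction k rule: less_induct)
    case (less k)
    show ?case
    proof (cases k)
      case 0
      have "K 0 = 1" by (rule fps_ext) (simp add: K_def)
      then show ?thesis by (simp only: 0 mult_1)
    next
      case (Suc j)
      have IH: "P (j - l) = K (j - l) * P 0" for l by (rule less) (simp add: Suc)
      have "P (Suc j) = K (Suc j) * P 0"
        unfolding P[of j] K[of j] sum_distrib_right IH by (simp only: mult.assoc)
      then show ?thesis by (simp only: Suc)
    qed
  qed
  then have "fps_nth (P k) n = fps_nth (K k * P 0) n" by (rule arg_cong)
  then show ?thesis by (simp add: P_def K_def fps_mult_nth atLeast0AtMost)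
qed

lemma exp_sum_convolution:
  assumes "exp_summable f" "exp_summable g" "\<And>i. 0 \<le> f i" "\<And>i. 0 \<le> g i"
  shows exp_summable_convolution: "exp_summable (\<lambda>n. \<Sum>i\<le>n. f i * g (n - i))"
    and "t > 0 \<Longrightarrow> exp_sum (\<lambda>n. \<Sum>i\<le>n. f i * g (n - i)) t = exp_sum f t * exp_sum g t"
proof -
  have *: "(\<lambda>n. (\<Sum>i\<le>n. f i * g (n - i)) * exp (- (real n * t))) sums (exp_sum f t * exp_sum g t)" if t: "t > 0" for t
  proof -
    have "summable (\<lambda>n. norm (f n * exp (- (real n * t))))" "summable (\<lambda>n. norm (g n * exp (- (real n * t))))"
      using assms t by (auto simp: exp_summable_def abs_mult)
    from Cauchy_product_sums[OF this]
    have "(\<lambda>n. \<Sum>i\<le>n. f i * exp (- (real i * t)) * (g (n - i) * exp (- (real (n - i) * t)))) sums (exp_sum f t * exp_sum g t)"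
      by (simp add: exp_sum_def)
    also have "(\<lambda>n. \<Sum>i\<le>n. f i * exp (- (real i * t)) * (g (n - i) * exp (- (real (n - i) * t)))) =
       (\<lambda>n. (\<Sum>i\<le>n. f i * g (n - i)) * exp (- (real n * t)))"
    proof
      fix n
      show "(\<Sum>i\<le>n. f i * exp (- (real i * t)) * (g (n - i) * exp (- (real (n - i) * t)))) =
          (\<Sum>i\<le>n. f i * g (n - i)) * exp (- (real n * t))"
        unfolding sum_distrib_right
      proof (rule sum.cong[OF refl])
        fix i assume "i \<in> {..n}"
        then have "exp (- (real i * t)) * exp (- (real (n - i) * t)) = exp (- (real n * t))"
          by (simp add: exp_add[symmetric] of_nat_diff algebra_simps)
        then show "f i * exp (- (real i * t)) * (g (n - i) * exp (- (real (n - i) * t))) =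
            f i * g (n - i) * exp (- (real n * t))"
          by (metis (no_types, lifting) mult.assoc mult.left_commute)
      qed
    qed
    finally show ?thesis .
  qed
  then show "exp_summable (\<lambda>n. \<Sum>i\<le>n. f i * g (n - i))" by (auto simp: exp_summable_def sums_iff)
  show "t > 0 \<Longrightarrow> exp_sum (\<lambda>n. \<Sum>i\<le>n. f i * g (n - i)) t = exp_sum f t * exp_sum g t"
    using * by (auto simp: exp_sum_def sums_iff)
qed

lemma divisor_sum_exp:
  assumes "l \<ge> 1"
  shows exp_summable_divisor_sum: "exp_summable (divisor_sum l)"
    and exp_sum_divisor_sum: "t > 0 \<Longrightarrow> exp_sum (divisor_sum l) t = divisor_series 0 l t"
proof -
  have "(\<lambda>i. divisor_sum l i * exp (- (real i * t))) sums divisor_series 0 l t" if "t > 0" for t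
  proof -
    have "(\<lambda>i. divisor_sum l (Suc i) * exp (- (real (Suc i) * t))) sums divisor_series 0 l t"
      using divisor_series_sums[OF assms that, of 0] by (simp add: divisor_series_def sums_iff)
    then show ?thesis by (subst (asm) sums_Suc_iff) simp
  qed
  then show "exp_summable (divisor_sum l)" "t > 0 \<Longrightarrow> exp_sum (divisor_sum l) t = divisor_series 0 l t"
    by (auto simp: exp_summable_def exp_sum_def sums_iff)
qed

lemma moment_coeff_nonneg: "0 \<le> moment_coeff k l"
  by (simp add: moment_coeff_def)

text \<open>The three claims share one induction: the product formula for \<open>exp_sum\<close> of
  a convolution needs nonnegativity and summability of the lower kernels. Even \<open>l\<close> drop
  out through \<open>moment_coeff\<close>, so the divisor series always has exponent at least
  1.\<close>

lemma moment_kernel_props: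
  "(\<forall>n. 0 \<le> moment_kernel k n) \<and> exp_summable (moment_kernel k) \<and>
   ((\<lambda>t. t ^ k * exp_sum (moment_kernel k) t) \<longlongrightarrow> lim_moment k) (at_right 0)"
proof (induction k rule: less_induct)
  case (less k)
  show ?case
  proof (cases k)
    case 0
    have "(\<lambda>n. of_bool (n = 0) * exp (- (real n * t))) sums 1" for t
      using sums_single[of 0 "\<lambda>n. exp (- (real n * t))"] by (simp add: of_bool_def if_distrib[of "\<lambda>x. x * _"] cong: if_cong)
    then have "exp_summable (moment_kernel 0)" "exp_sum (moment_kernel 0) t = 1" for t
      by (auto simp: exp_summable_def exp_sum_def sums_iff)
    moreover have "0 \<le> moment_kernel 0 n" for n by simp
    ultimately show ?thesis using 0 by (simp del: moment_kernel.simps)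
  next
    case (Suc j)
    define C where "C = (\<lambda>l n. \<Sum>i\<le>n. divisor_sum l i * moment_kernel (j - l) (n - i))"
    have IH: "\<And>n. 0 \<le> moment_kernel (j - l) n" "exp_summable (moment_kernel (j - l))"
      "((\<lambda>t. t ^ (j - l) * exp_sum (moment_kernel (j - l)) t) \<longlongrightarrow> lim_moment (j - l)) (at_right 0)" for l
      using less[of "j - l"] Suc by auto
    have K: "moment_kernel k n = (\<Sum>l\<le>j. moment_coeff j l * C l n)" for n
      unfolding Suc moment_kernel.simps C_def ..
    have C0: "0 \<le> C l n" for l n
      unfolding C_def by (intro sum_nonneg mult_nonneg_nonneg divisor_sum_nonneg IH)
    have odd1: "l \<ge> 1" if "odd l" for l :: nat using that by (cases l) auto
    have trm: "(\<lambda>n. moment_coeff j l * C l n * exp (- (real n * t))) sums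
        (moment_coeff j l * (divisor_series 0 l t * exp_sum (moment_kernel (j - l)) t))" if t: "t > 0" for l t
    proof (cases "odd l")
      case True
      note l = odd1[OF True]
      have s: "exp_summable (C l)" and e: "exp_sum (C l) t = divisor_series 0 l t * exp_sum (moment_kernel (j - l)) t"
        unfolding C_def using exp_sum_convolution[OF exp_summable_divisor_sum[OF l] IH(2) divisor_sum_nonneg IH(1)] t
          exp_sum_divisor_sum[OF l t] by auto
      have "(\<lambda>n. C l n * exp (- (real n * t))) sums exp_sum (C l) t"
        using s t by (auto simp: exp_summable_def exp_sum_def intro: summable_sums)
      from sums_mult[OF this, of "moment_coeff j l"] show ?thesis by (simp add: e mult.assoc)
    qed (simp add: moment_coeff_def)
    have all: "(\<lambda>n. moment_kernel k n * exp (- (real n * t))) sums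
        (\<Sum>l\<le>j. moment_coeff j l * (divisor_series 0 l t * exp_sum (moment_kernel (j - l)) t))" if t: "t > 0" for t
      unfolding K sum_distrib_right by (intro sums_sum trm t)
    have "((\<lambda>t. \<Sum>l\<le>j. moment_coeff j l * ((t ^ Suc (0 + l) * divisor_series 0 l t) * (t ^ (j - l) * exp_sum (moment_kernel (j - l)) t)))
       \<longlongrightarrow> (\<Sum>l\<le>j. moment_coeff j l * (fact l * zeta_suc l * lim_moment (j - l)))) (at_right 0)"
    proof (rule tendsto_sum)
      fix l assume "l \<in> {..j}"
      show "((\<lambda>t. moment_coeff j l * ((t ^ Suc (0 + l) * divisor_series 0 l t) * (t ^ (j - l) * exp_sum (moment_kernel (j - l)) t)))
        \<longlongrightarrow> moment_coeff j l * (fact l * zeta_suc l * lim_moment (j - l))) (at_right 0)"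
      proof (cases "odd l")
        case True
        from divisor_series_tendsto[OF odd1[OF True], of 0]
        have "((\<lambda>t. t ^ Suc (0 + l) * divisor_series 0 l t) \<longlongrightarrow> fact l * zeta_suc l) (at_right 0)"
          by (simp add: zeta_suc_def)
        then show ?thesis by (rule tendsto_mult[OF tendsto_const tendsto_mult[OF _ IH(3)]])
      qed (simp add: moment_coeff_def)
    qed
    then have "((\<lambda>t. t ^ k * exp_sum (moment_kernel k) t) \<longlongrightarrow> lim_moment k) (at_right 0)"
      unfolding Suc lim_moment.simps
    proof (rule Lim_transform_eventually)
      show "\<forall>\<^sub>F t in at_right 0. (\<Sum>l\<le>j. moment_coeff j l * ((t ^ Suc (0 + l) * divisor_series 0 l t) * (t ^ (j - l) * exp_sum (moment_kernel (j - l)) t)))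
         = t ^ Suc j * exp_sum (moment_kernel (Suc j)) t"
        using eventually_at_right_less[of "0::real"]
      proof eventually_elim
        case (elim t)
        have E: "exp_sum (moment_kernel (Suc j)) t = (\<Sum>l\<le>j. moment_coeff j l * (divisor_series 0 l t * exp_sum (moment_kernel (j - l)) t))"
          using all[OF elim] unfolding Suc exp_sum_def by (rule sums_unique[symmetric])
        show ?case unfolding E sum_distrib_left
        proof (rule sum.cong[OF refl])
          fix l assume "l \<in> {..j}"
          then have "t ^ Suc j = t ^ Suc (0 + l) * t ^ (j - l)" by (simp add: power_add[symmetric])
          then show "moment_coeff j l * ((t ^ Suc (0 + l) * divisor_series 0 l t) * (t ^ (j - l) * exp_sum (moment_kernel (j - l)) t)) =
             t ^ Suc j * (moment_coeff j l * (divisor_series 0 l t * exp_sum (moment_kernel (j - l)) t))"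
            by (simp only: mult_ac)
        qed
      qed
    qed
    moreover have "exp_summable (moment_kernel k)"
      using all by (auto simp: exp_summable_def sums_iff)
    moreover have "0 \<le> moment_kernel k n" for n
      unfolding K by (intro sum_nonneg mult_nonneg_nonneg moment_coeff_nonneg C0)
    ultimately show ?thesis by blast
  qed
qed

text \<open>The leading term of \<open>pair_moment k\<close> once all factors are evaluated at the
  saddle: the Gaussian constant, the squared Euler product, the kernel and the angular scale. At
  even order it is twice the claimed term.\<close>

definition pair_asymp :: "nat \<Rightarrow> nat \<Rightarrow> real" where
  "pair_asymp k n = lim_moment k / pi ^ k * 3 powr (k / 2) * (3 powr (- 3 / 4) / 4) * real n powr (real k / 2 - 5 / 4)
    * exp (2 * pi * sqrt (real n / 3))"

lemma saddle_identity:
  assumes n: "n > 0"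
  defines "t \<equiv> saddle n"
  shows "sqrt (3 / pi) / (2 * pi) * (lim_moment k / t ^ k * (t / (2 * pi) * exp (pi\<^sup>2 / (3 * t))) * t powr (3/2)) * exp (real n * t) =
    pair_asymp k n"
proof -
  define x where "x = 3 * real n"
  have x: "x > 0" using n by (simp add: x_def)
  have t: "t = pi / sqrt x" "t > 0" using n by (simp_all add: t_def x_def saddle_def)
  have e: "exp (pi\<^sup>2 / (3 * t)) * exp (real n * t) = exp (2 * pi * sqrt (real n / 3))"
  proof -
    have s: "sqrt x * sqrt x = x" using x by simp
    have h1: "sqrt (real n / 3) = sqrt x / 3"
    proof (rule real_sqrt_unique)
      show "(sqrt x / 3)\<^sup>2 = real n / 3" using x by (simp add: power_divide) (simp add: x_def)
    qed (use x in simp)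
    have h2: "pi\<^sup>2 / (3 * t) = pi * sqrt x / 3"
      unfolding t(1) using x by (simp add: power2_eq_square)
    have h3: "real n * t = pi * sqrt x / 3"
    proof -
      define y where "y = sqrt x"
      have r: "real n = y * y / 3" unfolding y_def s by (simp add: x_def)
      have "y > 0" using x by (simp add: y_def)
      then show ?thesis unfolding t(1) y_def[symmetric] r by simp
    qed
    show ?thesis unfolding exp_add[symmetric] h1 h2 h3 by simp
  qed
  have ln_x: "ln x = ln 3 + ln (real n)" using n by (simp add: x_def ln_mult)
  have tp: "t = exp (ln pi - ln x / 2)"
    unfolding t(1) using x by (simp add: exp_diff ln_sqrt[symmetric])
  have lnt: "ln t = ln pi - ln x / 2" using tp by (metis ln_exp)
  have sq: "sqrt (3 / pi) = exp ((ln 3 - ln pi) / 2)"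
    by (simp add: powr_half_sqrt[symmetric] powr_def ln_div)
  have a: "sqrt (3 / pi) / (2 * pi) * (1 / t ^ k * (t / (2 * pi)) * t powr (3/2)) =
     1 / pi ^ k * 3 powr (k / 2) * (3 powr (- 3 / 4) / 4) * real n powr (real k / 2 - 5 / 4)"
  proof -
    have p1: "t ^ k = exp (real k * ln t)" using t(2) by (simp add: exp_of_nat_mult)
    have p2: "pi ^ k = exp (real k * ln pi)" by (simp add: exp_of_nat_mult)
    have p3: "t powr (3/2) = exp (3/2 * ln t)" using t(2) by (simp add: powr_def)
    have p4: "t = exp (ln t)" using t(2) by simp
    have p5: "pi = exp (ln pi)" by simp
    have "sqrt (3 / pi) / (2 * pi) * (1 / t ^ k * (t / (2 * pi)) * t powr (3/2)) =
       sqrt (3 / pi) * t * t powr (3/2) / (t ^ k * (pi * pi)) / 4"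
      using t(2) by (simp add: mult_ac)
    also have "\<dots> = exp ((ln 3 - ln pi) / 2 + ln t + 3/2 * ln t - (real k * ln t + (ln pi + ln pi))) / 4"
      unfolding exp_add exp_diff sq[symmetric] p1[symmetric] p3[symmetric] p4[symmetric] p5[symmetric] ..
    \<comment> \<open>With every factor written as an exponential, the identity is linear in
      \<open>ln 3\<close>, \<open>ln pi\<close> and \<open>ln (real n)\<close>.\<close>
    also have "(ln 3 - ln pi) / 2 + ln t + 3/2 * ln t - (real k * ln t + (ln pi + ln pi)) =
       - (real k * ln pi) + (k / 2) * ln 3 + (- 3 / 4) * ln 3 + (real k / 2 - 5 / 4) * ln (real n)"
      unfolding lnt ln_x by (simp add: algebra_simps add_divide_distrib diff_divide_distrib)
    also have "exp \<dots> = 1 / pi ^ k * 3 powr (k / 2) * 3 powr (- 3 / 4) * real n powr (real k / 2 - 5 / 4)"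
      unfolding exp_add exp_minus p2 using n by (simp add: powr_def inverse_eq_divide)
    finally show ?thesis by simp
  qed
  have "sqrt (3 / pi) / (2 * pi) * (lim_moment k / t ^ k * (t / (2 * pi) * exp (pi\<^sup>2 / (3 * t))) * t powr (3/2)) * exp (real n * t) =
    lim_moment k * (sqrt (3 / pi) / (2 * pi) * (1 / t ^ k * (t / (2 * pi)) * t powr (3/2))) * (exp (pi\<^sup>2 / (3 * t)) * exp (real n * t))"
    by simp
  also have "\<dots> = pair_asymp k n"
    unfolding a e pair_asymp_def by simp
  finally show ?thesis .
qed

lemma pair_moment_asymptotics:
  assumes "lim_moment k > 0"
  shows "(\<lambda>n. pair_moment k n / pair_asymp k n) \<longlonglongrightarrow> 1"
proof -
  let ?e = "moment_kernel k"
  let ?a = "pair_moment k"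
  have e: "exp_summable ?e" "\<And>i. 0 \<le> ?e i" and lim: "((\<lambda>t. t ^ k * exp_sum ?e t) \<longlongrightarrow> lim_moment k) (at_right 0)"
    using moment_kernel_props[of k] by auto
  have 1: "(\<lambda>n. ?a n * exp (- (real n * saddle n)) /
      (exp_sum ?e (saddle n) * exp (2 * log_euler (saddle n)) * saddle n powr (3/2))) \<longlonglongrightarrow> sqrt (3 / pi) / (2 * pi)"
    using saddle_point_limit[OF e assms lim] unfolding pair_moment_eq_kernel_convolution[symmetric] .
  have 2: "(\<lambda>n. saddle n ^ k * exp_sum ?e (saddle n)) \<longlonglongrightarrow> lim_moment k"
    by (rule filterlim_compose[OF lim saddle_filterlim])
  have "((\<lambda>t. exp (2 * (log_euler t - pi\<^sup>2 / (6 * t) - ln (t / (2 * pi)) / 2))) \<longlongrightarrow> exp (2 * 0)) (at_right 0)"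
    by (intro tendsto_exp tendsto_mult tendsto_const log_euler_asymptotics)
  from filterlim_compose[OF this saddle_filterlim]
  have 3: "(\<lambda>n. exp (2 * (log_euler (saddle n) - pi\<^sup>2 / (6 * saddle n) - ln (saddle n / (2 * pi)) / 2))) \<longlonglongrightarrow> 1" by simp
  \<comment> \<open>In this product of the three limits \<open>exp_sum\<close> and
    \<open>exp (2 * log_euler _)\<close> cancel, leaving only explicit functions of the
    saddle.\<close>
  have "(\<lambda>n. ?a n * exp (- (real n * saddle n)) /
      (exp_sum ?e (saddle n) * exp (2 * log_euler (saddle n)) * saddle n powr (3/2)) *
      (saddle n ^ k * exp_sum ?e (saddle n)) *
      exp (2 * (log_euler (saddle n) - pi\<^sup>2 / (6 * saddle n) - ln (saddle n / (2 * pi)) / 2)) /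
      (sqrt (3 / pi) / (2 * pi) * lim_moment k)) \<longlonglongrightarrow>
      sqrt (3 / pi) / (2 * pi) * lim_moment k * 1 / (sqrt (3 / pi) / (2 * pi) * lim_moment k)"
    by (intro tendsto_divide tendsto_mult 1 2 3 tendsto_const) (use assms in auto)
  also have "sqrt (3 / pi) / (2 * pi) * lim_moment k * 1 / (sqrt (3 / pi) / (2 * pi) * lim_moment k) = 1"
    using assms by simp
  finally show ?thesis
  proof (rule Lim_transform_eventually)
    have "\<forall>\<^sub>F n in sequentially. saddle n ^ k * exp_sum ?e (saddle n) > 0"
      using order_tendstoD(1)[OF 2 assms] .
    then show "\<forall>\<^sub>F n in sequentially. ?a n * exp (- (real n * saddle n)) /
      (exp_sum ?e (saddle n) * exp (2 * log_euler (saddle n)) * saddle n powr (3/2)) *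
      (saddle n ^ k * exp_sum ?e (saddle n)) *
      exp (2 * (log_euler (saddle n) - pi\<^sup>2 / (6 * saddle n) - ln (saddle n / (2 * pi)) / 2)) /
      (sqrt (3 / pi) / (2 * pi) * lim_moment k) = ?a n / pair_asymp k n"
      using eventually_gt_at_top[of 0]
    proof eventually_elim
      case (elim n)
      define t where "t = saddle n"
      have t: "t > 0" using elim by (simp add: t_def saddle_pos)
      define E where "E = exp_sum ?e t"
      have E: "E \<noteq> 0" using elim(1) by (auto simp: E_def t_def)
      define G where "G = exp (2 * log_euler t)"
      have "exp (2 * (log_euler t - pi\<^sup>2 / (6 * t) - ln (t / (2 * pi)) / 2)) = exp (2 * log_euler t - pi\<^sup>2 / (3 * t) - ln (t / (2 * pi)))"
        by (simp add: algebra_simps)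
      also have "\<dots> = G / exp (pi\<^sup>2 / (3 * t)) / (t / (2 * pi))"
        using t by (simp add: exp_diff G_def)
      finally have g: "exp (2 * (log_euler t - pi\<^sup>2 / (6 * t) - ln (t / (2 * pi)) / 2)) = G / exp (pi\<^sup>2 / (3 * t)) / (t / (2 * pi))" .
      define q where "q = sqrt (3 / pi) / (2 * pi)"
      have q: "q \<noteq> 0" by (simp add: q_def)
      have "?a n * exp (- (real n * t)) / (E * G * t powr (3/2)) * (t ^ k * E) * (G / exp (pi\<^sup>2 / (3 * t)) / (t / (2 * pi))) / (q * lim_moment k) =
         ?a n / (q * (lim_moment k / t ^ k * (t / (2 * pi) * exp (pi\<^sup>2 / (3 * t))) * t powr (3/2)) * exp (real n * t))"
        using t E q assms by (simp add: exp_minus field_simps G_def)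
      also have "q * (lim_moment k / t ^ k * (t / (2 * pi) * exp (pi\<^sup>2 / (3 * t))) * t powr (3/2)) * exp (real n * t) = pair_asymp k n"
        unfolding t_def q_def using elim(2) by (rule saddle_identity)
      finally show ?case unfolding t_def[symmetric] g unfolding G_def[symmetric] E_def[symmetric] q_def[symmetric] .
    qed
  qed
qed

section \<open>Moments of unimodal sequences\<close>

lemma pair_asymp_pos:
  assumes "lim_moment k > 0" "n > 0"
  shows "pair_asymp k n > 0"
  unfolding pair_asymp_def using assms by (intro mult_pos_pos divide_pos_pos) auto

text \<open>A fixed shift changes sqrt(n) by o(1), so the exponential is insensitive to it; this
  permits comparing tied pairs with pairs of size \<open>n + 2 * J\<close>.\<close>

lemma pair_asymp_shift:
  assumes "lim_moment k > 0"
  shows "(\<lambda>n. pair_asymp k (n + m) / pair_asymp k n) \<longlonglongrightarrow> 1"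
proof -
  define c where "c = lim_moment k / pi ^ k * 3 powr (k / 2) * (3 powr (- 3 / 4) / 4)"
  have c: "c \<noteq> 0" using assms by (auto simp: c_def)
  define a where "a = real k / 2 - 5 / 4"
  define h where "h = real m"
  have eq: "pair_asymp k n = c * (real n powr a * exp (2 * pi * sqrt (real n / 3)))" for n
    by (simp add: pair_asymp_def c_def a_def)
  have "(\<lambda>n::nat. (real n + h) powr a * exp (2 * pi * sqrt ((real n + h) / 3)) / (real n powr a * exp (2 * pi * sqrt (real n / 3)))) \<longlonglongrightarrow> 1"
    by real_asymp
  then show ?thesis unfolding eq using c by (simp add: h_def)
qed

lemma pair_asymp_0_ratio:
  assumes "lim_moment k > 0" "k > 0"
  shows "(\<lambda>n. pair_asymp 0 n / pair_asymp k n) \<longlonglongrightarrow> 0"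
proof -
  define c where "c = lim_moment k / pi ^ k * 3 powr (k / 2)"
  have c: "c \<noteq> 0" using assms by (auto simp: c_def)
  define a where "a = real k / 2"
  have a: "a > 0" using assms by (simp add: a_def)
  have "(\<lambda>n::nat. 1 / c * real n powr (- a)) \<longlonglongrightarrow> 1 / c * 0"
    by (intro tendsto_mult tendsto_const) (use a in real_asymp)
  then have "(\<lambda>n::nat. 1 / c * real n powr (- a)) \<longlonglongrightarrow> 0" by simp
  then show ?thesis
  proof (rule Lim_transform_eventually)
    show "\<forall>\<^sub>F n in sequentially. 1 / c * real n powr (- a) = pair_asymp 0 n / pair_asymp k n"
      using eventually_gt_at_top[of 0]
    proof eventually_elim
      case (elim n)
      define E where "E = (3 powr (- 3 / 4) / 4) * exp (2 * pi * sqrt (real n / 3))"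
      have E: "E \<noteq> 0" by (simp add: E_def)
      have 0: "pair_asymp 0 n = real n powr (- 5 / 4) * E"
        by (simp add: pair_asymp_def E_def)
      have "pair_asymp k n = c * real n powr (a + - 5 / 4) * E"
        by (simp add: pair_asymp_def E_def c_def a_def)
      also have "\<dots> = c * (real n powr a * real n powr (- 5 / 4)) * E"
        by (simp only: powr_add)
      finally have k: "pair_asymp k n = c * (real n powr a * real n powr (- 5 / 4)) * E" .
      define r where "r = real n powr (- 5 / 4)"
      define p where "p = real n powr a"
      have "r \<noteq> 0" "p \<noteq> 0" using elim by (auto simp: r_def p_def)
      then show ?case unfolding 0 k powr_minus r_def[symmetric] p_def[symmetric]
        using E c by (simp add: field_simps)
    qed
  qed
qed

text \<open>For fixed \<open>J\<close> the tied moment is at most 1/(J+1) of the full moment at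
  \<open>n + 2 * J\<close>, whose order is that at \<open>n\<close>; then \<open>J\<close> is
  arbitrary.\<close>

lemma tied_moment_negligible:
  fixes k :: nat
  shows "(\<lambda>n. (\<Sum>p\<in>tied_pairs n. real_of_int (pair_rank p) ^ (2 * k)) / pair_asymp (2 * k) n) \<longlonglongrightarrow> 0"
proof -
  let ?f = "pair_asymp (2 * k)"
  let ?A = "pair_moment (2 * k)"
  define T where "T = (\<lambda>n. \<Sum>p\<in>tied_pairs n. real_of_int (pair_rank p) ^ (2 * k))"
  have f: "?f n > 0" if "n > 0" for n by (rule pair_asymp_pos[OF lim_moment_even_pos that])
  have T0: "0 \<le> T n" for n unfolding T_def by (intro sum_nonneg) simp
  have "(\<lambda>n. T n / ?f n) \<longlonglongrightarrow> 0"
  proof (rule tendstoI)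
    fix \<epsilon> :: real assume \<epsilon>: "\<epsilon> > 0"
    obtain J :: nat where J: "1 / \<epsilon> < real J" using reals_Archimedean2 by blast
    have J0: "real (Suc J) > 1 / \<epsilon>" using J by simp
    have "(\<lambda>n. ?A (n + 2 * J) / ?f (n + 2 * J) * (?f (n + 2 * J) / ?f n) / real (Suc J)) \<longlonglongrightarrow> 1 * 1 / real (Suc J)"
      by (intro tendsto_divide tendsto_mult tendsto_const pair_asymp_shift lim_moment_even_pos
          LIMSEQ_ignore_initial_segment[OF pair_moment_asymptotics[OF lim_moment_even_pos[of k]]]) auto
    moreover have "1 * 1 / real (Suc J) < \<epsilon>" using J0 \<epsilon> by (simp add: field_simps)
    ultimately have "\<forall>\<^sub>F n in sequentially. ?A (n + 2 * J) / ?f (n + 2 * J) * (?f (n + 2 * J) / ?f n) / real (Suc J) < \<epsilon>"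
      by (rule order_tendstoD(2))
    then show "\<forall>\<^sub>F n in sequentially. dist (T n / ?f n) 0 < \<epsilon>"
      using eventually_gt_at_top[of 0]
    proof eventually_elim
      case (elim n)
      have "real (Suc J) * T n \<le> ?A (n + 2 * J)"
        unfolding T_def pair_moment_def
        by (rule sum_tied_pairs_le[where f = "\<lambda>x. real_of_int x ^ (2 * k)"]) simp
      then have "T n \<le> ?A (n + 2 * J) / real (Suc J)" by (simp add: field_simps)
      then have "T n / ?f n \<le> ?A (n + 2 * J) / real (Suc J) / ?f n"
        using f[OF elim(2)] by (intro divide_right_mono) auto
      also have "\<dots> = ?A (n + 2 * J) / ?f (n + 2 * J) * (?f (n + 2 * J) / ?f n) / real (Suc J)"
        using f[of "n + 2 * J"] elim(2) by simp
      also have "\<dots> < \<epsilon>" by (rule elim(1))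
      finally show ?case using T0[of n] f[OF elim(2)] by (simp add: dist_real_def)
    qed
  qed
  then show ?thesis by (simp add: T_def)
qed

text \<open>The quotient of (1-x)^(2k) and x^(2k) tends to 1 at both ends, and \<open>C\<close>
  absorbs the finitely many exceptions. This replaces \<open>1 - D\<close> by \<open>D\<close> at
  the cost of a small multiple of the moment and a multiple of the number of pairs.\<close>

lemma shifted_power_le:
  fixes \<epsilon> :: real
  assumes "\<epsilon> > 0"
  obtains C where "\<And>x::int. \<bar>(1 - real_of_int x) ^ (2 * k) - real_of_int x ^ (2 * k)\<bar> \<le> \<epsilon> * real_of_int x ^ (2 * k) + C"
proof -
  let ?d = "\<lambda>x::real. \<bar>(1 - x) ^ (2 * k) - x ^ (2 * k)\<bar>"
  have lim: "((\<lambda>x::real. ((1 - x) / x) ^ (2 * k)) \<longlongrightarrow> (-1) ^ (2 * k)) F" if "((\<lambda>x::real. (1 - x) / x) \<longlongrightarrow> -1) F" for F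
    using tendsto_power[OF that] .
  have top: "\<forall>\<^sub>F x in at_top. dist (((1 - x) / x) ^ (2 * k)) ((-1::real) ^ (2 * k)) < \<epsilon>"
    by (rule tendstoD[OF lim assms]) real_asymp
  have bot: "\<forall>\<^sub>F x in at_bot. dist (((1 - x) / x) ^ (2 * k)) ((-1::real) ^ (2 * k)) < \<epsilon>"
    by (rule tendstoD[OF lim assms]) real_asymp
  obtain a where a: "\<And>x. x \<ge> a \<Longrightarrow> dist (((1 - x) / x) ^ (2 * k)) ((-1::real) ^ (2 * k)) < \<epsilon>"
    using top by (auto simp: eventually_at_top_linorder)
  obtain b where b: "\<And>x. x \<le> b \<Longrightarrow> dist (((1 - x) / x) ^ (2 * k)) ((-1::real) ^ (2 * k)) < \<epsilon>"
    using bot by (auto simp: eventually_at_bot_linorder)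
  define S where "S = {min 0 \<lfloor>b\<rfloor>..max 0 \<lceil>a\<rceil>}"
  show ?thesis
  proof (rule that[of "\<Sum>x\<in>S. ?d (real_of_int x)"])
    fix x :: int
    have nn: "0 \<le> (\<Sum>x\<in>S. ?d (real_of_int x))" by (intro sum_nonneg) auto
    show "?d (real_of_int x) \<le> \<epsilon> * real_of_int x ^ (2 * k) + (\<Sum>x\<in>S. ?d (real_of_int x))"
    proof (cases "x \<in> S")
      case True
      have "?d (real_of_int x) \<le> (\<Sum>x\<in>S. ?d (real_of_int x))"
        by (rule member_le_sum[OF True]) (auto simp: S_def)
      moreover have "0 \<le> \<epsilon> * real_of_int x ^ (2 * k)" using assms by simp
      ultimately show ?thesis by linarith
    next
      case False
      then have "x \<noteq> 0" "real_of_int x \<ge> a \<or> real_of_int x \<le> b"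
        by (auto simp: S_def) linarith+
      then have x: "real_of_int x ^ (2 * k) > 0" and d: "\<bar>((1 - real_of_int x) / real_of_int x) ^ (2 * k) - 1\<bar> < \<epsilon>"
        using a[of "real_of_int x"] b[of "real_of_int x"] by (auto simp: dist_real_def zero_less_power_eq)
      have "?d (real_of_int x) = \<bar>((1 - real_of_int x) / real_of_int x) ^ (2 * k) - 1\<bar> * real_of_int x ^ (2 * k)"
      proof -
        have eq: "((1 - real_of_int x) / real_of_int x) ^ (2 * k) - 1 = ((1 - real_of_int x) ^ (2 * k) - real_of_int x ^ (2 * k)) / real_of_int x ^ (2 * k)"
        proof -
          have "A / B - 1 = (A - B) / B" if "B > 0" for A B :: real
            using that by (simp add: diff_divide_distrib)
          from this[OF x] show ?thesis unfolding power_divide .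
        qed
        have "\<bar>D\<bar> = \<bar>D / B\<bar> * B" if "B > 0" for B D :: real using that by simp
        from this[OF x] show ?thesis unfolding eq .
      qed
      also have "\<dots> \<le> \<epsilon> * real_of_int x ^ (2 * k)"
        using d x by (intro mult_right_mono) auto
      finally show ?thesis using nn by linarith
    qed
  qed
qed

lemma peak_moment_ratio:
  "(\<lambda>n. (\<Sum>p\<in>peak_pairs n. real_of_int (pair_rank p) ^ (2 * k)) / pair_asymp (2 * k) n) \<longlonglongrightarrow> 1 / 2"
proof -
  have "(\<lambda>n. (pair_moment (2 * k) n / pair_asymp (2 * k) n +
      (\<Sum>p\<in>tied_pairs n. real_of_int (pair_rank p) ^ (2 * k)) / pair_asymp (2 * k) n) / 2) \<longlonglongrightarrow> (1 + 0) / 2"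
    by (intro tendsto_divide tendsto_add tendsto_const pair_moment_asymptotics lim_moment_even_pos tied_moment_negligible) auto
  then have "(\<lambda>n. (pair_moment (2 * k) n / pair_asymp (2 * k) n +
      (\<Sum>p\<in>tied_pairs n. real_of_int (pair_rank p) ^ (2 * k)) / pair_asymp (2 * k) n) / 2) \<longlonglongrightarrow> 1 / 2" by simp
  then show ?thesis
  proof (rule Lim_transform_eventually)
    show "\<forall>\<^sub>F n in sequentially. (pair_moment (2 * k) n / pair_asymp (2 * k) n +
      (\<Sum>p\<in>tied_pairs n. real_of_int (pair_rank p) ^ (2 * k)) / pair_asymp (2 * k) n) / 2 =
      (\<Sum>p\<in>peak_pairs n. real_of_int (pair_rank p) ^ (2 * k)) / pair_asymp (2 * k) n"
      using eventually_gt_at_top[of 0]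
    proof eventually_elim
      case (elim n)
      have "2 * (\<Sum>p\<in>peak_pairs n. real_of_int (pair_rank p) ^ (2 * k)) =
        pair_moment (2 * k) n + (\<Sum>p\<in>tied_pairs n. real_of_int (pair_rank p) ^ (2 * k))"
        unfolding pair_moment_def by (rule sum_peak_pairs[OF elim]) (simp add: pair_rank_swap)
      then have "(\<Sum>p\<in>peak_pairs n. real_of_int (pair_rank p) ^ (2 * k)) =
        (pair_moment (2 * k) n + (\<Sum>p\<in>tied_pairs n. real_of_int (pair_rank p) ^ (2 * k))) / 2"
        by (metis nonzero_mult_div_cancel_left zero_neq_numeral)
      then show ?case by (simp only: add_divide_distrib divide_divide_eq_left mult.commute)
    qed
  qed
qed

text \<open>For positive \<open>k\<close> the number of pairs is smaller than the moment by a factor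
  of order n^(-k), so the constant \<open>C\<close> of the shift disappears. For
  \<open>k = 0\<close> that comparison fails, but there the shift has no effect.\<close>

lemma u_moment_ratio: "(\<lambda>n. u_moment (2 * k) n / pair_asymp (2 * k) n) \<longlonglongrightarrow> 1 / 2"
proof (cases "k = 0")
  case True
  then show ?thesis using peak_moment_ratio[of 0] by (simp add: u_moment_eq_sum_peak)
next
  case False
  let ?f = "pair_asymp (2 * k)"
  define V where "V = (\<lambda>n. \<Sum>p\<in>peak_pairs n. real_of_int (pair_rank p) ^ (2 * k))"
  have V: "(\<lambda>n. V n / ?f n) \<longlonglongrightarrow> 1 / 2" unfolding V_def by (rule peak_moment_ratio)
  have f: "?f n > 0" if "n > 0" for n by (rule pair_asymp_pos[OF lim_moment_even_pos that])
  have P0: "(\<lambda>n. pair_moment 0 n / ?f n) \<longlonglongrightarrow> 0"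
  proof -
    have "(\<lambda>n. pair_moment 0 n / pair_asymp 0 n * (pair_asymp 0 n / ?f n)) \<longlonglongrightarrow> 1 * 0"
      by (intro tendsto_mult pair_moment_asymptotics pair_asymp_0_ratio lim_moment_even_pos) (use False in auto)
    then have "(\<lambda>n. pair_moment 0 n / pair_asymp 0 n * (pair_asymp 0 n / ?f n)) \<longlonglongrightarrow> 0" by simp
    then show ?thesis
    proof (rule Lim_transform_eventually)
      show "\<forall>\<^sub>F n in sequentially. pair_moment 0 n / pair_asymp 0 n * (pair_asymp 0 n / ?f n) = pair_moment 0 n / ?f n"
        using eventually_gt_at_top[of 0]
      proof eventually_elim
        case (elim n)
        show ?case using pair_asymp_pos[of 0 n] elim by simp
      qed
    qed
  qed
  have "(\<lambda>n. (u_moment (2 * k) n - V n) / ?f n) \<longlonglongrightarrow> 0"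
  proof (rule tendstoI)
    fix \<epsilon> :: real assume \<epsilon>: "\<epsilon> > 0"
    obtain C where C: "\<And>x::int. \<bar>(1 - real_of_int x) ^ (2 * k) - real_of_int x ^ (2 * k)\<bar> \<le> \<epsilon> * real_of_int x ^ (2 * k) + C"
      using shifted_power_le[OF \<epsilon>] by blast
    have C0: "0 \<le> C" using C[of 0] False by (simp add: zero_power)
    have "(\<lambda>n. \<epsilon> * (V n / ?f n) + C * (pair_moment 0 n / ?f n)) \<longlonglongrightarrow> \<epsilon> * (1 / 2) + C * 0"
      by (intro tendsto_add tendsto_mult tendsto_const V P0)
    moreover have "\<epsilon> * (1 / 2) + C * 0 < \<epsilon>" using \<epsilon> by simp
    ultimately have "\<forall>\<^sub>F n in sequentially. \<epsilon> * (V n / ?f n) + C * (pair_moment 0 n / ?f n) < \<epsilon>"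
      by (rule order_tendstoD(2))
    then show "\<forall>\<^sub>F n in sequentially. dist ((u_moment (2 * k) n - V n) / ?f n) 0 < \<epsilon>"
      using eventually_gt_at_top[of 0]
    proof eventually_elim
      case (elim n)
      have "u_moment (2 * k) n - V n =
          (\<Sum>p\<in>peak_pairs n. (1 - real_of_int (pair_rank p)) ^ (2 * k) - real_of_int (pair_rank p) ^ (2 * k))"
        by (simp add: u_moment_eq_sum_peak V_def sum_subtractf)
      also have "\<bar>\<dots>\<bar> \<le> (\<Sum>p\<in>peak_pairs n. \<epsilon> * real_of_int (pair_rank p) ^ (2 * k) + C)"
        by (rule order_trans[OF sum_abs]) (intro sum_mono C)
      also have "\<dots> = \<epsilon> * V n + C * real (card (peak_pairs n))"
        by (simp add: sum.distrib V_def sum_distrib_left)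
      also have "\<dots> \<le> \<epsilon> * V n + C * pair_moment 0 n"
      proof -
        have "card (peak_pairs n) \<le> card (partition_pairs n)"
          by (rule card_mono[OF finite_partition_pairs]) (auto simp: peak_pairs_def)
        then show ?thesis using C0 by (intro add_left_mono mult_left_mono) (auto simp: pair_moment_def)
      qed
      finally have "\<bar>u_moment (2 * k) n - V n\<bar> / ?f n \<le> (\<epsilon> * V n + C * pair_moment 0 n) / ?f n"
        using f[OF elim(2)] by (intro divide_right_mono) auto
      also have "\<dots> = \<epsilon> * (V n / ?f n) + C * (pair_moment 0 n / ?f n)"
        by (simp add: add_divide_distrib)
      also have "\<dots> < \<epsilon>" by (rule elim(1))
      finally show ?case using f[OF elim(2)] by (simp add: dist_real_def abs_divide)
    qed
  qed
  from tendsto_add[OF this V] show ?thesis by (simp add: add_divide_distrib[symmetric])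
qed

theorem theorem1p1:
  fixes k :: nat
  shows "(\<lambda>n::nat. u_moment (2 * k) n) \<sim>[at_top]
    (\<lambda>n::nat. (-1) ^ k * 2 powr (2 * real k - 3) * 3 powr (real k - 3 / 4)
       * bernoulli_poly (2 * k) (1 / 2) * real n powr (real k - 5 / 4)
       * exp (2 * pi * sqrt (real n / 3)))"
proof -
  let ?g = "\<lambda>n::nat. (-1) ^ k * 2 powr (2 * real k - 3) * 3 powr (real k - 3 / 4)
       * bernoulli_poly (2 * k) (1 / 2) * real n powr (real k - 5 / 4)
       * exp (2 * pi * sqrt (real n / 3))"
  have eq: "?g n = pair_asymp (2 * k) n / 2" for n
  proof -
    \<comment> \<open>The 8 is the 4 in \<open>pair_asymp\<close> times the 2 from passing to half
      of the pairs.\<close>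
    have 1: "2 powr (2 * real k - 3) = 2 ^ (2 * k) / (8::real)"
    proof -
      have "2 powr (2 * real k - 3) = 2 powr (real (2 * k)) / (2::real) powr 3"
        by (simp add: powr_diff)
      also have "\<dots> = 2 ^ (2 * k) / 8"
        by (subst powr_realpow) (simp_all add: powr_numeral)
      finally show ?thesis .
    qed
    have 2: "3 powr (real k - 3 / 4) = 3 powr (real (2 * k) / 2) * (3::real) powr (- 3 / 4)"
      by (simp add: powr_add[symmetric])
    have 3: "lim_moment (2 * k) / pi ^ (2 * k) = (-1) ^ k * 2 ^ (2 * k) * bernoulli_poly (2 * k) (1 / 2)"
      unfolding lim_moment_even by (simp add: power_mult_distrib)
    show ?thesis unfolding pair_asymp_def 1 2 3 by simp
  qed
  have "u_moment (2 * k) n / ?g n = 2 * (u_moment (2 * k) n / pair_asymp (2 * k) n)" for n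
    unfolding eq by simp
  moreover have "(\<lambda>n. 2 * (u_moment (2 * k) n / pair_asymp (2 * k) n)) \<longlonglongrightarrow> 2 * (1 / 2)"
    by (intro tendsto_mult tendsto_const u_moment_ratio)
  ultimately have "(\<lambda>n. u_moment (2 * k) n / ?g n) \<longlonglongrightarrow> 1" by simp
  then show ?thesis by (rule asymp_equivI')
qed

end
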